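(* In the setting described in the context (data $x_1,\dots,x_n$, loss functions $l_j$ that are $\gamma$-smooth and strictly convex, convex $R$ with bounded domain containing $0$ and attained linear subproblems), run either the Stochastic Generalized Frank-Wolfe method (Algorithm 1) or the Randomized Dual Coordinate Mirror Descent method (Algorithm 2) with step-sizes $$\alpha_i=\frac{2(2n+i)}{(i+1)(4n+i)},\qquad \eta_i=\frac{2n}{2n+i+1},\qquad i=0,1,\dots,$$ and denote $$\bar w^{k}=\frac{2}{(4n+k)(k+1)}\sum_{i=0}^k(2n+i)\,w^i .$$ Let $D_{\max}$ be any real number such that $D_h(\hat w,w^0)\le D_{\max}$ for all $\hat w\in\mathcal W$. Then for all $k\ge 0$, $$\mathbb E_{\xi_k}\left[P(\bar\beta^k)-D(\bar w^k)\right]\le \frac{8n\gamma M^{2}}{4n+k}+\frac{2n(2n-1)D_{\max}}{(4n+k)(k+1)},$$ and (since $D_{\max}$ can be chosen to be at most $\gamma M^2$) the right-hand side with such a choice is in turn bounded above by $$\frac{8n\gamma M^{2}}{4n+k}+\frac{2n(2n-1)\gamma M^2}{(4n+k)(k+1)},$$ so that $\mathbb E_{\xi_k}[P(\bar\beta^k)-D(\bar w^k)]$ is also at most this last quantity.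
   Context: Setting. Let $n,p\ge1$, $x_1,\dots,x_n\in\mathbb R^p$, and let $X\in\mathbb R^{n\times p}$ be the matrix whose $j$-th row is $x_j^T$. For $j=1,\dots,n$, $l_j:\mathbb R\to\mathbb R$ is strictly convex and $\gamma$-smooth, i.e. differentiable with derivative $\dot l_j$ satisfying $|\dot l_j(a)-\dot l_j(b)|\le\gamma|a-b|$ for all $a,b$. $R:\mathbb R^p\to\mathbb R\cup\{+\infty\}$ is convex, $\operatorname{dom}R=\{\beta: R(\beta)<+\infty\}$ is bounded and contains $0$, and $\min_\beta c^T\beta+R(\beta)$ is attained for every $c\in\mathbb R^p$. Conjugates: $f^*(y)=\sup_x\{y^Tx-f(x)\}$. Each $l_j^*$ is differentiable on the range of $\dot l_j$ (the interior of its domain), with derivative $\dot l_j^*$, and $u=\dot l_j(s)\iff s=\dot l_j^*(u)$. Put $L(s)=\sum_j l_j(s_j)$ and $L^*(w)=\sum_j l_j^*(w_j)$. Primal and dual objectives and saddle function: $P(\beta)=\frac1n\sum_{j=1}^n l_j(x_j^T\beta)+R(\beta)$ (to be minimized), $D(w)=-R^*(-\frac1nX^Tw)-\frac1n\sum_{j=1}^n l_j^*(w_j)$ (to be maximized), $\phi(\beta,w)=\frac1n w^TX\beta-\frac1n\sum_{j=1}^n l_j^*(w_j)+R(\beta)$. $h(w)=\frac1n\sum_{j=1}^n l_j^*(w_j)$, and $D_h(w_1,w_2)=h(w_1)-h(w_2)-\langle\nabla h(w_2),w_1-w_2\rangle$ is its Bregman distance. $M=\max_{\beta\in\operatorname{dom}R}\max_{j}|x_j^T\beta|$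 (understood as a supremum; finite). $\mathcal W=\{\hat w\in\mathbb R^n:\hat w\in\arg\max_w\phi(\hat\beta,w)\text{ for some }\hat\beta\in\operatorname{dom}R\}$. Algorithm 1. Step-sizes $\alpha_i,\eta_i\in(0,1]$. Initialize $\bar\beta^{-1}=0$, $s^0=0\in\mathbb R^n$, $d^0=\frac1nX^T\nabla L(s^0)$. For $i=0,1,\dots$: compute some $\tilde\beta^i\in\arg\min_\beta\{(d^i)^T\beta+R(\beta)\}$; choose $j_i$ uniformly at random in $\{1,\dots,n\}$, independently of the past; set $s^{i+1}_{j_i}=(1-\eta_i)s^i_{j_i}+\eta_i x_{j_i}^T\tilde\beta^i$ and $s^{i+1}_j=s^i_j$ for $j\ne j_i$; set $d^{i+1}=\frac1nX^T\nabla L(s^{i+1})$; set $\bar\beta^i=(1-\alpha_i)\bar\beta^{i-1}+\alpha_i\tilde\beta^i$. Also $w^i=\nabla L(s^i)$ for all $i\ge0$. Algorithm 2. Step-sizes $\alpha_i,\eta_i\in(0,1]$. Initialize $w^0=\arg\min_w h(w)$, $\bar\beta^{-1}=0$. For $i=0,1,\dots$: compute some $\tilde\beta^i\in\arg\min_\beta\{\frac1n(w^i)^TX\beta+R(\beta)\}$; choose $j_i$ uniformly at random in $\{1,\dots,n\}$, independently of the past; set $\tilde g^i=\frac1n\big(x_{j_i}^T\tilde\beta^i-\dot l^*_{j_i}(w^i_{j_i})\big)e_{j_i}$, with $e_j$ the $j$-th unit vector of $\mathbb R^n$; set $w^{i+1}=\arg\min_w\{\langle-\eta_i\tilde g^i,w-w^i\rangle+D_h(w,w^i)\}$;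 set $\bar\beta^i=(1-\alpha_i)\bar\beta^{i-1}+\alpha_i\tilde\beta^i$. $\tilde\beta^i$ is chosen before $j_i$ is drawn (it depends only on the past). $\xi_k=\{j_0,\dots,j_{k-1}\}$ and $\mathbb E_{\xi_k}$ is expectation over these indices. *)

theory Defs
  imports "HOL-Probability.Probability"
begin

section \<open>Extended-real-valued convex analysis\<close>

definition edom :: "('a \<Rightarrow> ereal) \<Rightarrow> 'a set" where
  "edom f = {x. f x < \<infinity>}"

text \<open>In \<^typ>\<open>ereal\<close> one has \<open>0 * \<infinity> = 0\<close>, so the end points \<open>t = 0\<close> and \<open>t = 1\<close> are
  harmless; excluding the value \<open>- \<infinity>\<close> keeps the right-hand side free of \<open>\<infinity> - \<infinity>\<close>.\<close>

definition econvex :: "('a::real_vector \<Rightarrow> ereal) \<Rightarrow> bool" where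
  "econvex f \<longleftrightarrow> (\<forall>x. f x \<noteq> -\<infinity>) \<and>
     (\<forall>x y. \<forall>t\<in>{0..1}. f ((1 - t) *\<^sub>R x + t *\<^sub>R y) \<le> ereal (1 - t) * f x + ereal t * f y)"

definition strictly_convex :: "('a::real_vector \<Rightarrow> real) \<Rightarrow> bool" where
  "strictly_convex f \<longleftrightarrow>
     (\<forall>x y. \<forall>t\<in>{0<..<1}. x \<noteq> y \<longrightarrow> f ((1 - t) *\<^sub>R x + t *\<^sub>R y) < (1 - t) * f x + t * f y)"

definition smooth_with :: "real \<Rightarrow> (real \<Rightarrow> real) \<Rightarrow> bool" where
  "smooth_with \<gamma> f \<longleftrightarrow> (\<forall>x. f differentiable (at x)) \<and>
     (\<forall>a b. \<bar>deriv f a - deriv f b\<bar> \<le> \<gamma> * \<bar>a - b\<bar>)"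

definition fconj :: "('a::real_inner \<Rightarrow> ereal) \<Rightarrow> 'a \<Rightarrow> ereal" where
  "fconj f y = (SUP x. ereal (y \<bullet> x) - f x)"

definition grad :: "('a::real_inner \<Rightarrow> real) \<Rightarrow> 'a \<Rightarrow> 'a" where
  "grad f x = (THE D. GDERIV f x :> D)"

text \<open>The gradient is meaningful at points \<open>v\<close> where \<open>h\<close> is finite in a neighbourhood and
  differentiable. The value is \<open>\<infinity>\<close> when \<open>u\<close> lies outside the domain of \<open>h\<close>, so that minimising
  over all \<open>u\<close> amounts to minimising over that domain.\<close>

definition bregman :: "('a::real_inner \<Rightarrow> ereal) \<Rightarrow> 'a \<Rightarrow> 'a \<Rightarrow> ereal" where
  "bregman h u v = h u - h v - ereal (grad (\<lambda>x. real_of_ereal (h x)) v \<bullet> (u - v))"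


section \<open>The optimization problem\<close>

text \<open>The index types give \<open>n = CARD('n)\<close> and \<open>p = CARD('p)\<close>; the data point \<open>x\<^sub>j\<close> is the row
  \<open>X $ j\<close>.\<close>

definition lstar :: "('n \<Rightarrow> real \<Rightarrow> real) \<Rightarrow> 'n \<Rightarrow> real \<Rightarrow> ereal" where
  "lstar l j = fconj (\<lambda>x. ereal (l j x))"

definition dlstar :: "('n \<Rightarrow> real \<Rightarrow> real) \<Rightarrow> 'n \<Rightarrow> real \<Rightarrow> real" where
  "dlstar l j = deriv (\<lambda>u. real_of_ereal (lstar l j u))"

definition Lfun :: "('n::finite \<Rightarrow> real \<Rightarrow> real) \<Rightarrow> real^'n \<Rightarrow> real" where
  "Lfun l s = (\<Sum>j\<in>UNIV. l j (s $ j))"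

definition hfun :: "('n::finite \<Rightarrow> real \<Rightarrow> real) \<Rightarrow> real^'n \<Rightarrow> ereal" where
  "hfun l w = ereal (1 / real CARD('n)) * (\<Sum>j\<in>UNIV. lstar l j (w $ j))"

definition primal :: "real^'p^'n \<Rightarrow> ('n::finite \<Rightarrow> real \<Rightarrow> real) \<Rightarrow> (real^'p \<Rightarrow> ereal)
    \<Rightarrow> real^'p \<Rightarrow> ereal" where
  "primal X l R b = ereal (1 / real CARD('n) * (\<Sum>j\<in>UNIV. l j (X $ j \<bullet> b))) + R b"

definition dual :: "real^'p^'n \<Rightarrow> ('n::finite \<Rightarrow> real \<Rightarrow> real) \<Rightarrow> (real^'p \<Rightarrow> ereal)
    \<Rightarrow> real^'n \<Rightarrow> ereal" where
  "dual X l R w = - fconj R (- ((1 / real CARD('n)) *\<^sub>R (transpose X *v w))) - hfun l w"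

text \<open>Only used for \<open>b\<close> in the domain of \<open>R\<close>; otherwise \<open>\<infinity> - \<infinity>\<close> may occur.\<close>

definition saddle :: "real^'p^'n \<Rightarrow> ('n::finite \<Rightarrow> real \<Rightarrow> real) \<Rightarrow> (real^'p \<Rightarrow> ereal)
    \<Rightarrow> real^'p \<Rightarrow> real^'n \<Rightarrow> ereal" where
  "saddle X l R b w = ereal (1 / real CARD('n) * (w \<bullet> (X *v b))) - hfun l w + R b"

definition data_bound :: "real^'p^'n \<Rightarrow> (real^'p \<Rightarrow> ereal) \<Rightarrow> real" where
  "data_bound X R = (SUP b\<in>edom R. Max (range (\<lambda>j. \<bar>X $ j \<bullet> b\<bar>)))"

definition Wset :: "real^'p^'n \<Rightarrow> ('n::finite \<Rightarrow> real \<Rightarrow> real) \<Rightarrow> (real^'p \<Rightarrow> ereal)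
    \<Rightarrow> (real^'n) set" where
  "Wset X l R = {wh. \<exists>bh\<in>edom R. is_arg_max (saddle X l R bh) (\<lambda>_. True) wh}"


section \<open>The algorithms\<close>

text \<open>The predicates describe a single run along a realised index sequence \<open>J\<close>. The averages are
  shifted by one: \<open>bbar 0\<close> is the initial average with index \<open>-1\<close>, and \<open>bbar (Suc i)\<close>
  is the average with index \<open>i\<close>. The predicate \<open>sgfw_run\<close> is the stochastic
  generalized Frank-Wolfe method, \<open>rdcmd_run\<close> randomized dual coordinate mirror descent.\<close>

definition averages :: "(nat \<Rightarrow> real) \<Rightarrow> (nat \<Rightarrow> real^'p) \<Rightarrow> (nat \<Rightarrow> real^'p) \<Rightarrow> bool" where
  "averages \<alpha> bt bbar \<longleftrightarrow> bbar 0 = 0 \<and>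
     (\<forall>i. bbar (Suc i) = (1 - \<alpha> i) *\<^sub>R bbar i + \<alpha> i *\<^sub>R bt i)"

definition sgfw_run :: "real^'p^'n \<Rightarrow> ('n::finite \<Rightarrow> real \<Rightarrow> real) \<Rightarrow> (real^'p \<Rightarrow> ereal)
    \<Rightarrow> (nat \<Rightarrow> real) \<Rightarrow> (nat \<Rightarrow> real) \<Rightarrow> (nat \<Rightarrow> 'n) \<Rightarrow> (nat \<Rightarrow> real^'p) \<Rightarrow> (nat \<Rightarrow> real^'p)
    \<Rightarrow> (nat \<Rightarrow> real^'n) \<Rightarrow> (nat \<Rightarrow> real^'p) \<Rightarrow> (nat \<Rightarrow> real^'n) \<Rightarrow> bool" where
  "sgfw_run X l R \<alpha> \<eta> J bt bbar s d w \<longleftrightarrow>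
     s 0 = 0 \<and>
     (\<forall>i. w i = grad (Lfun l) (s i)) \<and>
     (\<forall>i. d i = (1 / real CARD('n)) *\<^sub>R (transpose X *v grad (Lfun l) (s i))) \<and>
     (\<forall>i. is_arg_min (\<lambda>b. ereal (d i \<bullet> b) + R b) (\<lambda>_. True) (bt i)) \<and>
     (\<forall>i j. s (Suc i) $ j =
        (if j = J i then (1 - \<eta> i) * s i $ j + \<eta> i * (X $ j \<bullet> bt i) else s i $ j)) \<and>
     averages \<alpha> bt bbar"

definition stoch_grad :: "real^'p^'n \<Rightarrow> ('n::finite \<Rightarrow> real \<Rightarrow> real) \<Rightarrow> 'n \<Rightarrow> real^'p \<Rightarrow> real^'n
    \<Rightarrow> real^'n" where
  "stoch_grad X l j b w = (1 / real CARD('n) * (X $ j \<bullet> b - dlstar l j (w $ j))) *\<^sub>R axis j 1"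

definition rdcmd_run :: "real^'p^'n \<Rightarrow> ('n::finite \<Rightarrow> real \<Rightarrow> real) \<Rightarrow> (real^'p \<Rightarrow> ereal)
    \<Rightarrow> (nat \<Rightarrow> real) \<Rightarrow> (nat \<Rightarrow> real) \<Rightarrow> (nat \<Rightarrow> 'n) \<Rightarrow> (nat \<Rightarrow> real^'p) \<Rightarrow> (nat \<Rightarrow> real^'p)
    \<Rightarrow> (nat \<Rightarrow> real^'n) \<Rightarrow> bool" where
  "rdcmd_run X l R \<alpha> \<eta> J bt bbar w \<longleftrightarrow>
     is_arg_min (hfun l) (\<lambda>_. True) (w 0) \<and>
     (\<forall>i. is_arg_min (\<lambda>b. ereal (1 / real CARD('n) * (w i \<bullet> (X *v b))) + R b)
        (\<lambda>_. True) (bt i)) \<and>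
     (\<forall>i. is_arg_min
        (\<lambda>v. ereal ((- (\<eta> i *\<^sub>R stoch_grad X l (J i) (bt i) (w i))) \<bullet> (v - w i))
             + bregman (hfun l) v (w i))
        (\<lambda>_. True) (w (Suc i))) \<and>
     averages \<alpha> bt bbar"

text \<open>Equivalently, \<open>bt i\<close> is a function of \<open>J 0, \<dots>, J (i - 1)\<close>, so it is chosen before
  \<open>J i\<close> is drawn.\<close>

definition depends_on_past :: "'o measure \<Rightarrow> (nat \<Rightarrow> 'o \<Rightarrow> 'n) \<Rightarrow> (nat \<Rightarrow> 'o \<Rightarrow> 'b) \<Rightarrow> bool" where
  "depends_on_past \<Omega> J bt \<longleftrightarrow>
     (\<forall>i. \<forall>\<omega>\<in>space \<Omega>. \<forall>\<omega>'\<in>space \<Omega>. (\<forall>m<i. J m \<omega> = J m \<omega>') \<longrightarrow> bt i \<omega> = bt i \<omega>')"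

definition iid_uniform :: "'o measure \<Rightarrow> (nat \<Rightarrow> 'o \<Rightarrow> 'n::finite) \<Rightarrow> bool" where
  "iid_uniform \<Omega> J \<longleftrightarrow>
     prob_space.indep_vars \<Omega> (\<lambda>_. count_space UNIV) J UNIV \<and>
     (\<forall>i j. measure \<Omega> {\<omega> \<in> space \<Omega>. J i \<omega> = j} = 1 / real CARD('n))"

definition dist_bound :: "real^'p^'n \<Rightarrow> ('n::finite \<Rightarrow> real \<Rightarrow> real) \<Rightarrow> (real^'p \<Rightarrow> ereal)
    \<Rightarrow> real^'n \<Rightarrow> real \<Rightarrow> bool" where
  "dist_bound X l R w0 D \<longleftrightarrow> (\<forall>wh\<in>Wset X l R. bregman (hfun l) wh w0 \<le> ereal D)"

end

(*
  Both methods produce w^i = grad L(s^i), where s^i follows x_j^T bt^i in the sampled coordinates.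
  Put u_i = 2n + i, nu_i = u_i (u_i - 1) / 2, K = k + 1 and S = u_0 + ... + u_(K-1).  By conjugacy and
  the optimality of the bt^i, the gap satisfies for every run
    S gap <= nu_0 Dmax + (1/n) (sum_j (nu_K l_j(b_j) - nu_0 l_j(0)) - sum_i u_i (linearised loss)_i),
  where nu_K b_j is the u-weighted sum of the values a_j = x_j^T bt^i.  The linearised losses are
  taken at s^i and evaluated at a, and nu (b - s) has mean zero.  It remains to bound the expected
  regret, the bracket on the right, by 4 n^2 gamma M^2 K.  Smoothness reduces this to second moments
  of a - s, s and b - s, for which one-step recursions hold.  The crude bound (a - s)^2 <= 4 M^2
  leaves no room for the noise b - s, which is absorbed in three ways: for K <= 7n by a quadratic
  potential, for 7n <= K <= 29n by combining the recursions with optimised weights, and for K >= 29n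
  because the Bregman distance of s to a nearly optimal point of the primal problem stays small.
*)
theory Submission
  imports Defs
begin

section \<open>Smooth strictly convex losses\<close>

text \<open>Smoothness together with \<open>F_le\<close> already spends the whole budget
  \<open>4 * n\<^sup>2 * \<gamma> * M\<^sup>2 * K\<close>; for \<open>n = 1\<close> there is no
  noise and this suffices. For \<open>n \<ge> 2\<close> noise arises because the average of the
  \<open>bt i\<close> involves all coordinates, while \<open>s\<close> follows only the drawn ones.
  What pays for it is that \<open>\<bar>a - s\<bar>\<close> cannot stay near \<open>2 * M\<close>:
  an undrawn coordinate still has \<open>s = 0\<close>, and in the long run \<open>q_step\<close>
  charges \<open>real i * F i\<close> against \<open>u i * (n * M\<^sup>2)\<close>, so that on
  average \<open>F i\<close> is not much above \<open>n * M\<^sup>2\<close>. The step sizes make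
  \<open>b\<close> an average of the values \<open>a\<close> and of the start value 0, the latter
  with weight \<open>nu 0\<close>; convexity turns this extra weight into the term with
  \<open>Dmax\<close>. Every finite index sequence has positive probability and \<open>bt i\<close>
  is a function of the past. Hence expectations are finite averages over lists, and what holds along
  runs holds for every list.\<close>

definition breg :: "(real \<Rightarrow> real) \<Rightarrow> real \<Rightarrow> real \<Rightarrow> real" where
  "breg f x y = f x - f y - deriv f y * (x - y)"

locale smooth_loss =
  fixes f :: "real \<Rightarrow> real" and \<gamma> :: real
  assumes strict: "strictly_convex f" and smooth: "smooth_with \<gamma> f"
begin

lemma has_deriv: "(f has_real_derivative deriv f x) (at x)"
  using smooth by (simp add: smooth_with_def DERIV_deriv_iff_real_differentiable)

lemma deriv_lipschitz: "\<bar>deriv f a - deriv f b\<bar> \<le> \<gamma> * \<bar>a - b\<bar>"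
  using smooth by (simp add: smooth_with_def)

lemma convex: "convex_on UNIV f"
proof (rule convex_onI)
  fix t x y :: real assume "0 < t" "t < 1"
  then show "f ((1 - t) *\<^sub>R x + t *\<^sub>R y) \<le> (1 - t) * f x + t * f y"
  proof (cases "x = y")
    case True
    then show ?thesis by (simp add: algebra_simps)
  next
    case False
    have "\<forall>x y. \<forall>t\<in>{0<..<1}. x \<noteq> y \<longrightarrow> f ((1 - t) *\<^sub>R x + t *\<^sub>R y) < (1 - t) * f x + t * f y"
      using strict by (simp only: strictly_convex_def)
    from this[rule_format, of t x y] show ?thesis using False \<open>0 < t\<close> \<open>t < 1\<close> by simp
  qed
qed simp

lemma above_tangent: "f y + deriv f y * (x - y) \<le> f x"
  using convex_on_imp_above_tangent[of UNIV f y x "deriv f y"] convex has_deriv[of y]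
  by (simp add: algebra_simps)

lemma breg_nonneg: "0 \<le> breg f x y"
  using above_tangent[of y x] by (simp add: breg_def)

text \<open>If the tangent at \<open>y\<close> met the graph again at \<open>x\<close>, strict
  convexity would put the midpoint below the tangent.\<close>

lemma above_tangent_strict:
  assumes "x \<noteq> y" shows "f y + deriv f y * (x - y) < f x"
proof -
  define z where "z = (1 - 1/2) *\<^sub>R y + (1/2) *\<^sub>R x"
  have "\<forall>x y. \<forall>t\<in>{0<..<1}. x \<noteq> y \<longrightarrow> f ((1 - t) *\<^sub>R x + t *\<^sub>R y) < (1 - t) * f x + t * f y"
    using strict by (simp only: strictly_convex_def)
  from this[rule_format, of "1/2" y x] have "f z < f y / 2 + f x / 2"
    using assms by (simp add: z_def)
  moreover have "f y + deriv f y * (z - y) \<le> f z" by (rule above_tangent)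
  moreover have "deriv f y * (z - y) = deriv f y * (x - y) / 2"
    by (simp add: z_def field_simps)
  ultimately show ?thesis by linarith
qed

lemma deriv_strict_mono: "strict_mono (deriv f)"
proof (rule strict_monoI)
  fix x y :: real assume "x < y"
  then have "f x + deriv f x * (y - x) < f y" "f y + deriv f y * (x - y) < f x"
    using above_tangent_strict by auto
  then have "deriv f x * (y - x) < deriv f y * (y - x)" by (simp add: algebra_simps)
  then show "deriv f x < deriv f y" using \<open>x < y\<close> by simp
qed

lemma gamma_pos: "0 < \<gamma>"
  using deriv_lipschitz[of 1 0] strict_monoD[OF deriv_strict_mono, of 0 1] by simp

lemma deriv_continuous: "continuous_on A (deriv f)"
proof -
  have "\<gamma>-lipschitz_on UNIV (deriv f)"
    using deriv_lipschitz gamma_pos by (auto intro!: lipschitz_onI simp: dist_real_def)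
  then show ?thesis using lipschitz_on_continuous_on continuous_on_subset by blast
qed

text \<open>The range of the derivative is an interval. This yields a primal point for every dual
  value between two attained ones.\<close>

lemma deriv_IVT:
  assumes "deriv f a \<le> v" "v \<le> deriv f b"
  shows "\<exists>c. a \<le> c \<and> c \<le> b \<and> deriv f c = v"
proof -
  have "a \<le> b" using assms strict_mono_less_eq[OF deriv_strict_mono] by fastforce
  then show ?thesis using IVT'[of "deriv f" a v b] assms deriv_continuous by auto
qed

text \<open>The right side minus the left side vanishes at \<open>x = y\<close>, and by the
  Lipschitz bound its slope in \<open>x\<close> is nonnegative to the right of \<open>y\<close> and
  nonpositive to the left.\<close>

lemma breg_le: "breg f x y \<le> \<gamma> / 2 * (x - y)\<^sup>2"
proof -
  define g where "g t = \<gamma> / 2 * (t - y)\<^sup>2 - breg f t y" for t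
  have g': "(g has_real_derivative \<gamma> * (t - y) - (deriv f t - deriv f y)) (at t)" for t
    unfolding g_def breg_def
    by (auto intro!: derivative_eq_intros has_deriv)
  have "0 \<le> g x"
  proof (cases "y \<le> x")
    case True
    have "g y \<le> g x"
    proof (rule DERIV_nonneg_imp_nondecreasing[OF True])
      fix t assume "y \<le> t"
      then show "\<exists>d. DERIV g t :> d \<and> 0 \<le> d"
        using deriv_lipschitz[of t y] by (intro exI[of _ "\<gamma> * (t - y) - (deriv f t - deriv f y)"])
          (auto simp: g')
    qed
    then show ?thesis by (simp add: g_def breg_def)
  next
    case False
    then have "x \<le> y" by simp
    have "g y \<le> g x"
    proof (rule DERIV_nonpos_imp_nonincreasing[OF \<open>x \<le> y\<close>])
      fix t assume "t \<le> y"
      then show "\<exists>d. DERIV g t :> d \<and> d \<le> 0"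
        using deriv_lipschitz[of t y] g'[of t]
        by (intro exI[of _ "\<gamma> * (t - y) - (deriv f t - deriv f y)"] conjI)
          (auto simp: abs_if right_diff_distrib split: if_splits)
    qed
    then show ?thesis by (simp add: g_def breg_def)
  qed
  then show ?thesis by (simp add: g_def)
qed

text \<open>Cocoercivity. A gradient step of length \<open>1 / \<gamma>\<close> from
  \<open>x\<close> lowers the Bregman distance to \<open>y\<close> by at least
  \<open>d\<^sup>2 / (2 * \<gamma>)\<close>, and the result is still nonnegative.\<close>

lemma deriv_diff_sq_le: "(deriv f x - deriv f y)\<^sup>2 \<le> 2 * \<gamma> * breg f x y"
proof -
  define d where "d = deriv f x - deriv f y"
  define z where "z = x - d / \<gamma>"
  have zx: "z - x = - (d / \<gamma>)" by (simp add: z_def)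
  have "breg f z y = breg f x y + d * (z - x) + breg f z x"
    by (simp add: breg_def d_def algebra_simps)
  moreover have "0 \<le> breg f z y" by (rule breg_nonneg)
  moreover have "breg f z x \<le> \<gamma> / 2 * (z - x)\<^sup>2" by (rule breg_le)
  ultimately have "0 \<le> breg f x y + d * (z - x) + \<gamma> / 2 * (z - x)\<^sup>2" by linarith
  also have "\<dots> = breg f x y - d\<^sup>2 / (2 * \<gamma>)"
    unfolding zx using gamma_pos by (simp add: power2_eq_square field_simps)
  finally show ?thesis using gamma_pos by (simp add: d_def field_simps)
qed

lemma step_le: "f (s + \<eta> * d) \<le> f s + \<eta> * (deriv f s * d) + \<gamma> / 2 * \<eta>\<^sup>2 * d\<^sup>2"
  using breg_le[of "s + \<eta> * d" s] by (simp add: breg_def algebra_simps power_mult_distrib)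

text \<open>The price of passing from the noisy point \<open>s\<close> to its noiseless counterpart \<open>b\<close>; used with
  \<open>Q = \<gamma> / 2 * s\<^sup>2\<close> for \<open>c = 0\<close> and with \<open>Q = breg f s c\<close>.\<close>

lemma breg_diff_le:
  assumes "\<tau> > 0" and D: "(deriv f s - deriv f c)\<^sup>2 \<le> 2 * \<gamma> * Q"
  shows "breg f b c - breg f s c \<le> \<tau> * Q + \<gamma> / 2 * (1 + 1 / \<tau>) * (b - s)\<^sup>2"
proof -
  define d where "d = deriv f s - deriv f c"
  have "0 \<le> (\<tau> * d - \<gamma> * (b - s))\<^sup>2 / (2 * \<gamma> * \<tau>)"
    using assms gamma_pos by simp
  also have "\<dots> = \<tau> * d\<^sup>2 / (2 * \<gamma>) - d * (b - s) + \<gamma> / (2 * \<tau>) * (b - s)\<^sup>2"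
    using assms gamma_pos by (simp add: power2_eq_square field_simps)
  finally have "d * (b - s) \<le> \<tau> * d\<^sup>2 / (2 * \<gamma>) + \<gamma> / (2 * \<tau>) * (b - s)\<^sup>2" by simp
  moreover have "\<tau> * d\<^sup>2 / (2 * \<gamma>) \<le> \<tau> * Q"
    using D assms(1) gamma_pos by (simp add: d_def field_simps)
  moreover have "breg f b c - breg f s c = breg f b s + d * (b - s)"
    by (simp add: breg_def d_def algebra_simps)
  moreover have "breg f b s \<le> \<gamma> / 2 * (b - s)\<^sup>2" by (rule breg_le)
  moreover have "\<gamma> / 2 * (1 + 1 / \<tau>) * (b - s)\<^sup>2 = \<gamma> / 2 * (b - s)\<^sup>2 + \<gamma> / (2 * \<tau>) * (b - s)\<^sup>2"
    by (simp add: field_simps)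
  ultimately show ?thesis by linarith
qed

end

section \<open>Averaging over index histories\<close>

text \<open>A history is the list of drawn indices, most recent first.\<close>

primrec avg :: "nat \<Rightarrow> ('n::finite list \<Rightarrow> real) \<Rightarrow> real" where
  "avg 0 g = g []"
| "avg (Suc k) g = avg k (\<lambda>h. (\<Sum>i\<in>UNIV. g (i # h)) / real CARD('n))"

lemma avg_mono:
  fixes f g :: "'n::finite list \<Rightarrow> real"
  shows "(\<And>h. length h = k \<Longrightarrow> f h \<le> g h) \<Longrightarrow> avg k f \<le> avg k g"
proof (induction k arbitrary: f g)
  case (Suc k)
  show ?case unfolding avg.simps
    by (rule Suc.IH) (auto intro!: divide_right_mono sum_mono Suc.prems)
qed simp

lemma avg_cong:
  fixes f g :: "'n::finite list \<Rightarrow> real"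
  assumes "\<And>h. length h = k \<Longrightarrow> f h = g h" shows "avg k f = avg k g"
  using assms by (intro antisym avg_mono) auto

lemma avg_const [simp]: "avg k (\<lambda>h::'n::finite list. c) = c"
  by (induction k) auto

lemma avg_add: "avg k (\<lambda>h::'n::finite list. f h + g h) = avg k f + avg k g"
  by (induction k arbitrary: f g) (simp_all add: sum.distrib add_divide_distrib)

lemma avg_cmult: "avg k (\<lambda>h::'n::finite list. c * f h) = c * avg k f"
  by (induction k arbitrary: f)
    (simp_all add: sum_distrib_left[symmetric] times_divide_eq_right[symmetric] del: times_divide_eq_right)

lemma avg_diff: "avg k (\<lambda>h::'n::finite list. f h - g h) = avg k f - avg k g"
  using avg_add[of k f "\<lambda>h. (- 1) * g h"] avg_cmult[of k "- 1" g] by simp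

lemma avg_nonneg:
  fixes f :: "'n::finite list \<Rightarrow> real"
  assumes "\<And>h. length h = k \<Longrightarrow> 0 \<le> f h" shows "0 \<le> avg k f"
  using avg_mono[of k "\<lambda>_. 0" f] assms by simp

lemma avg_eq_sum:
  "avg k (g :: 'n::finite list \<Rightarrow> real) = (\<Sum>h | length h = k. g h) / real CARD('n) ^ k"
proof (induction k arbitrary: g)
  case 0
  have "{h::'n list. length h = 0} = {[]}" by auto
  then show ?case by simp
next
  case (Suc k)
  have "(\<Sum>h | length h = Suc k. g h) = (\<Sum>(h, i)\<in>{h. length h = k} \<times> UNIV. g (i # h))"
    by (rule sum.reindex_bij_witness[of _ "\<lambda>(h, i). i # h" "\<lambda>h. (tl h, hd h)"])
      (auto simp: length_Suc_conv)
  then show ?case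
    by (simp add: Suc.IH sum.cartesian_product sum_divide_distrib[symmetric])
qed

text \<open>For each \<open>j\<close> exactly one draw \<open>i\<close> hits it, and the remaining
  ones leave it alone.\<close>

lemma sum_if_eq:
  fixes p q :: "'n::finite \<Rightarrow> real"
  shows "(\<Sum>i\<in>UNIV. \<Sum>j\<in>UNIV. if i = j then p j else q j) =
    (\<Sum>j\<in>UNIV. p j + (real CARD('n) - 1) * q j)"
proof -
  have "(\<Sum>i\<in>UNIV. \<Sum>j\<in>UNIV. if i = j then p j else q j) =
      (\<Sum>j\<in>UNIV. \<Sum>i\<in>UNIV. if i = j then p j else q j)"
    by (rule sum.swap)
  also have "\<dots> = (\<Sum>j\<in>UNIV. p j + (real CARD('n) - 1) * q j)"
  proof (rule sum.cong)
    fix j :: 'n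
    have "(\<Sum>i\<in>UNIV. if i = j then p j else q j) = (\<Sum>i\<in>UNIV. q j + (if i = j then p j - q j else 0))"
      by (rule sum.cong) auto
    also have "\<dots> = p j + (real CARD('n) - 1) * q j"
      by (subst sum.distrib) (simp add: algebra_simps)
    finally show "(\<Sum>i\<in>UNIV. if i = j then p j else q j) = p j + (real CARD('n) - 1) * q j" .
  qed simp
  finally show ?thesis .
qed

lemma convex_step_abs:
  assumes "0 \<le> t" "t \<le> (1::real)" "\<bar>x\<bar> \<le> c" "\<bar>y\<bar> \<le> c" shows "\<bar>x + t * (y - x)\<bar> \<le> c"
proof -
  have "\<bar>x + t * (y - x)\<bar> = \<bar>(1 - t) * x + t * y\<bar>" by (simp add: algebra_simps)
  also have "\<dots> \<le> (1 - t) * \<bar>x\<bar> + t * \<bar>y\<bar>"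
    using assms by (metis abs_mult abs_of_nonneg abs_triangle_ineq diff_ge_0_iff_ge)
  also have "\<dots> \<le> (1 - t) * c + t * c" using assms by (intro add_mono mult_left_mono) auto
  finally show ?thesis by (simp add: algebra_simps)
qed

section \<open>The sampled sequence, its noiseless counterpart and their second moments\<close>

locale coord_tree =
  fixes a :: "'n::finite list \<Rightarrow> 'n \<Rightarrow> real" and n M :: real
  assumes n_eq: "n = real CARD('n)"
    and a_le: "\<bar>a h j\<bar> \<le> M"
begin

definition u :: "nat \<Rightarrow> real" where "u i = 2 * n + real i"

text \<open>A primitive of \<open>u\<close>, with the offset that gives
  \<open>nu (Suc i) * eta i = n * u i\<close>. The starting value
  \<open>nu 0 = n * (2 * n - 1)\<close> is the weight of the start point 0 in all averages.\<close>

definition nu :: "nat \<Rightarrow> real" where "nu i = u i * (u i - 1) / 2"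

definition eta :: "nat \<Rightarrow> real" where "eta i = 2 * n / (u i + 1)"

text \<open>\<open>s\<close> follows the sampled coordinates, \<open>b\<close> is its noiseless counterpart:
  \<open>nu\<close> times \<open>b\<close> is the sum of the \<open>u\<close>-weighted \<open>a\<close>, and \<open>b - s\<close> has mean zero.\<close>

primrec s :: "'n list \<Rightarrow> 'n \<Rightarrow> real" where
  "s [] j = 0"
| "s (i # h) j = (if i = j then s h j + eta (length h) * (a h j - s h j) else s h j)"

primrec b :: "'n list \<Rightarrow> 'n \<Rightarrow> real" where
  "b [] j = 0"
| "b (i # h) j = b h j + 2 / (u (length h) + 1) * (a h j - b h j)"

abbreviation \<delta> where "\<delta> h j \<equiv> a h j - s h j"

definition F where "F i = avg i (\<lambda>h. \<Sum>j\<in>UNIV. (\<delta> h j)\<^sup>2)"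
definition q where "q i = avg i (\<lambda>h. \<Sum>j\<in>UNIV. (s h j)\<^sup>2)"
definition z where "z i = avg i (\<lambda>h. \<Sum>j\<in>UNIV. (b h j - s h j)\<^sup>2)"

lemma n_ge: "1 \<le> n"
  unfolding n_eq using zero_less_card_finite[where 'a='n] by linarith

lemma M_nonneg: "0 \<le> M" using a_le[of "[]" undefined] by linarith

lemma u_Suc: "u (Suc i) = u i + 1" by (simp add: u_def)

lemma u_ge: "2 \<le> u i" using n_ge by (simp add: u_def)

lemma nu_Suc: "nu (Suc i) = nu i + u i" by (simp add: nu_def u_Suc field_simps)

lemma nu_pos: "0 < nu i" using u_ge[of i] by (simp add: nu_def)

lemma eta_bounds: "0 < eta i" "eta i \<le> 1" using n_ge by (simp_all add: eta_def u_def)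

lemma nu_eta: "nu (Suc i) * eta i = n * u i"
  using u_ge[of i] by (simp add: nu_def eta_def u_Suc field_simps)

lemma step_eq_eta: "2 / (u i + 1) = eta i / n"
  using n_ge by (simp add: eta_def)

lemma s_le: "\<bar>s h j\<bar> \<le> M"
  using M_nonneg eta_bounds by (induction h) (auto intro!: convex_step_abs a_le simp: less_imp_le)

lemma s_untouched: "j \<notin> set h \<Longrightarrow> s h j = 0"
  by (induction h) auto

lemma delta_le: "\<bar>\<delta> h j\<bar> \<le> 2 * M"
  using a_le[of h j] s_le[of h j] by linarith

lemma F_nonneg: "0 \<le> F i" unfolding F_def by (intro avg_nonneg sum_nonneg) auto

lemma q_nonneg: "0 \<le> q i" unfolding q_def by (intro avg_nonneg sum_nonneg) auto

lemma q_0: "q 0 = 0" by (simp add: q_def)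

lemma z_0: "z 0 = 0" by (simp add: z_def)

lemma F_le: "F i \<le> 4 * n * M\<^sup>2"
proof -
  have "(\<delta> h j)\<^sup>2 \<le> 4 * M\<^sup>2" for h j
    using power_mono[OF delta_le[of h j], of 2] by (simp add: power_mult_distrib)
  then have "(\<Sum>j\<in>UNIV. (\<delta> h j)\<^sup>2) \<le> 4 * n * M\<^sup>2" for h
    using sum_bounded_above[of UNIV "\<lambda>j. (\<delta> h j)\<^sup>2" "4 * M\<^sup>2"]
    by (simp add: n_eq)
  then have "F i \<le> avg i (\<lambda>h::'n list. 4 * n * M\<^sup>2)" unfolding F_def by (intro avg_mono)
  then show ?thesis by simp
qed

text \<open>One random step changes each coordinate with probability \<open>1 / n\<close>.\<close>

lemma avg_step:
  fixes g :: "'n \<Rightarrow> real \<Rightarrow> real \<Rightarrow> real"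
  shows "avg (Suc k) (\<lambda>h. \<Sum>j\<in>UNIV. g j (s h j) (b h j)) =
    avg k (\<lambda>h. \<Sum>j\<in>UNIV.
      g j (s h j) (b h j + 2 / (u k + 1) * (a h j - b h j)) +
      (g j (s h j + eta k * \<delta> h j) (b h j + 2 / (u k + 1) * (a h j - b h j))
        - g j (s h j) (b h j + 2 / (u k + 1) * (a h j - b h j))) / n)"
  unfolding avg.simps n_eq[symmetric]
proof (rule avg_cong)
  fix h :: "'n list" assume h: "length h = k"
  let ?b = "\<lambda>j. b h j + 2 / (u k + 1) * (a h j - b h j)"
  have "(\<Sum>i\<in>UNIV. \<Sum>j\<in>UNIV. g j (s (i # h) j) (b (i # h) j)) =
      (\<Sum>i\<in>UNIV. \<Sum>j\<in>UNIV. if i = j then g j (s h j + eta k * \<delta> h j) (?b j) else g j (s h j) (?b j))"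
    by (intro sum.cong) (auto simp: h)
  also have "\<dots> = (\<Sum>j\<in>UNIV. g j (s h j + eta k * \<delta> h j) (?b j) + (n - 1) * g j (s h j) (?b j))"
    unfolding n_eq by (rule sum_if_eq)
  finally show "(\<Sum>i\<in>UNIV. \<Sum>j\<in>UNIV. g j (s (i # h) j) (b (i # h) j)) / n =
      (\<Sum>j\<in>UNIV. g j (s h j) (?b j) + (g j (s h j + eta k * \<delta> h j) (?b j) - g j (s h j) (?b j)) / n)"
    using n_ge by (simp add: sum_divide_distrib add_divide_distrib diff_divide_distrib algebra_simps)
qed

text \<open>A coordinate of \<open>s\<close> is drawn with probability \<open>1 / n\<close>, so on
  average it moves towards \<open>a\<close> at the rate \<open>eta k / n\<close>, which is the rate
  of \<open>b\<close>. The mean of \<open>b - s\<close> is thus multiplied by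
  \<open>1 - 2 / (u k + 1)\<close> in each step, starting from 0. The coefficients \<open>c\<close>
  do not depend on the history.\<close>

lemma avg_mean_zero: "avg k (\<lambda>h. \<Sum>j\<in>UNIV. c j * (b h j - s h j)) = 0"
proof (induction k)
  case (Suc k)
  have "avg (Suc k) (\<lambda>h. \<Sum>j\<in>UNIV. c j * (b h j - s h j)) =
      avg k (\<lambda>h. \<Sum>j\<in>UNIV. c j * (b h j + 2 / (u k + 1) * (a h j - b h j) - s h j) +
        (c j * (b h j + 2 / (u k + 1) * (a h j - b h j) - (s h j + eta k * \<delta> h j))
          - c j * (b h j + 2 / (u k + 1) * (a h j - b h j) - s h j)) / n)"
    by (rule avg_step[of k "\<lambda>j x y. c j * (y - x)"])
  also have "\<dots> = avg k (\<lambda>h. (1 - 2 / (u k + 1)) * (\<Sum>j\<in>UNIV. c j * (b h j - s h j)))"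
  proof (rule avg_cong)
    fix h :: "'n list"
    show "(\<Sum>j\<in>UNIV. c j * (b h j + 2 / (u k + 1) * (a h j - b h j) - s h j) +
        (c j * (b h j + 2 / (u k + 1) * (a h j - b h j) - (s h j + eta k * \<delta> h j))
          - c j * (b h j + 2 / (u k + 1) * (a h j - b h j) - s h j)) / n)
      = (1 - 2 / (u k + 1)) * (\<Sum>j\<in>UNIV. c j * (b h j - s h j))"
      unfolding sum_distrib_left step_eq_eta
      by (rule sum.cong) (use n_ge in \<open>simp_all add: field_simps\<close>)
  qed
  finally show ?case by (simp add: avg_cmult Suc.IH)
qed simp

text \<open>In each coordinate \<open>nu k * (b - s)\<close> is a martingale. Its increment is
  \<open>u i * \<delta>\<close> times a variable that equals \<open>1 - n\<close> with probability
  \<open>1 / n\<close> and 1 otherwise; this variable has mean 0 and variance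
  \<open>n - 1\<close>.\<close>

lemma z_step: "(nu (Suc i))\<^sup>2 * z (Suc i) = (nu i)\<^sup>2 * z i + (n - 1) * (u i)\<^sup>2 * F i"
proof -
  define t where "t = eta i / n"
  have et: "eta i = n * t" using n_ge by (simp add: t_def)
  have nut: "nu (Suc i) * t = u i" using nu_eta[of i] n_ge by (simp add: et field_simps)
  have nut': "nu (Suc i) * (1 - t) = nu i" using nut nu_Suc[of i] by (simp add: algebra_simps)
  have "z (Suc i) = avg i (\<lambda>h. \<Sum>j\<in>UNIV. (b h j + t * (a h j - b h j) - s h j)\<^sup>2 +
        ((b h j + t * (a h j - b h j) - (s h j + eta i * \<delta> h j))\<^sup>2
          - (b h j + t * (a h j - b h j) - s h j)\<^sup>2) / n)"
    unfolding z_def t_def step_eq_eta[symmetric] by (rule avg_step[of i "\<lambda>j x y. (y - x)\<^sup>2"])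
  also have "\<dots> = avg i (\<lambda>h. (1 - t)\<^sup>2 * (\<Sum>j\<in>UNIV. (b h j - s h j)\<^sup>2) + (n - 1) * t\<^sup>2 * (\<Sum>j\<in>UNIV. (\<delta> h j)\<^sup>2))"
    unfolding sum_distrib_left sum.distrib[symmetric]
    by (intro avg_cong sum.cong refl) (use n_ge in \<open>simp add: et field_simps power2_eq_square\<close>)
  also have "\<dots> = (1 - t)\<^sup>2 * z i + (n - 1) * t\<^sup>2 * F i"
    by (simp add: avg_add avg_cmult z_def F_def)
  finally have "(nu (Suc i))\<^sup>2 * z (Suc i) = (nu (Suc i))\<^sup>2 * ((1 - t)\<^sup>2 * z i + (n - 1) * t\<^sup>2 * F i)"
    by simp
  also have "\<dots> = (nu (Suc i) * (1 - t))\<^sup>2 * z i + (n - 1) * (nu (Suc i) * t)\<^sup>2 * F i"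
    by (simp only: power_mult_distrib distrib_left mult_ac)
  finally have "(nu (Suc i))\<^sup>2 * z (Suc i)
      = (nu (Suc i) * (1 - t))\<^sup>2 * z i + (n - 1) * (nu (Suc i) * t)\<^sup>2 * F i" .
  then show ?thesis by (simp only: nut nut')
qed

lemma z_eq: "(nu k)\<^sup>2 * z k = (n - 1) * (\<Sum>i<k. (u i)\<^sup>2 * F i)"
proof (induction k)
  case (Suc k)
  show ?case unfolding sum.lessThan_Suc z_step Suc by (simp add: algebra_simps)
qed (simp add: z_0)

text \<open>The square of \<open>s + eta i * \<delta>\<close> is the convex combination of the
  squares of \<open>s\<close> and \<open>a\<close> minus \<open>eta i * (1 - eta i)\<close> times
  the square of \<open>\<delta>\<close>. Keeping that last term is the point: large displacements
  shrink the second moment of \<open>s\<close>, which cannot become negative.\<close>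

lemma q_step: "nu (Suc i) * q (Suc i) \<le> nu i * q i + u i * (n * M\<^sup>2) - real i * F i"
proof -
  define t where "t = eta i / n"
  have et: "eta i = n * t" using n_ge by (simp add: t_def)
  have nut: "nu (Suc i) * t = u i" using nu_eta[of i] n_ge by (simp add: et field_simps)
  have nut': "nu (Suc i) * (1 - t) = nu i" using nut nu_Suc[of i] by (simp add: algebra_simps)
  have uW: "real i \<le> u i * (1 - eta i)"
    using n_ge by (simp add: u_def eta_def field_simps)
  have "q (Suc i) = avg i (\<lambda>h. \<Sum>j\<in>UNIV. (s h j)\<^sup>2 + ((s h j + eta i * \<delta> h j)\<^sup>2 - (s h j)\<^sup>2) / n)"
    unfolding q_def by (rule avg_step[of i "\<lambda>j x y. x\<^sup>2"])
  also have "\<dots> \<le> avg i (\<lambda>h. (1 - t) * (\<Sum>j\<in>UNIV. (s h j)\<^sup>2) + t * (n * M\<^sup>2) - t * (1 - eta i) * (\<Sum>j\<in>UNIV. (\<delta> h j)\<^sup>2))"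
  proof (rule avg_mono)
    fix h :: "'n list"
    have "(\<Sum>j\<in>UNIV. (s h j)\<^sup>2 + ((s h j + eta i * \<delta> h j)\<^sup>2 - (s h j)\<^sup>2) / n)
        \<le> (\<Sum>j\<in>UNIV. (1 - t) * (s h j)\<^sup>2 + t * M\<^sup>2 - t * (1 - eta i) * (\<delta> h j)\<^sup>2)"
    proof (rule sum_mono)
      fix j
      have "(s h j)\<^sup>2 + ((s h j + eta i * \<delta> h j)\<^sup>2 - (s h j)\<^sup>2) / n
          = (1 - t) * (s h j)\<^sup>2 + t * (a h j)\<^sup>2 - t * (1 - eta i) * (\<delta> h j)\<^sup>2"
        using n_ge by (simp add: et field_simps power2_eq_square)
      moreover have "(a h j)\<^sup>2 \<le> M\<^sup>2" using power_mono[OF a_le[of h j], of 2] by simp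
      moreover have "0 \<le> t" using eta_bounds[of i] n_ge by (simp add: t_def)
      ultimately show "(s h j)\<^sup>2 + ((s h j + eta i * \<delta> h j)\<^sup>2 - (s h j)\<^sup>2) / n
          \<le> (1 - t) * (s h j)\<^sup>2 + t * M\<^sup>2 - t * (1 - eta i) * (\<delta> h j)\<^sup>2"
        by (simp add: mult_left_mono)
    qed
    also have "\<dots> = (1 - t) * (\<Sum>j\<in>UNIV. (s h j)\<^sup>2) + t * (n * M\<^sup>2) - t * (1 - eta i) * (\<Sum>j\<in>UNIV. (\<delta> h j)\<^sup>2)"
      by (simp add: sum_subtractf sum.distrib sum_distrib_left[symmetric] n_eq)
    finally show "(\<Sum>j\<in>UNIV. (s h j)\<^sup>2 + ((s h j + eta i * \<delta> h j)\<^sup>2 - (s h j)\<^sup>2) / n)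
        \<le> (1 - t) * (\<Sum>j\<in>UNIV. (s h j)\<^sup>2) + t * (n * M\<^sup>2) - t * (1 - eta i) * (\<Sum>j\<in>UNIV. (\<delta> h j)\<^sup>2)" .
  qed
  also have "\<dots> = (1 - t) * q i + t * (n * M\<^sup>2) - t * (1 - eta i) * F i"
    by (simp add: avg_add avg_diff avg_cmult q_def F_def)
  finally have "nu (Suc i) * q (Suc i) \<le> nu (Suc i) * ((1 - t) * q i + t * (n * M\<^sup>2) - t * (1 - eta i) * F i)"
    using nu_pos[of "Suc i"] by simp
  also have "\<dots> = (nu (Suc i) * (1 - t)) * q i + (nu (Suc i) * t) * (n * M\<^sup>2) - (nu (Suc i) * t) * (1 - eta i) * F i"
    by (simp add: algebra_simps)
  also have "\<dots> \<le> nu i * q i + u i * (n * M\<^sup>2) - real i * F i"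
    unfolding nut nut' using mult_right_mono[OF uW F_nonneg[of i]] by simp
  finally show ?thesis .
qed

text \<open>Summation by parts of \<open>q_step\<close>. Since the weights do not increase,
  \<open>p (Suc k)\<close> can be replaced by \<open>p k\<close> in front of the nonnegative second
  moment.\<close>

lemma weighted_q:
  fixes p :: "nat \<Rightarrow> real"
  assumes "\<And>i. p (Suc i) \<le> p i" and p: "\<And>i. 0 \<le> p i"
  shows "(\<Sum>i<k. p i * (real i * F i)) + p k * (nu k * q k) \<le> n * M\<^sup>2 * (\<Sum>i<k. p i * u i)"
proof (induction k)
  case (Suc k)
  have "p (Suc k) * (nu (Suc k) * q (Suc k)) \<le> p k * (nu (Suc k) * q (Suc k))"
    using assms[of k] nu_pos[of "Suc k"] q_nonneg[of "Suc k"] by (intro mult_right_mono) auto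
  also have "\<dots> \<le> p k * (nu k * q k + u k * (n * M\<^sup>2) - real k * F k)"
    using q_step[of k] p by (intro mult_left_mono) auto
  finally show ?case using Suc.IH by (simp add: algebra_simps)
qed (simp add: q_0)

end

section \<open>The growth rate of the potential\<close>

text \<open>The certificates expand the polynomials in the Bernstein basis of the interval, where all
  coefficients are positive.\<close>

lemma poly_mix_le_4:
  fixes z :: real assumes "2 \<le> z" "z \<le> 3"
  shows "0 \<le> 3840 - 2656*z + 528*z^2 - 90*z^3 + 27*z^4"
proof -
  have "(3840 - 2656*z + 528*z^2 - 90*z^3 + 27*z^4)
      = 352*(3-z)^4 + 648*(z-2)*(3-z)^3 + 468*(z-2)^2*(3-z)^2 + 526*(z-2)^3*(3-z) + 381*(z-2)^4"
    by algebra
  also have "\<dots> \<ge> 0"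
    using assms by (intro add_nonneg_nonneg mult_nonneg_nonneg zero_le_power) auto
  finally show ?thesis by simp
qed

lemma poly_mix_le_rate_max:
  fixes z :: real assumes "2 \<le> z" "z \<le> 3"
  shows "0 \<le> 96000 - 66400*z + 19032*z^2 - 2943*z^3 - 117*z^4 + 108*z^5"
proof -
  have "(96000 - 66400*z + 19032*z^2 - 2943*z^3 - 117*z^4 + 108*z^5)
      = 17368*(3-z)^5 + 66148*(z-2)*(3-z)^4 + 98118*(z-2)^2*(3-z)^3 + 71587*(z-2)^3*(3-z)^2
      + 27535*(z-2)^4*(3-z) + 5394*(z-2)^5"
    by algebra
  also have "\<dots> \<ge> 0"
    using assms by (intro add_nonneg_nonneg mult_nonneg_nonneg zero_le_power) auto
  finally show ?thesis by simp
qed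

lemma poly_rate_w:
  fixes z :: real assumes "2 \<le> z" "z \<le> 3"
  shows "0 \<le> 384 - 16*z + 12*z^2 - 9*z^3"
proof -
  have "(384 - 16*z + 12*z^2 - 9*z^3)
      = 328*(3-z)^3 + 908*(z-2)*(3-z)^2 + 790*(z-2)^2*(3-z) + 201*(z-2)^3"
    by algebra
  also have "\<dots> \<ge> 0"
    using assms by (intro add_nonneg_nonneg mult_nonneg_nonneg zero_le_power) auto
  finally show ?thesis by simp
qed

lemma poly_double:
  fixes z :: real assumes "3 \<le> z" "z \<le> 4"
  shows "0 \<le> -76800 - 16000*z + 10632*z^2 + 4707*z^3 - 1467*z^4 + 108*z^5"
proof -
  have "(-76800 - 16000*z + 10632*z^2 + 4707*z^3 - 1467*z^4 + 108*z^5)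
      = 5394*(4-z)^5 + 87155*(z-3)*(4-z)^4 + 297617*(z-3)^2*(4-z)^3 + 420684*(z-3)^3*(4-z)^2
      + 270320*(z-3)^4*(4-z) + 65600*(z-3)^5"
    by algebra
  also have "\<dots> \<ge> 0"
    using assms by (intro add_nonneg_nonneg mult_nonneg_nonneg zero_le_power) auto
  finally show ?thesis by simp
qed

lemma poly_vertex:
  fixes z :: real assumes "4 \<le> z" "z \<le> 9"
  shows "0 \<le> -133504 + 46832*z - 2072*z^2 + 1417*z^3 - 489*z^4 + 36*z^5"
proof -
  \<comment> \<open>On the whole interval one Bernstein coefficient is negative; subdivision makes
    all of them positive.\<close>
  consider "z \<le> 13/2" | "13/2 \<le> z \<and> z \<le> 31/4" | "31/4 \<le> z" by linarith
  then show ?thesis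
  proof cases
    case 1
    have "50000 * (-133504 + 46832*z - 2072*z^2 + 1417*z^3 - 489*z^4 + 36*z^5)
        = 368640*(13-2*z)^5 + 2609920*(2*z-8)*(13-2*z)^4 + 5856080*(2*z-8)^2*(13-2*z)^3
        + 5433370*(2*z-8)^3*(13-2*z)^2 + 2039355*(2*z-8)^4*(13-2*z) + 277035*(2*z-8)^5"
      by algebra
    also have "\<dots> \<ge> 0"
      using assms 1 by (intro add_nonneg_nonneg mult_nonneg_nonneg zero_le_power) auto
    finally show ?thesis by simp
  next
    case 2
    have "800000 * (-133504 + 46832*z - 2072*z^2 + 1417*z^3 - 489*z^4 + 36*z^5)
        = 4432560*(31-4*z)^5 + 16929360*(4*z-26)*(31-4*z)^4 + 23577040*(4*z-26)^2*(31-4*z)^3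
        + 15437060*(4*z-26)^3*(31-4*z)^2 + 6123265*(4*z-26)^4*(31-4*z) + 1794570*(4*z-26)^5"
      by algebra
    also have "\<dots> \<ge> 0"
      using assms 2 by (intro add_nonneg_nonneg mult_nonneg_nonneg zero_le_power) auto
    finally show ?thesis by simp
  next
    case 3
    have "800000 * (-133504 + 46832*z - 2072*z^2 + 1417*z^3 - 489*z^4 + 36*z^5)
        = 1794570*(36-4*z)^5 + 11822435*(4*z-31)*(36-4*z)^4 + 38233740*(4*z-31)^2*(36-4*z)^3
        + 65652560*(4*z-31)^3*(36-4*z)^2 + 55487040*(4*z-31)^4*(36-4*z) + 18068480*(4*z-31)^5"
      by algebra
    also have "\<dots> \<ge> 0"
      using assms 3 by (intro add_nonneg_nonneg mult_nonneg_nonneg zero_le_power) auto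
    finally show ?thesis by simp
  qed
qed

lemma poly_tau:
  fixes z :: real assumes "9 \<le> z" "z \<le> 31"
  shows "0 \<le> -21609000 - 12803700*z + 2372530*z^2 - 59319*z^3"
proof -
  have "10648 * (-21609000 - 12803700*z + 2372530*z^2 - 59319*z^3)
      = 12089079*(31-z)^3 + 376988343*(z-9)*(31-z)^2 + 1090833277*(z-9)^2*(31-z)
      + 94305301*(z-9)^3"
    by algebra
  also have "\<dots> \<ge> 0"
    using assms by (intro add_nonneg_nonneg mult_nonneg_nonneg zero_le_power) auto
  finally show ?thesis by simp
qed

lemma poly_middle_0:
  fixes z :: real assumes "9 \<le> z" "z \<le> 31"
  shows "0 \<le> 32600 - 21180*z + 2538*z^2 - 49*z^3"
proof -
  have "10648 * (32600 - 21180*z + 2538*z^2 - 49*z^3)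
      = 11837*(31-z)^3 + 312645*(z-9)*(31-z)^2 + 1177839*(z-9)^2*(31-z) + 355279*(z-9)^3"
    by algebra
  also have "\<dots> \<ge> 0"
    using assms by (intro add_nonneg_nonneg mult_nonneg_nonneg zero_le_power) auto
  finally show ?thesis by simp
qed

lemma poly_middle_1:
  fixes z :: real assumes "9 \<le> z" "z \<le> 31"
  shows "0 \<le> 71820 - 46168*z + 5325*z^2 - 98*z^3"
proof -
  have "10648 * (71820 - 46168*z + 5325*z^2 - 98*z^3)
      = 16191*(31-z)^3 + 617669*(z-9)*(31-z)^2 + 2483401*(z-9)^2*(31-z) + 838419*(z-9)^3"
    by algebra
  also have "\<dots> \<ge> 0"
    using assms by (intro add_nonneg_nonneg mult_nonneg_nonneg zero_le_power) auto
  finally show ?thesis by simp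
qed

text \<open>Up to the factor \<open>n\<close>, \<open>rate z M d\<close> bounds the expected growth of the potential \<open>pot\<close> below in
  one coordinate with \<open>d = \<bar>a - s\<bar>\<close>, where \<open>z = (u + 1) / n\<close>. The growth has to be at most
  \<open>4 * M\<^sup>2\<close> on average. For \<open>z \<le> 3\<close> this uses that many coordinates are still at \<open>0\<close>; the
  majorant \<open>rate_max z * M\<^sup>2\<close> exceeds the bound for \<open>z\<close> close to \<open>9\<close>, which the smaller values
  between \<open>3\<close> and \<open>7\<close> compensate.\<close>

definition rate_w :: "real \<Rightarrow> real" where
  "rate_w z = (8 - z) / (8 + 3 * z) - 8 / (9 * z) + 16 / (3 * z\<^sup>2)"

definition rate :: "real \<Rightarrow> real \<Rightarrow> real \<Rightarrow> real" where
  "rate z M d = z / 2 * M\<^sup>2 + 16 / (3 * z) * (M * d) + (rate_w z - 8 / (3 * z)) * d\<^sup>2"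

definition rate_max :: "real \<Rightarrow> real" where
  "rate_max z = 197 / 50 + 2 / 25 * ((z - 3) * (z - 7))"

lemma rate_max_eq: "50 * rate_max z = 281 - 40 * z + 4 * z\<^sup>2"
  by (simp add: rate_max_def algebra_simps power2_eq_square)

lemma nonneg_cancel: "0 < c \<Longrightarrow> 0 \<le> c * x \<Longrightarrow> 0 \<le> (x::real)"
  by (simp add: zero_le_mult_iff)

lemma rate_w_eq:
  assumes "0 < z"
  shows "9 * z\<^sup>2 * (8 + 3 * z) * rate_w z = 384 + 80 * z + 48 * z^2 - 9 * z^3"
proof -
  define y where "y = 8 + 3 * z"
  have y: "y \<noteq> 0" using assms by (simp add: y_def)
  have "9 * z\<^sup>2 * y * rate_w z = 9 * z\<^sup>2 * (8 - z) - 8 * z * y + 48 * y"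
  proof -
    have "9 * z\<^sup>2 * y * ((8 - z) / y) = 9 * z\<^sup>2 * (8 - z)" using y by simp
    moreover have "9 * z\<^sup>2 * y * (8 / (9 * z)) = 8 * z * y" using assms by (simp add: power2_eq_square)
    moreover have "9 * z\<^sup>2 * y * (16 / (3 * z\<^sup>2)) = 48 * y" using assms by simp
    ultimately show ?thesis
      unfolding rate_w_def y_def[symmetric] by (simp only: distrib_left right_diff_distrib)
  qed
  then show ?thesis unfolding y_def by (simp add: algebra_simps power2_eq_square power3_eq_cube)
qed

lemma rate_w_ge: "4 / (3 * z) \<le> rate_w z" if "2 \<le> z" "z \<le> 3"
proof -
  have D: "0 < 9 * z\<^sup>2 * (8 + 3 * z)" using that by (intro mult_pos_pos) auto
  have "9 * z\<^sup>2 * (8 + 3 * z) * (rate_w z - 4 / (3 * z))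
      = 9 * z\<^sup>2 * (8 + 3 * z) * rate_w z - 12 * z * (8 + 3 * z)"
    using that by (simp add: field_simps power2_eq_square)
  also have "\<dots> = 384 - 16*z + 12*z^2 - 9*z^3"
    using that by (subst rate_w_eq) (simp_all add: algebra_simps power2_eq_square)
  also have "\<dots> \<ge> 0" by (rule poly_rate_w[OF that])
  finally have "0 \<le> 9 * z\<^sup>2 * (8 + 3 * z) * (rate_w z - 4 / (3 * z))" .
  from nonneg_cancel[OF D this] show ?thesis by simp
qed

text \<open>A coordinate that has not been drawn has \<open>s = 0\<close>, hence
  \<open>\<bar>a - s\<bar> \<le> M\<close>. The bound is the value at \<open>d = M\<close>.\<close>

lemma rate_le_untouched:
  assumes z: "2 \<le> z" "z \<le> 3" and d: "0 \<le> d" "d \<le> M"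
  shows "rate z M d \<le> (z / 2 + 8 / (3 * z) + rate_w z) * M\<^sup>2"
proof -
  have "0 \<le> 4 / (3 * z)" using z by simp
  then have "0 \<le> rate_w z" using rate_w_ge[OF z] by linarith
  have "0 \<le> rate_w z * ((M + d) * (M - d)) + 8 / (3 * z) * (M - d)\<^sup>2"
    using d z \<open>0 \<le> rate_w z\<close> by (intro add_nonneg_nonneg mult_nonneg_nonneg) auto
  also have "\<dots> = (z / 2 + 8 / (3 * z) + rate_w z) * M\<^sup>2 - rate z M d"
    using z by (simp add: rate_def field_simps power2_eq_square)
  finally show ?thesis by simp
qed

text \<open>Subtracting \<open>4 / (3 * z) * (2 * M - d)\<^sup>2\<close> removes the term linear in
  \<open>d\<close> and leaves \<open>c * d\<^sup>2\<close>. If \<open>c\<close> is nonnegative the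
  worst case is \<open>d = 2 * M\<close>; otherwise this term is dropped.\<close>

lemma rate_le_double:
  assumes z: "0 < z" and d: "0 \<le> d" "d \<le> 2 * M"
  shows "rate z M d \<le> (z / 2 + 16 / (3 * z)) * M\<^sup>2 \<or> rate z M d \<le> (z / 2 + 4 * rate_w z) * M\<^sup>2"
    and "4 / (3 * z) \<le> rate_w z \<Longrightarrow> rate z M d \<le> (z / 2 + 4 * rate_w z) * M\<^sup>2"
proof -
  define c where "c = rate_w z - 4 / (3 * z)"
  have "0 \<le> 4 / (3 * z) * (2 * M - d)\<^sup>2" using z by simp
  also have "\<dots> = z / 2 * M\<^sup>2 + 16 / (3 * z) * M\<^sup>2 + c * d\<^sup>2 - rate z M d"
    using z by (simp add: rate_def c_def field_simps power2_eq_square)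
  finally have 1: "rate z M d \<le> z / 2 * M\<^sup>2 + 16 / (3 * z) * M\<^sup>2 + c * d\<^sup>2" by simp
  have 2: "c * d\<^sup>2 \<le> c * (4 * M\<^sup>2)" if "0 \<le> c"
    using that power_mono[OF d(2) d(1), of 2] by (intro mult_left_mono) (auto simp: power_mult_distrib)
  have 3: "16 / (3 * z) * M\<^sup>2 + c * (4 * M\<^sup>2) = 4 * rate_w z * M\<^sup>2"
    using z by (simp add: c_def field_simps)
  show two: "rate z M d \<le> (z / 2 + 4 * rate_w z) * M\<^sup>2" if "4 / (3 * z) \<le> rate_w z"
    using 1 2 3 that by (simp add: c_def distrib_right)
  show "rate z M d \<le> (z / 2 + 16 / (3 * z)) * M\<^sup>2 \<or> rate z M d \<le> (z / 2 + 4 * rate_w z) * M\<^sup>2"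
  proof (cases "0 \<le> c")
    case True
    then show ?thesis using two by (simp add: c_def)
  next
    case False
    then have "c * d\<^sup>2 \<le> 0" by (simp add: mult_nonpos_nonneg)
    then show ?thesis using 1 by (simp add: distrib_right)
  qed
qed

lemma rate_le_mid:
  assumes z: "3 \<le> z" "z \<le> 4" and d: "0 \<le> d" "d \<le> 2 * M"
  shows "rate z M d \<le> rate_max z * M\<^sup>2"
proof -
  have pos: "0 < 300 * z\<^sup>2 * (8 + 3 * z)" using z by (intro mult_pos_pos) auto
  have "300 * z\<^sup>2 * (8 + 3 * z) * (rate_max z - (z / 2 + 4 * rate_w z))
      = 6 * (z\<^sup>2 * (8 + 3 * z)) * (50 * rate_max z - 25 * z)
        - 400 / 3 * (9 * z\<^sup>2 * (8 + 3 * z) * rate_w z)"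
    by (simp add: right_diff_distrib distrib_left mult_ac)
  also have "\<dots> = 6 * (z\<^sup>2 * (8 + 3 * z)) * (281 - 40 * z + 4 * z\<^sup>2 - 25 * z)
        - 400 / 3 * (384 + 80 * z + 48 * z^2 - 9 * z^3)"
    using z by (subst rate_w_eq) (auto simp only: rate_max_eq)
  also have "\<dots> = 2 / 3 * (-76800 - 16000*z + 10632*z^2 + 4707*z^3 - 1467*z^4 + 108*z^5)"
    by (simp add: algebra_simps power_numeral_reduce)
  finally have eq: "300 * z\<^sup>2 * (8 + 3 * z) * (rate_max z - (z / 2 + 4 * rate_w z))
      = 2 / 3 * (-76800 - 16000*z + 10632*z^2 + 4707*z^3 - 1467*z^4 + 108*z^5)" .
  have "0 \<le> 300 * z\<^sup>2 * (8 + 3 * z) * (rate_max z - (z / 2 + 4 * rate_w z))"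
    unfolding eq using poly_double[OF z] by simp
  from nonneg_cancel[OF pos this] have 1: "z / 2 + 4 * rate_w z \<le> rate_max z" by simp
  \<comment> \<open>\<open>4 / 9 * (7 - z)\<close> is the chord of the convex function
    \<open>16 / (3 * z)\<close> between \<open>z = 3\<close> and \<open>z = 4\<close>.\<close>
  have "12 \<le> z * (7 - z)" using mult_nonneg_nonneg[of "4 - z" "z - 3"] z by (simp add: algebra_simps)
  then have "16 / (3 * z) \<le> 4 / 9 * (7 - z)" using z by (simp add: field_simps)
  moreover have "rate_max z - z / 2 - 4 / 9 * (7 - z) = 2 / 25 * (z - 7 / 2)\<^sup>2 + (6880 - 1330 * z) / 4500"
    by (simp add: rate_max_def field_simps power2_eq_square)
  moreover have "0 \<le> 2 / 25 * (z - 7 / 2)\<^sup>2 + (6880 - 1330 * z) / 4500" using z by simp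
  ultimately have 2: "z / 2 + 16 / (3 * z) \<le> rate_max z" by linarith
  show ?thesis
    using rate_le_double(1)[OF _ d, of z] z mult_right_mono[OF 1, of "M\<^sup>2"] mult_right_mono[OF 2, of "M\<^sup>2"]
    by auto
qed

text \<open>Here \<open>rate z M\<close> is concave in \<open>d\<close> with leading coefficient
  \<open>- c\<close>. Its value at the vertex is \<open>(z / 2 + k\<^sup>2 / c) * M\<^sup>2\<close>,
  so the claim amounts to \<open>k\<^sup>2 \<le> e * c\<close>.\<close>

lemma rate_le_high:
  assumes z: "4 \<le> z" "z \<le> 9"
  shows "rate z M d \<le> rate_max z * M\<^sup>2"
proof -
  define c where "c = 8 / (3 * z) - rate_w z"
  define e where "e = rate_max z - z / 2"
  define k where "k = 8 / (3 * z)"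
  have D: "0 < 9 * z\<^sup>2 * (8 + 3 * z)" using z by (intro mult_pos_pos) auto
  have cD: "9 * z\<^sup>2 * (8 + 3 * z) * c = -384 + 112 * z + 24 * z^2 + 9 * z^3"
  proof -
    have "9 * z\<^sup>2 * (8 + 3 * z) * c = 24 * z * (8 + 3 * z) - 9 * z\<^sup>2 * (8 + 3 * z) * rate_w z"
      using z by (simp add: c_def field_simps power2_eq_square)
    then show ?thesis using z by (subst (asm) rate_w_eq) (auto simp: algebra_simps power2_eq_square)
  qed
  have kD: "9 * z\<^sup>2 * k\<^sup>2 = 64" using z by (simp add: k_def field_simps power2_eq_square)
  have "0 \<le> 24 * z^2" "0 \<le> 9 * z^3" "0 < -384 + 112 * z" using z by auto
  then have "0 < -384 + 112 * z + 24 * z^2 + 9 * z^3" by linarith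
  then have c: "0 < c" using cD D by (metis zero_less_mult_pos)
  have eq: "100 * (e * (-384 + 112 * z + 24 * z^2 + 9 * z^3) - 64 * (8 + 3 * z))
      = 2 * (-133504 + 46832*z - 2072*z^2 + 1417*z^3 - 489*z^4 + 36*z^5)"
  proof -
    have e50: "50 * e = 281 - 65 * z + 4 * z\<^sup>2"
      unfolding e_def right_diff_distrib rate_max_eq by simp
    have "100 * (e * (-384 + 112 * z + 24 * z^2 + 9 * z^3) - 64 * (8 + 3 * z))
      = 2 * (50 * e) * (-384 + 112 * z + 24 * z^2 + 9 * z^3) - 6400 * (8 + 3 * z)" by simp
    then show ?thesis unfolding e50 by (simp add: algebra_simps power_numeral_reduce)
  qed
  have "0 \<le> 100 * (e * (-384 + 112 * z + 24 * z^2 + 9 * z^3) - 64 * (8 + 3 * z))"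
    unfolding eq using poly_vertex[OF z] by simp
  then have "64 * (8 + 3 * z) \<le> e * (-384 + 112 * z + 24 * z^2 + 9 * z^3)" by simp
  then have "9 * z\<^sup>2 * (8 + 3 * z) * k\<^sup>2 \<le> 9 * z\<^sup>2 * (8 + 3 * z) * (e * c)"
    unfolding cD[symmetric] kD[symmetric] by (simp add: algebra_simps)
  then have "0 \<le> 9 * z\<^sup>2 * (8 + 3 * z) * (e * c - k\<^sup>2)" by (simp add: right_diff_distrib)
  from nonneg_cancel[OF D this] have kec: "k\<^sup>2 \<le> e * c" by simp
  have "0 \<le> (c * d - k * M)\<^sup>2 + (e * c - k\<^sup>2) * M\<^sup>2" using kec by simp
  also have "\<dots> = c * (rate_max z * M\<^sup>2 - rate z M d)"
  proof -
    have 1: "rate z M d = z / 2 * M\<^sup>2 + 2 * k * (M * d) - c * d\<^sup>2"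
      by (simp add: rate_def c_def k_def algebra_simps)
    have 2: "rate_max z = e + z / 2" by (simp add: e_def)
    show ?thesis unfolding 1 2 by (simp add: algebra_simps power2_eq_square)
  qed
  finally have "0 \<le> c * (rate_max z * M\<^sup>2 - rate z M d)" .
  from nonneg_cancel[OF c this] show ?thesis by simp
qed

text \<open>With \<open>z = 2 + (k + 1) / n\<close> the weight \<open>z - 2\<close> bounds the
  fraction of coordinates drawn in \<open>k\<close> steps. The two bracketed expressions are the
  bounds for undrawn and for arbitrary coordinates.\<close>

lemma rate_mix:
  assumes z: "2 \<le> z" "z \<le> 3"
  defines "r \<equiv> (3 - z) * (z / 2 + 8 / (3 * z) + rate_w z) + (z - 2) * (z / 2 + 4 * rate_w z)"
  shows "r \<le> 4" "r \<le> rate_max z"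
proof -
  have D: "0 < 18 * z\<^sup>2 * (8 + 3 * z)" using z by (intro mult_pos_pos) auto
  have "18 * z\<^sup>2 * (8 + 3 * z) * r = 9 * z^3 * (8 + 3 * z) + 48 * z * (3 - z) * (8 + 3 * z)
      + 2 * (3 * z - 5) * (9 * z\<^sup>2 * (8 + 3 * z) * rate_w z)"
    using z by (simp add: r_def field_simps power2_eq_square power3_eq_cube)
  then have r: "18 * z\<^sup>2 * (8 + 3 * z) * r = 9 * z^3 * (8 + 3 * z) + 48 * z * (3 - z) * (8 + 3 * z)
      + 2 * (3 * z - 5) * (384 + 80 * z + 48 * z^2 - 9 * z^3)"
    using z by (subst (asm) rate_w_eq) auto
  have "18 * z\<^sup>2 * (8 + 3 * z) * (4 - r) = 3840 - 2656*z + 528*z^2 - 90*z^3 + 27*z^4"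
    unfolding right_diff_distrib r by (simp add: algebra_simps power_numeral_reduce)
  then have "0 \<le> 18 * z\<^sup>2 * (8 + 3 * z) * (4 - r)" using poly_mix_le_4[OF z] by linarith
  from nonneg_cancel[OF D this] show "r \<le> 4" by simp
  have "25 * (18 * z\<^sup>2 * (8 + 3 * z) * (rate_max z - r))
      = 96000 - 66400*z + 19032*z^2 - 2943*z^3 - 117*z^4 + 108*z^5"
  proof -
    have "25 * (18 * z\<^sup>2 * (8 + 3 * z) * (rate_max z - r))
      = 9 * z\<^sup>2 * (8 + 3 * z) * (50 * rate_max z) - 25 * (18 * z\<^sup>2 * (8 + 3 * z) * r)"
      by (simp add: algebra_simps)
    then show ?thesis unfolding r rate_max_eq by (simp add: algebra_simps power_numeral_reduce)
  qed
  then have "0 \<le> 18 * z\<^sup>2 * (8 + 3 * z) * (rate_max z - r)" using poly_mix_le_rate_max[OF z] by linarith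
  from nonneg_cancel[OF D this] show "r \<le> rate_max z" by simp
qed

text \<open>The left side is the minimum of the right side over \<open>x\<close>.\<close>

lemma weighted_squares_ge:
  fixes p q :: real assumes "0 < p" "0 < q"
  shows "p * q / (p + q) * d\<^sup>2 \<le> p * (d - x)\<^sup>2 + q * x\<^sup>2"
proof -
  have "0 \<le> (p * (d - x) - q * x)\<^sup>2" by simp
  also have "\<dots> = (p + q) * (p * (d - x)\<^sup>2 + q * x\<^sup>2) - p * q * d\<^sup>2"
    by (simp add: algebra_simps power2_eq_square)
  finally show ?thesis using assms by (simp add: divide_le_eq mult.commute)
qed

text \<open>\<open>rate_w\<close> is the limit of the left side divided by \<open>n\<close> when
  \<open>n\<close> grows and \<open>(u + 1) / n\<close> stays fixed. The error \<open>1 / 8\<close>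
  is affordable: multiplied by a squared distance of at most \<open>4 * M\<^sup>2\<close> it gives
  \<open>M\<^sup>2 / 2\<close>, the gap between the coefficients \<open>u / 2\<close> and
  \<open>(u + 1) / 2\<close>.\<close>

lemma rate_w_discrete:
  fixes n u :: real
  assumes n: "1 \<le> n" and u: "2 * n \<le> u"
  shows "n + 16 / 9 * n * (n - 1) / (u + 1) - 8 / 3 * n\<^sup>2 / (u + 1) * ((u + 1 - 2 * n) / (u + 1))
      - (u - 1) / (u + 1) * (4 * n * u / (8 * n + 3 * u)) \<le> n * rate_w ((u + 1) / n) + 1 / 8"
proof -
  define y where "y = u + 1"
  have pos: "0 < n" "0 < y" "0 < u" "0 < 8 * n + 3 * u" "0 < 8 * n + 3 * y"
    using n u by (auto simp: y_def)
  have w: "n * rate_w (y / n) = n * (8 * n - y) / (8 * n + 3 * y) - 8 * n\<^sup>2 / (9 * y) + 16 * n^3 / (3 * y\<^sup>2)"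
  proof -
    have "(8 - y / n) / (8 + 3 * (y / n)) = (8 * n - y) / (8 * n + 3 * y)"
    proof -
      have "8 - y / n = (8 * n - y) / n" "8 + 3 * (y / n) = (8 * n + 3 * y) / n"
        using pos by (simp_all add: field_simps)
      then show ?thesis using pos by simp
    qed
    moreover have "n * (8 / (9 * (y / n))) = 8 * n\<^sup>2 / (9 * y)" "n * (16 / (3 * (y / n)\<^sup>2)) = 16 * n^3 / (3 * y\<^sup>2)"
      using pos by (simp_all add: field_simps power2_eq_square power3_eq_cube)
    ultimately show ?thesis by (simp add: rate_w_def distrib_left right_diff_distrib)
  qed
  define P where "P = 8 * n + 3 * u"
  define Q where "Q = 8 * n + 3 * y"
  have PQ: "0 < P" "0 < Q" using pos by (simp_all add: P_def Q_def)
  have a1: "n - n * (8 * n - y) / Q = 4 * n * y / Q"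
  proof -
    have "n - n * (8 * n - y) / Q = (n * Q - n * (8 * n - y)) / Q"
      using PQ by (simp add: diff_divide_distrib)
    moreover have "n * Q - n * (8 * n - y) = 4 * n * y" by (simp add: Q_def algebra_simps)
    ultimately show ?thesis by simp
  qed
  have a2: "4 * n * y / Q - 4 * n * u / P = 32 * n\<^sup>2 / (Q * P)"
  proof -
    have "4 * n * y * P - 4 * n * u * Q = 32 * n\<^sup>2"
      by (simp add: P_def Q_def y_def algebra_simps power2_eq_square)
    then show ?thesis using PQ by (simp add: diff_frac_eq)
  qed
  have a3: "(u - 1) / y * (4 * n * u / P) = 4 * n * u / P - 8 * n * u / (y * P)"
  proof -
    have "(u - 1) / y = 1 - 2 / y" using pos by (simp add: y_def field_simps)
    then show ?thesis by (simp add: left_diff_distrib diff_divide_distrib)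
  qed
  have a4: "16 / 9 * n * (n - 1) / y - 8 / 3 * n\<^sup>2 / y * ((y - 2 * n) / y)
      = - (8 * n\<^sup>2 / (9 * y)) + 16 * n^3 / (3 * y\<^sup>2) - 16 * n / (9 * y)"
    using pos by (simp add: field_simps power2_eq_square power3_eq_cube)
  have a5: "8 * n * u / (y * P) - 16 * n / (9 * y) = n * (24 * u - 128 * n) / (9 * y * P)"
  proof -
    have "8 * n * u * (9 * y) - 16 * n * (y * P) = y * (n * (24 * u - 128 * n))"
      by (simp add: P_def algebra_simps)
    then have "8 * n * u / (y * P) - 16 * n / (9 * y) = y * (n * (24 * u - 128 * n)) / (y * P * (9 * y))"
      using PQ pos by (simp add: diff_frac_eq)
    then show ?thesis using pos by simp
  qed
  have "n + 16 / 9 * n * (n - 1) / y - 8 / 3 * n\<^sup>2 / y * ((y - 2 * n) / y)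
      - (u - 1) / y * (4 * n * u / P) - n * rate_w (y / n)
      = 32 * n\<^sup>2 / (Q * P) + n * (24 * u - 128 * n) / (9 * y * P)"
    unfolding w a3 Q_def[symmetric] using a1 a2 a4 a5 by linarith
  also have "\<dots> = (288 * n\<^sup>2 * y + n * (24 * u - 128 * n) * Q) / (9 * y * P * Q)"
  proof -
    have "32 * n\<^sup>2 / (Q * P) = 288 * n\<^sup>2 * y / (9 * y * P * Q)" using PQ pos by simp
    moreover have "x / (9 * y * P) = x * Q / (9 * y * P * Q)" for x using PQ by simp
    ultimately show ?thesis by (simp only: add_divide_distrib)
  qed
  also have "\<dots> \<le> 1 / 8"
  proof -
    define v where "v = u - 2 * n"
    have v: "0 \<le> v" using u by (simp add: v_def)
    have uv: "u = 2 * n + v" by (simp add: v_def)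
    have "9 * y * P * Q - 8 * (288 * n\<^sup>2 * y + n * (24 * u - 128 * n) * Q)
      = 7880 * n^3 + 204 * (n^2 * v) + 342 * (n * v^2) + 81 * v^3 + 2136 * n^2 + 720 * (n * v) + 162 * v^2 + 378 * n + 81 * v"
      unfolding P_def Q_def y_def uv by (simp add: algebra_simps power_numeral_reduce)
    also have "\<dots> \<ge> 0" using v n by (intro add_nonneg_nonneg mult_nonneg_nonneg) auto
    finally show ?thesis using pos PQ by (simp add: divide_le_eq)
  qed
  finally show ?thesis by (simp add: y_def P_def)
qed

text \<open>The left side is the growth of one coordinate of the potential plus
  \<open>n * (a - s)\<^sup>2\<close>. As \<open>a - s = (a - b) + (b - s)\<close>, the two negative
  squares jointly dominate a multiple of \<open>(a - s)\<^sup>2\<close> by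
  \<open>weighted_squares_ge\<close>; this eliminates \<open>b\<close>.\<close>

lemma rate_coord:
  fixes n u :: real
  assumes n: "1 \<le> n" and u: "2 * n \<le> u" and a: "\<bar>a\<bar> \<le> M" and s: "\<bar>s\<bar> \<le> M"
  shows "n * (a - s)\<^sup>2 + u / 2 * a\<^sup>2 - u * (u - 1) / (2 * (u + 1)) * (a - b)\<^sup>2
      - 4 / 9 * n * ((3 * u - 1) / (u + 1)) * (b - s)\<^sup>2 + 16 / 9 * n * (n - 1) / (u + 1) * (a - s)\<^sup>2
      + 8 / 3 * n\<^sup>2 / (u + 1) * (a\<^sup>2 - s\<^sup>2 - (u + 1 - 2 * n) / (u + 1) * (a - s)\<^sup>2)
    \<le> n * rate ((u + 1) / n) M \<bar>a - s\<bar>"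
proof -
  define d where "d = a - s"
  define c where "c = (u - 1) / (u + 1)"
  define e where "e = 4 * n * u / (8 * n + 3 * u)"
  define k where "k = 8 / 3 * n\<^sup>2 / (u + 1)"
  have pos: "0 < n" "0 < u" "0 < u + 1" "0 \<le> u - 1" "0 < 8 * n + 3 * u" using n u by auto
  have c0: "0 \<le> c" using pos by (simp add: c_def)
  have M: "0 \<le> M" using a by linarith
  have sq: "a\<^sup>2 \<le> M\<^sup>2" using power_mono[OF a, of 2] by simp
  have dM: "\<bar>d\<bar> \<le> 2 * M" using a s by (simp add: d_def)
  have e: "4 * n / 3 * (u / 2) / (4 * n / 3 + u / 2) = e"
    using pos by (simp add: e_def field_simps)
  have "c * (e * d\<^sup>2) \<le> c * (4 * n / 3 * (d - (a - b))\<^sup>2 + u / 2 * (a - b)\<^sup>2)"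
    using weighted_squares_ge[of "4 * n / 3" "u / 2" d "a - b"] pos c0 e by (intro mult_left_mono) auto
  also have "\<dots> = 4 / 3 * n * c * (b - s)\<^sup>2 + u * (u - 1) / (2 * (u + 1)) * (a - b)\<^sup>2"
  proof -
    have 1: "c * (u / 2) = u * (u - 1) / (2 * (u + 1))" by (simp add: c_def mult.commute)
    have 2: "d - (a - b) = b - s" by (simp add: d_def)
    have "c * (4 * n / 3 * x + u / 2 * y) = 4 / 3 * n * c * x + c * (u / 2) * y" for x y
      by (simp add: distrib_left mult_ac)
    then show ?thesis unfolding 1 2 by simp
  qed
  also have "4 / 3 * n * c * (b - s)\<^sup>2 \<le> 4 / 9 * n * ((3 * u - 1) / (u + 1)) * (b - s)\<^sup>2"
  proof -
    have "3 * c \<le> (3 * u - 1) / (u + 1)" using pos by (simp add: c_def field_simps)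
    then have "4 / 9 * n * (3 * c) * (b - s)\<^sup>2 \<le> 4 / 9 * n * ((3 * u - 1) / (u + 1)) * (b - s)\<^sup>2"
      using pos by (intro mult_right_mono mult_left_mono) auto
    moreover have "4 / 3 * n * c = 4 / 9 * n * (3 * c)" by simp
    ultimately show ?thesis by (simp only:)
  qed
  finally have 1: "c * e * d\<^sup>2 \<le> 4 / 9 * n * ((3 * u - 1) / (u + 1)) * (b - s)\<^sup>2
      + u * (u - 1) / (2 * (u + 1)) * (a - b)\<^sup>2" by simp
  have "a\<^sup>2 - s\<^sup>2 = 2 * (a * d) - d\<^sup>2" by (simp add: d_def power2_eq_square algebra_simps)
  moreover have "a * d \<le> M * \<bar>d\<bar>" using a by (metis abs_ge_self abs_ge_zero abs_mult mult_right_mono order_trans)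
  ultimately have "a\<^sup>2 - s\<^sup>2 \<le> 2 * (M * \<bar>d\<bar>) - d\<^sup>2" by linarith
  then have 2: "k * (a\<^sup>2 - s\<^sup>2) \<le> k * (2 * (M * \<bar>d\<bar>) - d\<^sup>2)" using pos by (intro mult_left_mono) (auto simp: k_def)
  have 3: "(n + 16 / 9 * n * (n - 1) / (u + 1) - k * ((u + 1 - 2 * n) / (u + 1)) - c * e) * d\<^sup>2
      \<le> (n * rate_w ((u + 1) / n) + 1 / 8) * d\<^sup>2"
    unfolding k_def c_def e_def by (intro mult_right_mono rate_w_discrete n u) auto
  have 4: "u / 2 * a\<^sup>2 \<le> u / 2 * M\<^sup>2" using pos sq by (intro mult_left_mono) auto
  have 5: "d\<^sup>2 \<le> 4 * M\<^sup>2" using power_mono[OF dM, of 2] by (simp add: power_mult_distrib)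
  have 6: "n * rate ((u + 1) / n) M \<bar>d\<bar> = (u + 1) / 2 * M\<^sup>2 + k * (2 * (M * \<bar>d\<bar>) - d\<^sup>2) + n * rate_w ((u + 1) / n) * d\<^sup>2"
  proof -
    define y where "y = u + 1"
    have y: "0 < y" using pos by (simp add: y_def)
    have 1: "n * (y / n / 2 * x) = y / 2 * x" for x using pos by simp
    have 2: "n * (16 / (3 * (y / n)) * x) = 2 * (k * x)" for x
      using pos y unfolding k_def y_def[symmetric] by (simp add: field_simps power2_eq_square)
    have 3: "n * (8 / (3 * (y / n)) * x) = k * x" for x
      using pos y unfolding k_def y_def[symmetric] by (simp add: field_simps power2_eq_square)
    show ?thesis
      unfolding rate_def y_def[symmetric] left_diff_distrib right_diff_distrib distrib_left 1 2 3
      by simp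
  qed
  define g where "g = 16 / 9 * n * (n - 1) / (u + 1)"
  define v where "v = (u + 1 - 2 * n) / (u + 1)"
  have 7: "(n + g - k * v - c * e) * d\<^sup>2 = n * d\<^sup>2 + g * d\<^sup>2 - k * (v * d\<^sup>2) - c * e * d\<^sup>2"
    by (simp add: left_diff_distrib distrib_right mult.assoc)
  have 8: "k * (a\<^sup>2 - s\<^sup>2 - v * d\<^sup>2) = k * (a\<^sup>2 - s\<^sup>2) - k * (v * d\<^sup>2)"
    by (simp only: right_diff_distrib)
  have 9: "(n * rate_w ((u + 1) / n) + 1 / 8) * d\<^sup>2 = n * rate_w ((u + 1) / n) * d\<^sup>2 + d\<^sup>2 / 8"
    and 10: "(u + 1) / 2 * M\<^sup>2 = u / 2 * M\<^sup>2 + M\<^sup>2 / 2"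
    by (simp_all add: distrib_right add_divide_distrib)
  have arith: "T11 + T9 - T1 - T2 + T5 + (T6 - T4) \<le> T10 + N / 2 + T7 + T8"
    if "T3 \<le> T2 + T1" "T6 \<le> T7" "T11 + T5 - T4 - T3 \<le> T8 + D / 8" "T9 \<le> T10" "D \<le> 4 * N"
    for T1 T2 T3 T4 T5 T6 T7 T8 T9 T10 T11 N D :: real
    using that by linarith
  show ?thesis
    unfolding d_def[symmetric] 6 k_def[symmetric] g_def[symmetric] v_def[symmetric] 8 10
    by (rule arith[OF 1 2 3[folded g_def v_def, unfolded 7 9] 4 5])
qed

text \<open>The variance identity for a weighted mean. For \<open>y = u k + 1\<close> the products
  \<open>(y - 1) * y / 2\<close> and \<open>(y - 1) * (y - 2) / 2\<close> are
  \<open>nu (Suc k)\<close> and \<open>nu k\<close>.\<close>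

lemma weighted_mean_sq:
  fixes y :: real assumes "0 < y"
  shows "(y - 1) * y / 2 / 2 * (b + 2 / y * (a - b))\<^sup>2
    = (y - 1) * (y - 2) / 2 / 2 * b\<^sup>2 + (y - 1) / 2 * a\<^sup>2 - (y - 1) * (y - 2) / (2 * y) * (a - b)\<^sup>2"
  using assms by (simp add: field_simps power2_eq_square)

lemma weighted_noise_sq:
  fixes y :: real assumes "0 < y"
  shows "y * (1 - 2 / y)\<^sup>2 = y - 1 - (3 * (y - 1) - 1) / y" "y * (2 / y)\<^sup>2 = 4 / y"
  using assms by (simp_all add: field_simps power2_eq_square)

section \<open>The quadratic potential and short runs\<close>

context coord_tree
begin

text \<open>The first summand is the quantity to be bounded. The decay of the second one, a noise
  term, serves to lower the coefficient of \<open>(a - s)\<^sup>2\<close> in the growth. The third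
  one has nonpositive growth once \<open>\<bar>a - s\<bar> = 2 * M\<close>, so it relieves exactly
  the worst displacements.\<close>

definition pot :: "nat \<Rightarrow> 'n list \<Rightarrow> real" where
  "pot k h = (\<Sum>j\<in>UNIV. nu k / 2 * (b h j)\<^sup>2 + 4 / 9 * n * u k * (b h j - s h j)\<^sup>2 + 4 / 3 * n\<^sup>2 * (s h j)\<^sup>2)"

text \<open>The term \<open>n * F k\<close>, which is the price of smoothness up to the factor
  \<open>\<gamma>\<close>, is carried along so that summation bounds it jointly with the final
  potential.\<close>

lemma pot_step:
  "avg (Suc k) (pot (Suc k)) + n * F k
    \<le> avg k (pot k) + avg k (\<lambda>h. \<Sum>j\<in>UNIV. n * rate ((u k + 1) / n) M \<bar>\<delta> h j\<bar>)"
proof -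
  define t where "t = 2 / (u k + 1)"
  define U where "U = u k"
  have U: "2 * n \<le> U" "0 < U" "0 < U + 1" using n_ge by (auto simp: U_def u_def)
  have tU: "t = 2 / (U + 1)" by (simp add: t_def U_def)
  have t: "eta k = n * t" by (simp add: tU eta_def U_def[symmetric])
  define g where "g x y = nu (Suc k) / 2 * y\<^sup>2 + 4 / 9 * n * u (Suc k) * (y - x)\<^sup>2 + 4 / 3 * n\<^sup>2 * x\<^sup>2" for x y
  have "avg (Suc k) (pot (Suc k)) = avg (Suc k) (\<lambda>h. \<Sum>j\<in>UNIV. g (s h j) (b h j))"
    by (simp only: pot_def[abs_def] g_def)
  also have "\<dots> = avg k (\<lambda>h. \<Sum>j\<in>UNIV. g (s h j) (b h j + t * (a h j - b h j))
      + (g (s h j + eta k * \<delta> h j) (b h j + t * (a h j - b h j)) - g (s h j) (b h j + t * (a h j - b h j))) / n)"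
    unfolding t_def by (rule avg_step[of k "\<lambda>j. g"])
  also have "\<dots> \<le> avg k (\<lambda>h. pot k h + (\<Sum>j\<in>UNIV. n * rate ((u k + 1) / n) M \<bar>\<delta> h j\<bar>) - n * (\<Sum>j\<in>UNIV. (\<delta> h j)\<^sup>2))"
    unfolding pot_def sum_distrib_left sum.distrib[symmetric] sum_subtractf[symmetric]
  proof (intro avg_mono sum_mono)
    fix h :: "'n list" and j
    let ?a = "a h j" and ?b = "b h j" and ?s = "s h j"
    let ?b' = "?b + t * (?a - ?b)"
    have "U * (U + 1) / 2 / 2 * ?b'\<^sup>2 = U * (U - 1) / 2 / 2 * ?b\<^sup>2 + U / 2 * ?a\<^sup>2 - U * (U - 1) / (2 * (U + 1)) * (?a - ?b)\<^sup>2"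
      using weighted_mean_sq[of "U + 1" ?b ?a] U(3) by (simp add: tU)
    then have 1: "nu (Suc k) / 2 * ?b'\<^sup>2 = nu k / 2 * ?b\<^sup>2 + U / 2 * ?a\<^sup>2 - U * (U - 1) / (2 * (U + 1)) * (?a - ?b)\<^sup>2"
      by (simp add: nu_def u_Suc U_def mult.commute)
    have A: "(?b' - ?s)\<^sup>2 + ((?b' - (?s + eta k * (?a - ?s)))\<^sup>2 - (?b' - ?s)\<^sup>2) / n
        = (1 - t)\<^sup>2 * (?b - ?s)\<^sup>2 + (n - 1) * t\<^sup>2 * (?a - ?s)\<^sup>2"
      using n_ge by (simp add: t field_simps power2_eq_square)
    have e: "(U + 1) * (1 - t)\<^sup>2 = U - (3 * U - 1) / (U + 1)" "(U + 1) * t\<^sup>2 = 4 / (U + 1)"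
      using weighted_noise_sq[OF U(3)] by (simp_all add: tU)
    have "(U + 1) * ((1 - t)\<^sup>2 * x + (n - 1) * t\<^sup>2 * y) = ((U + 1) * (1 - t)\<^sup>2) * x + (n - 1) * ((U + 1) * t\<^sup>2) * y"
      for x y by (simp only: distrib_left mult_ac)
    then have 2: "(U + 1) * ((?b' - ?s)\<^sup>2 + ((?b' - (?s + eta k * (?a - ?s)))\<^sup>2 - (?b' - ?s)\<^sup>2) / n)
        = (U - (3 * U - 1) / (U + 1)) * (?b - ?s)\<^sup>2 + (n - 1) * (4 / (U + 1)) * (?a - ?s)\<^sup>2"
      unfolding A e .
    have "?s\<^sup>2 + ((?s + eta k * (?a - ?s))\<^sup>2 - ?s\<^sup>2) / n = ?s\<^sup>2 + t * (?a\<^sup>2 - ?s\<^sup>2 - (1 - eta k) * (?a - ?s)\<^sup>2)"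
      using n_ge by (simp add: t field_simps power2_eq_square)
    moreover have "1 - eta k = (U + 1 - 2 * n) / (U + 1)"
      using U by (simp add: eta_def U_def field_simps)
    ultimately have 3: "?s\<^sup>2 + ((?s + eta k * (?a - ?s))\<^sup>2 - ?s\<^sup>2) / n
        = ?s\<^sup>2 + 2 / (U + 1) * (?a\<^sup>2 - ?s\<^sup>2 - (U + 1 - 2 * n) / (U + 1) * (?a - ?s)\<^sup>2)"
      by (simp add: t_def U_def)
    have "g ?s ?b' + (g (?s + eta k * (?a - ?s)) ?b' - g ?s ?b') / n
      = nu (Suc k) / 2 * ?b'\<^sup>2
        + 4 / 9 * n * ((U + 1) * ((?b' - ?s)\<^sup>2 + ((?b' - (?s + eta k * (?a - ?s)))\<^sup>2 - (?b' - ?s)\<^sup>2) / n))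
        + 4 / 3 * n\<^sup>2 * (?s\<^sup>2 + ((?s + eta k * (?a - ?s))\<^sup>2 - ?s\<^sup>2) / n)"
    proof -
      have "p + c * x + d * y + (p + c * x' + d * y' - (p + c * x + d * y)) / n
          = p + c * (x + (x' - x) / n) + d * (y + (y' - y) / n)" for p c d x x' y y'
        using n_ge by (simp add: field_simps)
      from this[where c = "4 / 9 * n * (U + 1)"] show ?thesis
        unfolding g_def u_Suc U_def[symmetric] mult.assoc[symmetric] .
    qed
    also have "\<dots> = nu k / 2 * ?b\<^sup>2 + 4 / 9 * n * u k * (?b - ?s)\<^sup>2 + 4 / 3 * n\<^sup>2 * ?s\<^sup>2
      + (n * (?a - ?s)\<^sup>2 + U / 2 * ?a\<^sup>2 - U * (U - 1) / (2 * (U + 1)) * (?a - ?b)\<^sup>2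
      - 4 / 9 * n * ((3 * U - 1) / (U + 1)) * (?b - ?s)\<^sup>2 + 16 / 9 * n * (n - 1) / (U + 1) * (?a - ?s)\<^sup>2
      + 8 / 3 * n\<^sup>2 / (U + 1) * (?a\<^sup>2 - ?s\<^sup>2 - (U + 1 - 2 * n) / (U + 1) * (?a - ?s)\<^sup>2)) - n * (?a - ?s)\<^sup>2"
    proof -
      have "(A + p - c) + 4 / 9 * n * ((U - v) * x + (n - 1) * (4 / y) * w) + 4 / 3 * n\<^sup>2 * (r + 2 / y * k)
          = A + 4 / 9 * n * U * x + 4 / 3 * n\<^sup>2 * r + (n * w + p - c - 4 / 9 * n * v * x
            + 16 / 9 * n * (n - 1) / y * w + 8 / 3 * n\<^sup>2 / y * k) - n * w"
        if "0 < y" for A p c v x w y r k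
        using that by (simp add: field_simps)
      from this[OF U(3)] show ?thesis unfolding 1 2 3 U_def[symmetric] .
    qed
    also have "\<dots> \<le> nu k / 2 * ?b\<^sup>2 + 4 / 9 * n * u k * (?b - ?s)\<^sup>2 + 4 / 3 * n\<^sup>2 * ?s\<^sup>2
        + n * rate ((u k + 1) / n) M \<bar>?a - ?s\<bar> - n * (?a - ?s)\<^sup>2"
      using rate_coord[OF n_ge U(1) a_le[of h j] s_le[of h j], of ?b] unfolding U_def by linarith
    finally show "g ?s ?b' + (g (?s + eta k * (?a - ?s)) ?b' - g ?s ?b') / n
      \<le> nu k / 2 * ?b\<^sup>2 + 4 / 9 * n * u k * (?b - ?s)\<^sup>2 + 4 / 3 * n\<^sup>2 * ?s\<^sup>2
        + n * rate ((u k + 1) / n) M \<bar>?a - ?s\<bar> - n * (?a - ?s)\<^sup>2" .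
  qed
  also have "\<dots> = avg k (pot k) + avg k (\<lambda>h. \<Sum>j\<in>UNIV. n * rate ((u k + 1) / n) M \<bar>\<delta> h j\<bar>) - n * F k"
    by (simp add: avg_add avg_diff avg_cmult F_def)
  finally show ?thesis by simp
qed

text \<open>After \<open>k\<close> steps at most \<open>k\<close> coordinates have moved away from \<open>0\<close>.\<close>

lemma sum_rate_le:
  assumes h: "length h = k" and y: "y = (u k + 1) / n" "y \<le> 9"
  shows "(\<Sum>j\<in>UNIV. rate y M \<bar>\<delta> h j\<bar>) \<le> n * rate_max y * M\<^sup>2"
    and "y \<le> 7 \<Longrightarrow> (\<Sum>j\<in>UNIV. rate y M \<bar>\<delta> h j\<bar>) \<le> 4 * n * M\<^sup>2"
proof -
  have z_eq: "y = 2 + (real k + 1) / n" using n_ge by (simp add: y u_def field_simps)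
  then have z2: "2 \<le> y" using n_ge by simp
  have "(\<Sum>j\<in>UNIV. rate y M \<bar>\<delta> h j\<bar>) \<le> n * rate_max y * M\<^sup>2 \<and>
    (y \<le> 7 \<longrightarrow> (\<Sum>j\<in>UNIV. rate y M \<bar>\<delta> h j\<bar>) \<le> 4 * n * M\<^sup>2)"
  proof (cases "3 \<le> y")
    case True
    have "rate y M \<bar>\<delta> h j\<bar> \<le> rate_max y * M\<^sup>2" for j
      using rate_le_mid[of y "\<bar>\<delta> h j\<bar>" M] rate_le_high[of y M "\<bar>\<delta> h j\<bar>"] True y(2) delta_le[of h j]
      by (cases "y \<le> 4") auto
    then have 1: "(\<Sum>j\<in>UNIV. rate y M \<bar>\<delta> h j\<bar>) \<le> n * rate_max y * M\<^sup>2"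
      using sum_bounded_above[of UNIV "\<lambda>j. rate y M \<bar>\<delta> h j\<bar>" "rate_max y * M\<^sup>2"] by (simp add: n_eq mult.assoc)
    moreover have "rate_max y \<le> 4" if "y \<le> 7"
    proof -
      have "(y - 3) * (y - 7) \<le> 0" using that True by (intro mult_nonneg_nonpos) auto
      then show ?thesis unfolding rate_max_def by linarith
    qed
    then have "n * rate_max y * M\<^sup>2 \<le> 4 * n * M\<^sup>2" if "y \<le> 7"
      using that n_ge by (intro mult_right_mono) auto
    ultimately show ?thesis by linarith
  next
    case False
    then have z3: "2 \<le> y" "y \<le> 3" using z2 by auto
    define R0 where "R0 = (y / 2 + 8 / (3 * y) + rate_w y) * M\<^sup>2"
    define R1 where "R1 = (y / 2 + 4 * rate_w y) * M\<^sup>2"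
    have "8 / (3 * y) \<le> 3 * rate_w y"
    proof -
      have "8 / (3 * y) \<le> 3 * (4 / (3 * y))" using z2 by (simp add: field_simps)
      also have "\<dots> \<le> 3 * rate_w y" using rate_w_ge[OF z3] by simp
      finally show ?thesis .
    qed
    then have R: "R0 \<le> R1" unfolding R0_def R1_def by (intro mult_right_mono) auto
    have "card (set h) \<le> k" using card_length[of h] h by simp
    also have "real k \<le> n * (y - 2)" using n_ge by (simp add: z_eq)
    finally have c: "real (card (set h)) \<le> n * (y - 2)" by simp
    have "rate y M \<bar>\<delta> h j\<bar> \<le> R0 + (if j \<in> set h then R1 - R0 else 0)" for j
    proof (cases "j \<in> set h")
      case True
      then show ?thesis using rate_le_double(2)[of y "\<bar>\<delta> h j\<bar>" M] z2 rate_w_ge[OF z3] delta_le[of h j]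
        by (simp add: R1_def)
    next
      case False
      then show ?thesis using rate_le_untouched[OF z3, of "\<bar>\<delta> h j\<bar>" M] a_le[of h j] s_untouched[OF False]
        by (simp add: R0_def)
    qed
    then have "(\<Sum>j\<in>UNIV. rate y M \<bar>\<delta> h j\<bar>) \<le> (\<Sum>j\<in>UNIV. R0 + (if j \<in> set h then R1 - R0 else 0))"
      by (intro sum_mono)
    also have "\<dots> = n * R0 + real (card (set h)) * (R1 - R0)"
      by (simp add: sum.distrib n_eq sum.If_cases)
    also have "\<dots> \<le> n * R0 + n * (y - 2) * (R1 - R0)"
      using R c by (intro add_left_mono mult_right_mono) auto
    also have "\<dots> = n * ((3 - y) * (y / 2 + 8 / (3 * y) + rate_w y) + (y - 2) * (y / 2 + 4 * rate_w y)) * M\<^sup>2"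
    proof -
      have "n * (p * c) + n * (y - 2) * (v * c - p * c) = n * ((3 - y) * p + (y - 2) * v) * c" for p v c
        by (simp add: algebra_simps)
      then show ?thesis unfolding R0_def R1_def .
    qed
    finally have 1: "(\<Sum>j\<in>UNIV. rate y M \<bar>\<delta> h j\<bar>)
        \<le> n * ((3 - y) * (y / 2 + 8 / (3 * y) + rate_w y) + (y - 2) * (y / 2 + 4 * rate_w y)) * M\<^sup>2" .
    have "n * ((3 - y) * (y / 2 + 8 / (3 * y) + rate_w y) + (y - 2) * (y / 2 + 4 * rate_w y)) * M\<^sup>2 \<le> n * c * M\<^sup>2"
      if "(3 - y) * (y / 2 + 8 / (3 * y) + rate_w y) + (y - 2) * (y / 2 + 4 * rate_w y) \<le> c" for c
      using that n_ge by (intro mult_right_mono mult_left_mono) auto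
    from this[OF rate_mix(1)[OF z3]] this[OF rate_mix(2)[OF z3]] 1
    show ?thesis by (simp add: mult_ac)
  qed
  then show "(\<Sum>j\<in>UNIV. rate y M \<bar>\<delta> h j\<bar>) \<le> n * rate_max y * M\<^sup>2"
    and "y \<le> 7 \<Longrightarrow> (\<Sum>j\<in>UNIV. rate y M \<bar>\<delta> h j\<bar>) \<le> 4 * n * M\<^sup>2" by auto
qed

lemma pot_le:
  assumes "\<And>i h. i < K \<Longrightarrow> length h = i \<Longrightarrow> (\<Sum>j\<in>UNIV. rate ((u i + 1) / n) M \<bar>\<delta> h j\<bar>) \<le> n * r i * M\<^sup>2"
  shows "avg K (pot K) + n * (\<Sum>i<K. F i) \<le> n\<^sup>2 * M\<^sup>2 * (\<Sum>i<K. r i)"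
  using assms
proof (induction K)
  case 0
  then show ?case by (simp add: pot_def)
next
  case (Suc K)
  have "avg K (\<lambda>h. \<Sum>j\<in>UNIV. n * rate ((u K + 1) / n) M \<bar>\<delta> h j\<bar>) \<le> avg K (\<lambda>h::'n list. n\<^sup>2 * M\<^sup>2 * r K)"
  proof (rule avg_mono)
    fix h :: "'n list" assume "length h = K"
    then have "n * (\<Sum>j\<in>UNIV. rate ((u K + 1) / n) M \<bar>\<delta> h j\<bar>) \<le> n * (n * r K * M\<^sup>2)"
      using Suc.prems[of K h] n_ge by (intro mult_left_mono) auto
    then show "(\<Sum>j\<in>UNIV. n * rate ((u K + 1) / n) M \<bar>\<delta> h j\<bar>) \<le> n\<^sup>2 * M\<^sup>2 * r K"
      by (simp add: sum_distrib_left[symmetric] power2_eq_square mult_ac)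
  qed
  then have "avg (Suc K) (pot (Suc K)) + n * F K \<le> avg K (pot K) + n\<^sup>2 * M\<^sup>2 * r K"
    using pot_step[of K] by simp
  moreover have "avg K (pot K) + n * (\<Sum>i<K. F i) \<le> n\<^sup>2 * M\<^sup>2 * (\<Sum>i<K. r i)"
    using Suc by simp
  ultimately show ?case by (simp add: distrib_left)
qed

text \<open>\<open>K \<le> 7 * n\<close> keeps \<open>z = (u i + 1) / n\<close> below 9, where the
  majorants hold. Up to \<open>5 * n\<close> every step costs at most 4 units; beyond that only the
  sum of the values \<open>rate_max\<close> stays below \<open>4 * K\<close>. The second moment of
  \<open>b\<close> appears because Bregman distances to 0 satisfy
  \<open>breg (l j) (b h j) 0 \<le> \<gamma> / 2 * (b h j)\<^sup>2\<close>.\<close>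

lemma regime_small:
  assumes n: "2 \<le> n" and K: "real K \<le> 7 * n"
  shows "n * (\<Sum>i<K. F i) + nu K / 2 * avg K (\<lambda>h. \<Sum>j\<in>UNIV. (b h j)\<^sup>2) \<le> 4 * n\<^sup>2 * M\<^sup>2 * K"
proof -
  define zz where "zz i = (u i + 1) / n" for i
  have zz_eq: "zz i = 2 + (real i + 1) / n" for i using n_ge by (simp add: zz_def u_def field_simps)
  define r where "r i = (if real K \<le> 5 * n then 4 else rate_max (zz i))" for i
  have "(\<Sum>j\<in>UNIV. rate (zz i) M \<bar>\<delta> h j\<bar>) \<le> n * r i * M\<^sup>2" if "i < K" "length h = i" for i h
  proof -
    have i: "real i + 1 \<le> K" using that by simp
    have "zz i \<le> 9" using i K n_ge by (simp add: zz_eq divide_le_eq)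
    moreover have "zz i \<le> 7" if "real K \<le> 5 * n" using i that n_ge by (simp add: zz_eq divide_le_eq)
    ultimately show ?thesis
      using sum_rate_le[OF that(2) zz_def] by (auto simp: r_def mult_ac)
  qed
  then have 1: "avg K (pot K) + n * (\<Sum>i<K. F i) \<le> n\<^sup>2 * M\<^sup>2 * (\<Sum>i<K. r i)"
    unfolding zz_def by (rule pot_le)
  have "(\<Sum>i<K. r i) \<le> 4 * K"
  proof (cases "real K \<le> 5 * n")
    case False
    have "r i = 217 / 50 - 12 / 25 * ((real i + 1) / n) + 2 / 25 * ((real i + 1) / n)\<^sup>2" for i
    proof -
      have "197 / 50 + 2 / 25 * ((2 + x - 3) * (2 + x - 7)) = 217 / 50 - 12 / 25 * x + 2 / 25 * x\<^sup>2"
        for x :: real by (simp add: power2_eq_square field_simps)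
      then show ?thesis using False by (simp only: r_def rate_max_def zz_eq if_False)
    qed
    then have "r i = 217 / 50 - 12 / 25 / n * (real i + 1) + 2 / 25 / n\<^sup>2 * (real i + 1)\<^sup>2" for i
      by (simp add: power_divide)
    then have s0: "(\<Sum>i<K. r i) = 217 / 50 * K - 12 / 25 / n * (\<Sum>i<K. real i + 1) + 2 / 25 / n\<^sup>2 * (\<Sum>i<K. (real i + 1)\<^sup>2)"
      by (simp only: sum.distrib sum_subtractf sum_distrib_left[symmetric] sum_constant) simp
    have s1: "(\<Sum>i<K. real i + 1) = K * (real K + 1) / 2" by (induction K) (auto simp: field_simps)
    have s2: "(\<Sum>i<K. (real i + 1)\<^sup>2) = K * (real K + 1) * (2 * real K + 1) / 6"
      by (induction K) (auto simp: field_simps power2_eq_square)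
    have r_eq: "(\<Sum>i<K. r i) = 4 * K + K / (150 * n\<^sup>2) * (51 * n\<^sup>2 - 36 * n * (real K + 1) + 2 * (real K + 1) * (2 * real K + 1))"
      unfolding s0 s1 s2 using n_ge by (simp add: field_simps power2_eq_square)
    have "51 * n\<^sup>2 - 36 * n * (real K + 1) + 2 * (real K + 1) * (2 * real K + 1) \<le> 0"
    proof -
      define x where "x = real K"
      have x: "5 * n \<le> x" "x \<le> 7 * n" using False K by (auto simp: x_def)
      \<comment> \<open>The first two terms have a sign for
        \<open>5 * n \<le> x \<le> 7 * n\<close>; the last bracket is nonnegative because
        \<open>2 \<le> n\<close>.\<close>
      have "0 \<le> 4 * ((x - 5 * n) * (7 * n - x)) + (12 * n + 6) * (7 * n - x) + (5 * n\<^sup>2 - 6 * n - 2)"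
      proof -
        have "5 * n\<^sup>2 - 6 * n - 2 = 5 * (n - 2) * n + 4 * (n - 2) + 6" by (simp add: algebra_simps power2_eq_square)
        moreover have "0 \<le> 5 * (n - 2) * n + 4 * (n - 2) + 6" using n by (intro add_nonneg_nonneg mult_nonneg_nonneg) auto
        moreover have "0 \<le> 4 * ((x - 5 * n) * (7 * n - x))" "0 \<le> (12 * n + 6) * (7 * n - x)"
          using x n by auto
        ultimately show ?thesis by linarith
      qed
      also have "\<dots> = - (51 * n\<^sup>2 - 36 * n * (x + 1) + 2 * (x + 1) * (2 * x + 1))"
        by (simp add: algebra_simps power2_eq_square)
      finally show ?thesis unfolding x_def[symmetric] by linarith
    qed
    then have "K / (150 * n\<^sup>2) * (51 * n\<^sup>2 - 36 * n * (real K + 1) + 2 * (real K + 1) * (2 * real K + 1)) \<le> 0"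
      by (intro mult_nonneg_nonpos) auto
    then show ?thesis unfolding r_eq by linarith
  qed (simp add: r_def)
  then have "n\<^sup>2 * M\<^sup>2 * (\<Sum>i<K. r i) \<le> n\<^sup>2 * M\<^sup>2 * (4 * K)" by (intro mult_left_mono) auto
  moreover have "nu K / 2 * avg K (\<lambda>h. \<Sum>j\<in>UNIV. (b h j)\<^sup>2) \<le> avg K (pot K)"
    unfolding avg_cmult[symmetric] pot_def sum_distrib_left
    using n_ge u_ge[of K] by (intro avg_mono sum_mono) auto
  ultimately show ?thesis using 1 by (simp add: mult_ac)
qed

end

section \<open>Second moments over long runs\<close>

lemma sum_arith:
  fixes n :: real
  shows "(\<Sum>i<K. 2 * n + real i) = real K * (4 * n + real K - 1) / 2"
    and "(\<Sum>i<K. (2 * n + real i)\<^sup>2)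
      = ((2 * n + K) * (2 * n + K - 1) * (2 * (2 * n + K) - 1) - 2 * n * (2 * n - 1) * (4 * n - 1)) / 6"
    and "(\<Sum>i<K. real i) = real K * (real K - 1) / 2"
  by (induction K) (auto simp: field_simps power2_eq_square)

text \<open>Both \<open>m \<in> {0, 1/2}\<close> are covered by a cubic; in between the difference is concave in \<open>m\<close>.\<close>

lemma middle_cubic:
  fixes m x :: real
  assumes m: "0 \<le> m" "m \<le> 1/2" and x: "9 \<le> x" "x \<le> 31"
  shows "2 / 3 * (2 * x^3 - 3 * m * x\<^sup>2 + m\<^sup>2 * x - 16 + 12 * m - 2 * m\<^sup>2)
    \<le> (39 / 100 * x + 49 / 10) * (x - 2) * (3 * x - 10 - 3 * m)"
proof -
  have "(39 / 100 * x + 49 / 10) * (x - 2) * (3 * x - 10 - 3 * m)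
      - 2 / 3 * (2 * x^3 - 3 * m * x\<^sup>2 + m\<^sup>2 * x - 16 + 12 * m - 2 * m\<^sup>2)
    = (1 - 2 * m) / 300 * (32600 - 21180*x + 2538*x^2 - 49*x^3)
      + 2 * m / 600 * (71820 - 46168*x + 5325*x^2 - 98*x^3) + 2 / 3 * (x - 2) * m * (1 / 2 - m)"
    by (simp add: field_simps power2_eq_square power3_eq_cube)
  also have "\<dots> \<ge> 0"
    using m x poly_middle_0[OF x] poly_middle_1[OF x] by (intro add_nonneg_nonneg mult_nonneg_nonneg) auto
  finally show ?thesis by simp
qed

text \<open>\<open>\<sigma>\<close> is an affine function of \<open>n / X\<close> fitted so that
  both inequalities hold for \<open>X / n\<close> between 9 and 31. In \<open>regime_middle\<close>
  the first one yields \<open>\<tau> / 2 \<le> p\<close>, the second one makes the excess over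
  \<open>4 * n * K\<close> nonpositive.\<close>

lemma middle_arith:
  fixes n K :: real
  assumes n: "2 \<le> n" and K: "7 * n \<le> K" "K \<le> 29 * n"
  defines "X \<equiv> 2 * n + K"
  defines "\<sigma> \<equiv> 39 / 100 + 49 / 10 * n / X"
  shows "\<sigma>^3 * X \<le> 4 * n * (1 + \<sigma>\<^sup>2)"
    and "4 / 6 * (X * (X - 1) * (2 * X - 1) - 2 * n * (2 * n - 1) * (4 * n - 1))
      \<le> \<sigma> * X * K * (3 * K - 4 * n - 3)"
proof -
  define x where "x = X / n"
  define S where "S = 39 / 100 * x + 49 / 10"
  have pos: "0 < n" "0 < X" using n K by (auto simp: X_def)
  have x: "9 \<le> x" "x \<le> 31" using n K by (auto simp: x_def X_def field_simps)
  have Xx: "X = n * x" using pos by (simp add: x_def)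
  have sx: "\<sigma> * x = S" using pos by (simp add: \<sigma>_def S_def x_def field_simps)
  have "4 * x\<^sup>2 + 4 * S\<^sup>2 - S^3 = (-21609000 - 12803700*x + 2372530*x^2 - 59319*x^3) / 1000000"
    by (simp add: S_def field_simps power2_eq_square power3_eq_cube)
  then have "S^3 \<le> 4 * x\<^sup>2 + 4 * S\<^sup>2" using poly_tau[OF x] by simp
  then have "x\<^sup>2 * (\<sigma>^3 * x) \<le> x\<^sup>2 * (4 * (1 + \<sigma>\<^sup>2))"
    unfolding sx[symmetric] by (simp add: power_mult_distrib power2_eq_square power3_eq_cube algebra_simps)
  then have "\<sigma>^3 * x \<le> 4 * (1 + \<sigma>\<^sup>2)" using x by simp
  then have "n * (\<sigma>^3 * x) \<le> n * (4 * (1 + \<sigma>\<^sup>2))" using pos by (intro mult_left_mono) auto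
  then show "\<sigma>^3 * X \<le> 4 * n * (1 + \<sigma>\<^sup>2)" by (simp add: Xx mult_ac)
  have K_eq: "K = n * (x - 2)" using Xx by (simp add: X_def algebra_simps)
  define m where "m = 1 / n"
  have m: "0 \<le> m" "m \<le> 1 / 2" using n by (auto simp: m_def field_simps)
  have nm: "n * m = 1" using pos by (simp add: m_def)
  have "4 / 6 * (X * (X - 1) * (2 * X - 1) - 2 * n * (2 * n - 1) * (4 * n - 1))
      = 4 / 6 * (n * x * (n * x - n * m) * (2 * (n * x) - n * m) - 2 * n * (2 * n - n * m) * (4 * n - n * m))"
    by (simp add: nm Xx)
  also have "\<dots> = n^3 * (2 / 3 * (2 * x^3 - 3 * m * x\<^sup>2 + m\<^sup>2 * x - 16 + 12 * m - 2 * m\<^sup>2))"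
    by (simp add: field_simps power2_eq_square power3_eq_cube)
  also have "\<dots> \<le> n^3 * (S * (x - 2) * (3 * x - 10 - 3 * m))"
    unfolding S_def using middle_cubic[OF m x] pos by (intro mult_left_mono) auto
  also have "\<dots> = (n * S) * (n * (x - 2)) * (3 * (n * (x - 2)) - 4 * n - 3 * (n * m))"
    by (simp add: algebra_simps power3_eq_cube)
  also have "n * S = \<sigma> * X" using sx Xx by (simp add: algebra_simps)
  finally show "4 / 6 * (X * (X - 1) * (2 * X - 1) - 2 * n * (2 * n - 1) * (4 * n - 1))
      \<le> \<sigma> * X * K * (3 * K - 4 * n - 3)"
    by (simp add: K_eq[symmetric] nm)
qed

lemma sum_inverse_le_ln:
  fixes N k :: nat
  assumes "0 < N" "N \<le> k"
  shows "(\<Sum>i=N..k. 1 / real i) \<le> 1 / N + ln (real k / N)"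
  using assms(2)
proof (induction k rule: dec_induct)
  case base
  then show ?case using assms by simp
next
  case (step k)
  have k: "0 < real k" using step assms by simp
  have "ln (real k / (real k + 1)) \<le> real k / (real k + 1) - 1"
    using k by (intro ln_le_minus_one) auto
  also have "\<dots> = - (1 / (real k + 1))" using k by (simp add: field_simps)
  finally have "1 / (real k + 1) \<le> ln ((real k + 1) / N) - ln (real k / N)"
    using k assms by (simp add: ln_div)
  then show ?case using step by (simp add: add.commute)
qed

text \<open>The tangent of the logarithm at 19, with \<open>ln 19\<close> rounded up to 3. The
  latter follows from \<open>exp 3 \<ge> 19\<close>, obtained as the twelfth power of a quadratic
  Taylor bound at \<open>1 / 4\<close>.\<close>

lemma ln_le_linear:
  fixes x :: real assumes "0 < x" shows "ln x \<le> x / 19 + 2"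
proof -
  have "41 / 32 \<le> exp (1 / 4 :: real)" using exp_lower_Taylor_quadratic[of "1 / 4 :: real"]
    by (simp add: power2_eq_square)
  then have "(41 / 32)^12 \<le> (exp (1 / 4 :: real))^12" by (intro power_mono) auto
  also have "(exp (1 / 4 :: real))^12 = exp 3" by (simp add: exp_of_nat_mult[symmetric])
  finally have "19 \<le> exp (3::real)" by (simp add: power_numeral_reduce)
  then have "ln 19 \<le> (3::real)" by (metis ln_exp ln_le_cancel_iff zero_less_numeral exp_gt_zero)
  moreover have "ln (x / 19) \<le> x / 19 - 1" using assms by (intro ln_le_minus_one) auto
  moreover have "ln (x / 19) = ln x - ln 19" using assms by (simp add: ln_div)
  ultimately show ?thesis by linarith
qed

lemma large_arith:
  fixes n K :: real
  assumes n: "2 \<le> n" and K: "29 * n \<le> K"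
  defines "X \<equiv> 2 * n + K"
  shows "5 / 3 * (21 / 19 * n * K + 15 / 2 * n\<^sup>2 + 7 / 2 * n) + 5 / 2 * n * (4 * n + K) / X\<^sup>2 * (K * (4 * n + K - 1) / 2)
    + 40 * n^3 / X\<^sup>2 * K + n * (2 * n - 1) / 3 \<le> 4 * n * K"
proof -
  have pos: "0 < n" "0 < X" "0 < K" using n K by (auto simp: X_def)
  have n2: "n * n \<le> n * K / 29" using mult_left_mono[OF K, of n] pos by simp
  have n1: "n \<le> n * K / 58"
  proof -
    have "2 * n \<le> n * n" using n by simp
    then show ?thesis using n2 by simp
  qed
  have "(4 * n + K) / X \<le> 33 / 31" using K pos by (simp add: X_def field_simps)
  then have "((4 * n + K) / X)\<^sup>2 \<le> (33 / 31)\<^sup>2" using pos by (intro power_mono) auto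
  then have r: "((4 * n + K) / X)\<^sup>2 \<le> 1089 / 961" by (simp add: power2_eq_square)
  have "5 / 2 * n * (4 * n + K) / X\<^sup>2 * (K * (4 * n + K - 1) / 2)
      \<le> 5 / 2 * n * (4 * n + K) / X\<^sup>2 * (K * (4 * n + K) / 2)"
    using pos by (intro mult_left_mono divide_right_mono) auto
  also have "\<dots> = 5 / 4 * (n * K) * ((4 * n + K) / X)\<^sup>2"
    using pos by (simp add: field_simps power2_eq_square)
  also have "\<dots> \<le> 5 / 4 * (n * K) * (1089 / 961)" using pos by (intro mult_left_mono r) auto
  finally have 1: "5 / 2 * n * (4 * n + K) / X\<^sup>2 * (K * (4 * n + K - 1) / 2) \<le> 5445 / 3844 * (n * K)" by simp
  have "n / X \<le> 1 / 31" using K pos by (simp add: X_def field_simps)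
  then have "(n / X)\<^sup>2 \<le> (1 / 31)\<^sup>2" using pos by (intro power_mono) auto
  then have "40 * (n * K) * (n / X)\<^sup>2 \<le> 40 * (n * K) * (1 / 961)"
    using pos by (intro mult_left_mono) (auto simp: power2_eq_square)
  moreover have "40 * (n * K) * (n / X)\<^sup>2 = 40 * n^3 / X\<^sup>2 * K"
    by (simp add: power_divide power2_eq_square power3_eq_cube)
  ultimately have 2: "40 * n^3 / X\<^sup>2 * K \<le> 40 / 961 * (n * K)" by simp
  have 3: "n * (2 * n - 1) / 3 \<le> 2 / 3 * (n * n)" using pos by (simp add: field_simps)
  \<comment> \<open>Everything is measured in units of \<open>P = n * K\<close>. The shares 1.85,
    1.42, 0.05, 0.46 and 0.11 add up to less than 4.\<close>
  have arith: "5 / 3 * (21 / 19 * P + 15 / 2 * Q + 7 / 2 * x) + T1 + T2 + T3 \<le> 4 * P"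
    if "T1 \<le> 5445 / 3844 * P" "T2 \<le> 40 / 961 * P" "T3 \<le> 2 / 3 * Q" "Q \<le> P / 29" "x \<le> P / 58" "0 < x"
    for P Q x T1 T2 T3 :: real
  proof -
    have "0 \<le> P" using that by linarith
    then have "T1 \<le> 142 / 100 * P" "T2 \<le> 5 / 100 * P" using that by linarith+
    moreover have "5 / 3 * (21 / 19 * P + 15 / 2 * Q + 7 / 2 * x) = 35 / 19 * P + 25 / 2 * Q + 35 / 6 * x" by simp
    moreover have "35 / 19 * P \<le> 185 / 100 * P" "25 / 2 * Q + 2 / 3 * Q \<le> 46 / 100 * P" "35 / 6 * x \<le> 11 / 100 * P"
      using that \<open>0 \<le> P\<close> by linarith+
    ultimately show ?thesis using that(3) \<open>0 \<le> P\<close> by linarith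
  qed
  show ?thesis
    using arith[OF 1 2 3 n2 n1 pos(1)] unfolding power2_eq_square[of n] mult.assoc[of "21 / 19" n] mult.assoc[of 4 n] .
qed

section \<open>Medium and long runs\<close>

context coord_tree
begin

lemma nu_z_le: "nu K * z K \<le> 2 * n / (u K)\<^sup>2 * (\<Sum>i<K. (u i)\<^sup>2 * F i)"
proof -
  have pos: "0 < nu K" "0 < u K" "2 * n \<le> u K" using nu_pos[of K] u_ge[of K] by (auto simp: u_def)
  have "nu K * z K = (n - 1) * (\<Sum>i<K. (u i)\<^sup>2 * F i) / nu K"
    using z_eq[of K] pos by (simp add: field_simps power2_eq_square)
  also have "\<dots> = (n - 1) / nu K * (\<Sum>i<K. (u i)\<^sup>2 * F i)" by simp
  also have "\<dots> \<le> 2 * n / (u K)\<^sup>2 * (\<Sum>i<K. (u i)\<^sup>2 * F i)"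
  proof (rule mult_right_mono)
    have "(n - 1) * u K \<le> n * (u K - 1)" using pos n_ge by (simp add: algebra_simps)
    moreover have "1 < u K" using u_ge[of K] by simp
    ultimately show "(n - 1) / nu K \<le> 2 * n / (u K)\<^sup>2"
      using pos by (simp add: nu_def field_simps power2_eq_square)
    show "0 \<le> (\<Sum>i<K. (u i)\<^sup>2 * F i)" by (intro sum_nonneg mult_nonneg_nonneg F_nonneg) auto
  qed
  finally show ?thesis .
qed

lemma sum_F_le:
  assumes "\<And>i. i < K \<Longrightarrow> 0 \<le> c i"
  shows "(\<Sum>i<K. c i * F i) \<le> 4 * n * M\<^sup>2 * (\<Sum>i<K. c i)"
proof -
  have "(\<Sum>i<K. c i * F i) \<le> (\<Sum>i<K. c i * (4 * n * M\<^sup>2))"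
    using assms F_le by (intro sum_mono mult_left_mono) auto
  then show ?thesis by (simp add: sum_distrib_right[symmetric] mult.commute)
qed

text \<open>After \<open>nu_z_le\<close> all terms are sums of multiples of \<open>F i\<close>,
  except for the multiple of \<open>q K\<close>. A part \<open>p * real i\<close> of each
  coefficient is charged to \<open>weighted_q\<close> with constant weight, which also disposes of
  \<open>q K\<close>; the rest \<open>c i\<close> is bounded by \<open>F_le\<close>, which requires
  \<open>c i\<close> to be nonnegative.\<close>

lemma regime_middle:
  assumes n: "2 \<le> n" and K: "7 * n \<le> real K" "real K \<le> 29 * n"
  obtains \<tau> where "0 < \<tau>"
    "n * (\<Sum>i<K. F i) + \<tau> / 2 * (nu K * q K) + (1 + 1 / \<tau>) / 2 * (nu K * z K) \<le> 4 * n\<^sup>2 * M\<^sup>2 * K"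
proof
  define X where "X = u K"
  define \<sigma> where "\<sigma> = 39 / 100 + 49 / 10 * n / X"
  define \<tau> where "\<tau> = \<sigma>\<^sup>2"
  define \<kappa> where "\<kappa> = 1 + 1 / \<tau>"
  \<comment> \<open>The choices of \<open>p\<close> and of \<open>\<tau>\<close> as the square of
    \<open>\<sigma>\<close> complete the square: \<open>c i\<close> becomes \<open>\<kappa> * n * (u
    i / X - \<sigma>)\<^sup>2 + n * (2 * p - \<tau>)\<close>. Thus \<open>c i\<close> is nonnegative
    as soon as \<open>\<tau> / 2 \<le> p\<close>, which is also what the term with
    \<open>q K\<close> needs.\<close>
  define p where "p = 2 * \<kappa> * \<sigma> * n / X"
  have X: "0 < X" "X = 2 * n + real K" using n by (auto simp: X_def u_def)
  have pos: "0 < \<sigma>" "0 < n" using X n by (auto simp: \<sigma>_def intro!: add_pos_nonneg)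
  then show tau: "0 < \<tau>" by (simp add: \<tau>_def)
  have k_tau: "\<kappa> * \<sigma>\<^sup>2 = 1 + \<tau>" using pos by (simp add: \<kappa>_def \<tau>_def field_simps)
  note arith = middle_arith[OF n K, folded X(2), folded \<sigma>_def]
  have p_ge: "\<tau> / 2 \<le> p"
  proof -
    have "\<sigma>^3 * X \<le> \<sigma>\<^sup>2 * (4 * n * \<kappa>)"
    proof -
      have e: "\<sigma>\<^sup>2 * (4 * n * \<kappa>) = 4 * n * (\<kappa> * \<sigma>\<^sup>2)" by (simp add: mult_ac)
      show ?thesis unfolding e k_tau unfolding \<tau>_def by (rule arith(1))
    qed
    then have "\<sigma>\<^sup>2 * (\<sigma> * X) \<le> \<sigma>\<^sup>2 * (4 * n * \<kappa>)" by (simp add: power3_eq_cube power2_eq_square mult_ac)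
    then have "\<sigma> * X \<le> 4 * n * \<kappa>" using pos by simp
    then have "\<sigma> * (\<sigma> * X) \<le> \<sigma> * (4 * n * \<kappa>)" using pos by (intro mult_left_mono) auto
    then show ?thesis using X by (simp add: p_def \<tau>_def field_simps power2_eq_square)
  qed
  define c where "c i = n + \<kappa> * n / X\<^sup>2 * (u i)\<^sup>2 - p * real i" for i
  have c: "0 \<le> c i" for i
  proof -
    have "c i = \<kappa> * n * (u i / X - \<sigma>)\<^sup>2 + n * (2 * p - \<tau>)"
    proof -
      have "\<kappa> * n * (u i / X - \<sigma>)\<^sup>2 = \<kappa> * n / X\<^sup>2 * (u i)\<^sup>2 - p * u i + n * (\<kappa> * \<sigma>\<^sup>2)"
        using X(1) by (simp add: p_def power2_eq_square field_simps)
      then show ?thesis unfolding k_tau c_def by (simp add: u_def algebra_simps)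
    qed
    then show ?thesis using p_ge pos tau by (simp add: \<kappa>_def)
  qed
  have "n * (\<Sum>i<K. F i) + \<tau> / 2 * (nu K * q K) + \<kappa> / 2 * (nu K * z K)
      \<le> n * (\<Sum>i<K. F i) + p * (nu K * q K) + \<kappa> / 2 * (2 * n / X\<^sup>2 * (\<Sum>i<K. (u i)\<^sup>2 * F i))"
    using nu_z_le[of K] p_ge tau q_nonneg[of K] nu_pos[of K] n_ge
    by (intro add_mono mult_left_mono mult_right_mono) (auto simp: X_def \<kappa>_def)
  also have "\<dots> = (\<Sum>i<K. c i * F i) + ((\<Sum>i<K. p * (real i * F i)) + p * (nu K * q K))"
    by (simp add: c_def sum_distrib_left sum.distrib[symmetric] sum_subtractf[symmetric] algebra_simps)
  also have "\<dots> \<le> 4 * n * M\<^sup>2 * (\<Sum>i<K. c i) + n * M\<^sup>2 * (\<Sum>i<K. p * u i)"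
    using p_ge tau by (intro add_mono sum_F_le weighted_q c) auto
  also have "\<dots> = n * M\<^sup>2 * (4 * n * K + (p * ((\<Sum>i<K. u i) - 4 * (\<Sum>i<K. real i)) + 4 * \<kappa> * n / X\<^sup>2 * (\<Sum>i<K. (u i)\<^sup>2)))"
  proof -
    have 1: "(\<Sum>i<K. c i) = n * K + \<kappa> * n / X\<^sup>2 * (\<Sum>i<K. (u i)\<^sup>2) - p * (\<Sum>i<K. real i)"
      unfolding c_def by (simp only: sum.distrib sum_subtractf sum_distrib_left[symmetric] sum_constant) simp
    show ?thesis unfolding 1 sum_distrib_left[symmetric] by (simp add: algebra_simps)
  qed
  also have "\<dots> \<le> n * M\<^sup>2 * (4 * n * K)"
  proof (rule mult_left_mono)
    have eq: "p * x + 4 * \<kappa> * n / X\<^sup>2 * y = \<kappa> * n / X\<^sup>2 * (2 * \<sigma> * X * x + 4 * y)" for x y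
      using X(1) by (simp add: p_def field_simps power2_eq_square)
    have "2 * \<sigma> * X * (real K * (4 * n + real K - 1) / 2 - 4 * (real K * (real K - 1) / 2))
      + 4 * ((X * (X - 1) * (2 * X - 1) - 2 * n * (2 * n - 1) * (4 * n - 1)) / 6) \<le> 0"
    proof -
      have "2 * \<sigma> * X * (real K * (4 * n + real K - 1) / 2 - 4 * (real K * (real K - 1) / 2))
          = - (\<sigma> * X * real K * (3 * real K - 4 * n - 3))" by (simp add: field_simps)
      then show ?thesis using arith(2) by linarith
    qed
    then have "\<kappa> * n / X\<^sup>2 * (2 * \<sigma> * X * ((\<Sum>i<K. u i) - 4 * (\<Sum>i<K. real i)) + 4 * (\<Sum>i<K. (u i)\<^sup>2)) \<le> 0"
      unfolding u_def sum_arith X(2)[symmetric] using pos tau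
      by (intro mult_nonneg_nonpos) (auto simp: \<kappa>_def)
    then show "4 * n * K + (p * ((\<Sum>i<K. u i) - 4 * (\<Sum>i<K. real i)) + 4 * \<kappa> * n / X\<^sup>2 * (\<Sum>i<K. (u i)\<^sup>2)) \<le> 4 * n * K"
      unfolding eq by simp
  qed (use pos in auto)
  finally show "n * (\<Sum>i<K. F i) + \<tau> / 2 * (nu K * q K) + (1 + 1 / \<tau>) / 2 * (nu K * z K) \<le> 4 * n\<^sup>2 * M\<^sup>2 * K"
    by (simp add: \<kappa>_def power2_eq_square mult_ac)
qed

text \<open>The factors arise from \<open>avg_regret_quadratic\<close> with
  \<open>\<tau> = 2 / 3\<close>, where \<open>Q\<close> is the Bregman distance to a nearly optimal
  point: \<open>5 / 3 = 1 + \<tau>\<close>, \<open>5 / 4 = (1 + 1 / \<tau>) / 2\<close>, and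
  \<open>1 / 3 = \<tau> / 2\<close> belongs to the initial distance.\<close>

lemma regime_large:
  assumes n: "2 \<le> n" and K: "29 * n \<le> real K"
  shows "5 / 3 * (n * (\<Sum>i<K. F i)) + 5 / 4 * (nu K * z K) + n * nu 0 * M\<^sup>2 / 3 \<le> 4 * n\<^sup>2 * M\<^sup>2 * K"
proof -
  define N where "N = CARD('n)"
  have N: "0 < N" "n = real N" "N \<le> K" "N < K" using n K by (auto simp: N_def n_eq)
  define X where "X = u K"
  have X: "0 < X" "X = 2 * n + real K" using n by (auto simp: X_def u_def)
  \<comment> \<open>A weight proportional to \<open>n / i\<close> charges the whole coefficient
    \<open>5 / 3 * n\<close> of \<open>F i\<close> to \<open>weighted_q\<close>, at a cost of
    \<open>n * u i / i\<close> instead of \<open>4 * n\<close> units per step. The cap at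
    \<open>n\<close> keeps the weights bounded for small \<open>i\<close> and still
    nonincreasing.\<close>
  define m where "m i = (if i < N then n else real i)" for i
  have m: "0 < m i" "real i \<le> m i" "m i \<le> m (Suc i)" for i using N by (auto simp: m_def)
  \<comment> \<open>In \<open>(u i)\<^sup>2 = 4 * n\<^sup>2 + (4 * n + real i) * real i\<close> the
    second summand is at most a constant multiple of \<open>real i\<close> and goes into the weights
    through \<open>\<pi>\<close>; the first one goes into \<open>c i\<close> as
    \<open>10 * n^3 / X\<^sup>2\<close>.\<close>
  define \<pi> where "\<pi> = 5 / 2 * n * (4 * n + K) / X\<^sup>2"
  have pi: "0 \<le> \<pi>" using n by (simp add: \<pi>_def)
  define p where "p i = 5 / 3 * n / m i + \<pi>" for i
  have p: "0 \<le> p i" "p (Suc i) \<le> p i" for i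
    using pi n m[of i] m[of "Suc i"] by (auto simp: p_def intro!: divide_left_mono)
  define c where "c i = 5 / 3 * n * (1 - real i / m i) + 10 * n^3 / X\<^sup>2" for i
  have c: "0 \<le> c i" for i using m[of i] n by (simp add: c_def)
  have "5 / 3 * (n * (\<Sum>i<K. F i)) + 5 / 4 * (nu K * z K)
      \<le> 5 / 3 * (n * (\<Sum>i<K. F i)) + 5 / 4 * (2 * n / X\<^sup>2 * (\<Sum>i<K. (u i)\<^sup>2 * F i))"
    using nu_z_le[of K] by (simp add: X_def)
  also have "\<dots> = (\<Sum>i<K. (5 / 3 * n + 5 / 2 * n / X\<^sup>2 * (u i)\<^sup>2) * F i)"
    by (simp add: sum_distrib_left sum.distrib[symmetric] algebra_simps)
  also have "\<dots> \<le> (\<Sum>i<K. (c i + p i * real i) * F i)"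
  proof (intro sum_mono mult_right_mono F_nonneg)
    fix i assume i: "i \<in> {..<K}"
    have "(u i)\<^sup>2 = 4 * n\<^sup>2 + (4 * n + real i) * real i" by (simp add: u_def power2_eq_square algebra_simps)
    also have "\<dots> \<le> 4 * n\<^sup>2 + (4 * n + real K) * real i"
      using i by (intro add_left_mono mult_right_mono) auto
    finally have "5 / 2 * n / X\<^sup>2 * (u i)\<^sup>2 \<le> 5 / 2 * n / X\<^sup>2 * (4 * n\<^sup>2 + (4 * n + real K) * real i)"
      using n by (intro mult_left_mono) auto
    also have "\<dots> = 10 * n^3 / X\<^sup>2 + \<pi> * real i"
    proof -
      have "5 / 2 * n / X\<^sup>2 * (4 * n\<^sup>2 + y * x) = 10 * n^3 / X\<^sup>2 + 5 / 2 * n * y / X\<^sup>2 * x" for x y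
        using X(1) by (simp add: field_simps power2_eq_square power3_eq_cube)
      then show ?thesis by (simp add: \<pi>_def)
    qed
    finally have "5 / 2 * n / X\<^sup>2 * (u i)\<^sup>2 \<le> 10 * n^3 / X\<^sup>2 + \<pi> * real i" .
    then show "5 / 3 * n + 5 / 2 * n / X\<^sup>2 * (u i)\<^sup>2 \<le> c i + p i * real i"
    proof -
      have "5 / 3 * n * (1 - real i / x) + y + (5 / 3 * n / x + \<pi>) * real i = 5 / 3 * n + (y + \<pi> * real i)"
        if "0 < x" for x y
        using that by (simp add: field_simps)
      from this[OF m(1)[of i], of "10 * n^3 / X\<^sup>2"] show ?thesis
        using \<open>5 / 2 * n / X\<^sup>2 * (u i)\<^sup>2 \<le> 10 * n^3 / X\<^sup>2 + \<pi> * real i\<close> unfolding c_def p_def by linarith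
    qed
  qed
  also have "\<dots> = (\<Sum>i<K. c i * F i) + (\<Sum>i<K. p i * (real i * F i))"
    by (simp add: distrib_right sum.distrib mult.assoc)
  also have "\<dots> \<le> 4 * n * M\<^sup>2 * (\<Sum>i<K. c i) + n * M\<^sup>2 * (\<Sum>i<K. p i * u i)"
  proof (rule add_mono)
    show "(\<Sum>i<K. c i * F i) \<le> 4 * n * M\<^sup>2 * (\<Sum>i<K. c i)" by (rule sum_F_le) (rule c)
    have "0 \<le> p K * (nu K * q K)" using p nu_pos[of K] q_nonneg[of K] by (intro mult_nonneg_nonneg) auto
    moreover have "(\<Sum>i<K. p i * (real i * F i)) + p K * (nu K * q K) \<le> n * M\<^sup>2 * (\<Sum>i<K. p i * u i)"
      by (rule weighted_q) (use p in auto)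
    ultimately show "(\<Sum>i<K. p i * (real i * F i)) \<le> n * M\<^sup>2 * (\<Sum>i<K. p i * u i)" by linarith
  qed
  also have "\<dots> = n * M\<^sup>2 * (\<Sum>i<K. 4 * c i + p i * u i)"
    by (simp only: sum.distrib sum_distrib_left[symmetric]) (simp add: algebra_simps)
  also have "\<dots> \<le> n * M\<^sup>2 * (5 / 3 * (21 / 19 * n * K + 15 / 2 * n\<^sup>2 + 7 / 2 * n)
      + \<pi> * (K * (4 * n + K - 1) / 2) + 40 * n^3 / X\<^sup>2 * K)"
  proof (rule mult_left_mono)
    define e where "e i = n * u i / m i + 4 * n * (1 - real i / m i)" for i
    have "(\<Sum>i<K. 4 * c i + p i * u i) = 5 / 3 * (\<Sum>i<K. e i) + \<pi> * (\<Sum>i<K. u i) + 40 * n^3 / X\<^sup>2 * K"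
    proof -
      have "4 * (5 / 3 * n * (1 - y / x) + w) + (5 / 3 * n / x + \<pi>) * v
          = 5 / 3 * (n * v / x + 4 * n * (1 - y / x)) + \<pi> * v + 4 * w" if "0 < x" for x y v w
        using that by (simp add: field_simps)
      from this[OF m(1)] have "4 * c i + p i * u i = 5 / 3 * e i + \<pi> * u i + 4 * (10 * n^3 / X\<^sup>2)" for i
        unfolding c_def p_def e_def .
      then show ?thesis
        by (simp only: sum.distrib sum_distrib_left[symmetric] sum_constant) simp
    qed
    moreover have "(\<Sum>i<K. e i) \<le> 21 / 19 * n * K + 15 / 2 * n\<^sup>2 + 7 / 2 * n"
    proof -
      have "(\<Sum>i<K. e i) = (\<Sum>i<N. e i) + (\<Sum>i=N..K-1. e i)"
      proof -
        have "{..<K} = {..<N} \<union> {N..K-1}" using N by auto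
        moreover have "{..<N} \<inter> {N..K-1} = {}" by auto
        ultimately show ?thesis by (simp add: sum.union_disjoint)
      qed
      moreover have "(\<Sum>i<N. e i) = (\<Sum>i<N. 6 * n - 3 * real i)"
        using n by (intro sum.cong) (auto simp: e_def m_def u_def field_simps)
      moreover have "(\<Sum>i<N. 6 * n - 3 * real i) = 9 / 2 * n\<^sup>2 + 3 / 2 * n"
        by (simp only: sum_subtractf sum_distrib_left[symmetric] sum_arith(3) sum_constant card_lessThan)
          (simp add: N(2) field_simps power2_eq_square)
      moreover have "(\<Sum>i=N..K-1. e i) = (\<Sum>i=N..K-1. n + 2 * n\<^sup>2 * (1 / real i))"
        using N(1,3,4) by (intro sum.cong) (auto simp: e_def m_def u_def field_simps power2_eq_square)
      moreover have "(\<Sum>i=N..K-1. n + 2 * n\<^sup>2 * (1 / real i)) = n * (K - n) + 2 * n\<^sup>2 * (\<Sum>i=N..K-1. 1 / real i)"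
        unfolding sum.distrib sum_distrib_left[symmetric] using N by (simp add: of_nat_diff mult.commute)
      moreover have "2 * n\<^sup>2 * (\<Sum>i=N..K-1. 1 / real i) \<le> 2 * n\<^sup>2 * (1 / n + (K / n / 19 + 2))"
      proof (rule mult_left_mono)
        have "(\<Sum>i=N..K-1. 1 / real i) \<le> 1 / N + ln (real (K - 1) / N)"
          by (rule sum_inverse_le_ln) (use N in auto)
        also have "ln (real (K - 1) / N) \<le> real (K - 1) / N / 19 + 2" using N by (intro ln_le_linear) auto
        also have "real (K - 1) / N / 19 \<le> K / n / 19" using N by (simp add: divide_right_mono)
        finally show "(\<Sum>i=N..K-1. 1 / real i) \<le> 1 / n + (K / n / 19 + 2)" by (simp add: N)
      qed simp
      moreover have "2 * n\<^sup>2 * (1 / n + (K / n / 19 + 2)) = 2 * n + 2 / 19 * n * K + 4 * n\<^sup>2"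
        using n by (simp add: field_simps power2_eq_square)
      moreover have "n * (K - n) = n * K - n\<^sup>2" by (simp add: right_diff_distrib power2_eq_square)
      ultimately show ?thesis by linarith
    qed
    moreover have "(\<Sum>i<K. u i) = K * (4 * n + K - 1) / 2" unfolding u_def by (rule sum_arith)
    ultimately show "(\<Sum>i<K. 4 * c i + p i * u i) \<le> 5 / 3 * (21 / 19 * n * K + 15 / 2 * n\<^sup>2 + 7 / 2 * n)
      + \<pi> * (K * (4 * n + K - 1) / 2) + 40 * n^3 / X\<^sup>2 * K" by simp
  qed (use n in auto)
  finally have 1: "5 / 3 * (n * (\<Sum>i<K. F i)) + 5 / 4 * (nu K * z K) \<le>
      n * M\<^sup>2 * (5 / 3 * (21 / 19 * n * K + 15 / 2 * n\<^sup>2 + 7 / 2 * n)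
      + \<pi> * (K * (4 * n + K - 1) / 2) + 40 * n^3 / X\<^sup>2 * K)" .
  have "n * M\<^sup>2 * (5 / 3 * (21 / 19 * n * K + 15 / 2 * n\<^sup>2 + 7 / 2 * n)
      + \<pi> * (K * (4 * n + K - 1) / 2) + 40 * n^3 / X\<^sup>2 * K + n * (2 * n - 1) / 3) \<le> n * M\<^sup>2 * (4 * n * K)"
    using large_arith[OF n K] n unfolding X(2) \<pi>_def by (intro mult_left_mono) auto
  moreover have "n * nu 0 * M\<^sup>2 / 3 = n * M\<^sup>2 * (n * (2 * n - 1) / 3)" by (simp add: nu_def u_def)
  moreover have "n * M\<^sup>2 * (4 * n * K) = 4 * n\<^sup>2 * M\<^sup>2 * K" by (simp add: power2_eq_square mult_ac)
  ultimately show ?thesis using 1 unfolding distrib_left[of _ _ "n * (2 * n - 1) / 3"] by linarith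
qed

end

section \<open>The expected regret\<close>

locale loss_tree = coord_tree a n M
  for a :: "'n::finite list \<Rightarrow> 'n \<Rightarrow> real" and n M :: real +
  fixes l :: "'n \<Rightarrow> real \<Rightarrow> real" and \<gamma> :: real
  assumes losses: "smooth_loss (l j) \<gamma>"
begin

primrec tangent_sum :: "'n list \<Rightarrow> real" where
  "tangent_sum [] = 0"
| "tangent_sum (i # h) = tangent_sum h
    + u (length h) * (\<Sum>j\<in>UNIV. l j (s h j) + deriv (l j) (s h j) * \<delta> h j)"

definition regret :: "'n list \<Rightarrow> real" where
  "regret h = (\<Sum>j\<in>UNIV. nu (length h) * l j (b h j) - nu 0 * l j 0) - tangent_sum h"

lemma nu_eta_div: "nu (Suc k) * eta k / n = u k"
  using n_ge by (simp add: nu_eta)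

lemma gamma_pos: "0 < \<gamma>" using losses smooth_loss.gamma_pos by blast

lemma avg_tangent_step:
  "avg (Suc k) tangent_sum = avg k tangent_sum
    + avg k (\<lambda>h. u k * (\<Sum>j\<in>UNIV. l j (s h j) + deriv (l j) (s h j) * \<delta> h j))"
  unfolding avg.simps avg_add[symmetric]
  by (rule avg_cong) (simp add: add_divide_distrib)

text \<open>The descent inequality averaged over the drawn coordinate. The linear term gets the
  weight \<open>nu (Suc k) * eta k / n = u k\<close>, and \<open>u k * eta k \<le> 2 * n\<close>
  bounds the quadratic one.\<close>

lemma avg_loss_step:
  "nu (Suc k) * avg (Suc k) (\<lambda>h. \<Sum>j\<in>UNIV. l j (s h j))
    \<le> nu k * avg k (\<lambda>h. \<Sum>j\<in>UNIV. l j (s h j))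
      + avg k (\<lambda>h. u k * (\<Sum>j\<in>UNIV. l j (s h j) + deriv (l j) (s h j) * \<delta> h j)) + \<gamma> * n * F k"
proof -
  have "nu (Suc k) * avg (Suc k) (\<lambda>h. \<Sum>j\<in>UNIV. l j (s h j))
      = nu (Suc k) * avg k (\<lambda>h. \<Sum>j\<in>UNIV. l j (s h j) + (l j (s h j + eta k * \<delta> h j) - l j (s h j)) / n)"
    using avg_step[of k "\<lambda>j x y. l j x"] by simp
  also have "\<dots> = avg k (\<lambda>h. \<Sum>j\<in>UNIV. nu (Suc k) * (l j (s h j) + (l j (s h j + eta k * \<delta> h j) - l j (s h j)) / n))"
    by (simp add: avg_cmult[symmetric] sum_distrib_left)
  also have "\<dots> \<le> avg k (\<lambda>h. \<Sum>j\<in>UNIV. nu k * l j (s h j)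
      + u k * (l j (s h j) + deriv (l j) (s h j) * \<delta> h j) + \<gamma> * n * (\<delta> h j)\<^sup>2)"
  proof (intro avg_mono sum_mono)
    fix h :: "'n list" and j
    let ?x = "l j (s h j)" and ?d = "\<delta> h j"
    have "l j (s h j + eta k * ?d) - ?x \<le> eta k * (deriv (l j) (s h j) * ?d) + \<gamma> / 2 * (eta k)\<^sup>2 * ?d\<^sup>2"
      using smooth_loss.step_le[OF losses[of j], of "s h j" "eta k" ?d] by linarith
    then have "nu (Suc k) / n * (l j (s h j + eta k * ?d) - ?x)
        \<le> nu (Suc k) / n * (eta k * (deriv (l j) (s h j) * ?d) + \<gamma> / 2 * (eta k)\<^sup>2 * ?d\<^sup>2)"
      using nu_pos[of "Suc k"] n_ge by (intro mult_left_mono) auto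
    also have "\<dots> = (nu (Suc k) * eta k) / n * (deriv (l j) (s h j) * ?d + \<gamma> / 2 * eta k * ?d\<^sup>2)"
      by (simp add: algebra_simps power2_eq_square)
    also have "\<dots> = u k * (deriv (l j) (s h j) * ?d) + \<gamma> / 2 * (u k * eta k) * ?d\<^sup>2"
      unfolding nu_eta_div by (simp add: algebra_simps)
    also have "\<dots> \<le> u k * (deriv (l j) (s h j) * ?d) + \<gamma> / 2 * (2 * n) * ?d\<^sup>2"
    proof -
      have "u k * eta k \<le> 2 * n" using u_ge[of k] n_ge by (simp add: eta_def field_simps)
      then show ?thesis using gamma_pos by (intro add_left_mono mult_right_mono mult_left_mono) auto
    qed
    finally have "nu (Suc k) / n * (l j (s h j + eta k * ?d) - ?x)
      \<le> u k * (deriv (l j) (s h j) * ?d) + \<gamma> * n * ?d\<^sup>2" by simp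
    then show "nu (Suc k) * (?x + (l j (s h j + eta k * ?d) - ?x) / n)
      \<le> nu k * ?x + u k * (?x + deriv (l j) (s h j) * ?d) + \<gamma> * n * ?d\<^sup>2"
      using nu_Suc[of k] by (simp add: distrib_left distrib_right)
  qed
  also have "\<dots> = nu k * avg k (\<lambda>h. \<Sum>j\<in>UNIV. l j (s h j))
      + avg k (\<lambda>h. u k * (\<Sum>j\<in>UNIV. l j (s h j) + deriv (l j) (s h j) * \<delta> h j)) + \<gamma> * n * F k"
    by (simp only: sum.distrib sum_distrib_left[symmetric] avg_add avg_cmult F_def)
  finally show ?thesis .
qed

lemma avg_loss_le:
  "nu k * avg k (\<lambda>h. \<Sum>j\<in>UNIV. l j (s h j))
    \<le> nu 0 * (\<Sum>j\<in>UNIV. l j 0) + avg k tangent_sum + \<gamma> * n * (\<Sum>i<k. F i)"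
proof (induction k)
  case (Suc k)
  then show ?case using avg_loss_step[of k] avg_tangent_step[of k] by (simp add: distrib_left)
qed simp

text \<open>The point \<open>c\<close> is the same for all histories, so the linear parts at
  \<open>c\<close> differ by a multiple of \<open>b - s\<close>, which has mean zero. The loss
  difference between \<open>b\<close> and \<open>s\<close> may therefore be measured by Bregman
  distances to any fixed point.\<close>

lemma avg_regret_le:
  "avg k regret \<le> \<gamma> * n * (\<Sum>i<k. F i)
    + nu k * avg k (\<lambda>h. \<Sum>j\<in>UNIV. breg (l j) (b h j) (c j) - breg (l j) (s h j) (c j))"
proof -
  have "avg k regret = avg k (\<lambda>h. nu k * (\<Sum>j\<in>UNIV. l j (b h j)) - nu 0 * (\<Sum>j\<in>UNIV. l j 0) - tangent_sum h)"
    by (rule avg_cong) (simp add: regret_def sum_subtractf sum_distrib_left)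
  also have "\<dots> = nu k * avg k (\<lambda>h. \<Sum>j\<in>UNIV. l j (b h j)) - nu 0 * (\<Sum>j\<in>UNIV. l j 0) - avg k tangent_sum"
    by (simp only: avg_diff avg_cmult avg_const)
  also have "\<dots> \<le> \<gamma> * n * (\<Sum>i<k. F i)
      + (nu k * avg k (\<lambda>h. \<Sum>j\<in>UNIV. l j (b h j)) - nu k * avg k (\<lambda>h. \<Sum>j\<in>UNIV. l j (s h j)))"
    using avg_loss_le[of k] by linarith
  also have "nu k * avg k (\<lambda>h. \<Sum>j\<in>UNIV. l j (b h j)) - nu k * avg k (\<lambda>h. \<Sum>j\<in>UNIV. l j (s h j))
      = nu k * avg k (\<lambda>h. \<Sum>j\<in>UNIV. breg (l j) (b h j) (c j) - breg (l j) (s h j) (c j))"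
  proof -
    have "(\<Sum>j\<in>UNIV. l j (b h j)) - (\<Sum>j\<in>UNIV. l j (s h j))
        = (\<Sum>j\<in>UNIV. breg (l j) (b h j) (c j) - breg (l j) (s h j) (c j))
          + (\<Sum>j\<in>UNIV. deriv (l j) (c j) * (b h j - s h j))" for h
      by (simp add: breg_def sum_subtractf[symmetric] sum.distrib[symmetric] algebra_simps)
    then have "avg k (\<lambda>h. \<Sum>j\<in>UNIV. l j (b h j)) - avg k (\<lambda>h. \<Sum>j\<in>UNIV. l j (s h j))
        = avg k (\<lambda>h. \<Sum>j\<in>UNIV. breg (l j) (b h j) (c j) - breg (l j) (s h j) (c j))"
      by (simp only: avg_diff[symmetric] avg_add) (simp add: avg_add avg_mean_zero)
    then show ?thesis by (simp only: right_diff_distrib[symmetric])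
  qed
  finally show ?thesis .
qed

text \<open>\<open>avg_loss_step\<close> minus the corresponding recursion for the tangents at
  \<open>c\<close>, which is an equality because these are affine.\<close>

lemma avg_breg_step:
  "nu (Suc k) * avg (Suc k) (\<lambda>h. \<Sum>j\<in>UNIV. breg (l j) (s h j) (c j))
    \<le> nu k * avg k (\<lambda>h. \<Sum>j\<in>UNIV. breg (l j) (s h j) (c j)) + u k * avg k (\<lambda>h. \<Sum>j\<in>UNIV.
        (deriv (l j) (s h j) - deriv (l j) (c j)) * \<delta> h j + breg (l j) (s h j) (c j)) + \<gamma> * n * F k"
proof -
  let ?L = "\<lambda>h. \<Sum>j\<in>UNIV. l j (s h j)" and ?c = "\<lambda>h. \<Sum>j\<in>UNIV. l j (c j) + deriv (l j) (c j) * (s h j - c j)"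
  have br: "(\<Sum>j\<in>UNIV. breg (l j) (s h j) (c j)) = ?L h - ?c h" for h
    by (simp add: breg_def sum_subtractf sum.distrib)
  have "nu (Suc k) * avg (Suc k) ?c = nu k * avg k ?c
      + avg k (\<lambda>h. u k * (\<Sum>j\<in>UNIV. l j (c j) + deriv (l j) (c j) * (s h j - c j) + deriv (l j) (c j) * \<delta> h j))"
  proof -
    have "avg (Suc k) ?c = avg k (\<lambda>h. \<Sum>j\<in>UNIV. l j (c j) + deriv (l j) (c j) * (s h j - c j)
      + (l j (c j) + deriv (l j) (c j) * (s h j + eta k * \<delta> h j - c j) - (l j (c j) + deriv (l j) (c j) * (s h j - c j))) / n)"
      by (rule avg_step[of k "\<lambda>j x y. l j (c j) + deriv (l j) (c j) * (x - c j)"])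
    also have "\<dots> = avg k (\<lambda>h. ?c h + (eta k / n) * (\<Sum>j\<in>UNIV. deriv (l j) (c j) * \<delta> h j))"
      unfolding sum_distrib_left sum.distrib[symmetric]
      by (intro avg_cong sum.cong refl) (simp add: algebra_simps diff_divide_distrib add_divide_distrib)
    finally have e: "avg (Suc k) ?c = avg k ?c + eta k / n * avg k (\<lambda>h. \<Sum>j\<in>UNIV. deriv (l j) (c j) * \<delta> h j)"
      by (simp only: avg_add avg_cmult)
    have "nu (Suc k) * avg (Suc k) ?c = nu (Suc k) * avg k ?c
        + (nu (Suc k) * eta k) / n * avg k (\<lambda>h. \<Sum>j\<in>UNIV. deriv (l j) (c j) * \<delta> h j)"
      unfolding e by (simp add: distrib_left)
    then have "nu (Suc k) * avg (Suc k) ?c = (nu k + u k) * avg k ?c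
        + u k * avg k (\<lambda>h. \<Sum>j\<in>UNIV. deriv (l j) (c j) * \<delta> h j)"
      by (simp only: nu_eta_div) (simp only: nu_Suc)
    then show ?thesis
      unfolding avg_cmult sum.distrib[of "\<lambda>j. l j (c j) + deriv (l j) (c j) * (s _ j - c j)"] avg_add
      by (simp add: algebra_simps)
  qed
  moreover have "avg k (\<lambda>h. u k * (\<Sum>j\<in>UNIV. l j (s h j) + deriv (l j) (s h j) * \<delta> h j))
      - avg k (\<lambda>h. u k * (\<Sum>j\<in>UNIV. l j (c j) + deriv (l j) (c j) * (s h j - c j) + deriv (l j) (c j) * \<delta> h j))
    = u k * avg k (\<lambda>h. \<Sum>j\<in>UNIV.
        (deriv (l j) (s h j) - deriv (l j) (c j)) * \<delta> h j + breg (l j) (s h j) (c j))"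
    unfolding avg_diff[symmetric] right_diff_distrib[symmetric] avg_cmult sum_subtractf[symmetric] breg_def
    by (intro arg_cong[where f = "\<lambda>x. u k * x"] avg_cong sum.cong refl) (simp add: algebra_simps)
  ultimately show ?thesis
    using avg_loss_step[of k] unfolding br avg_diff right_diff_distrib by linarith
qed

text \<open>The hypothesis bounds the duality gap of \<open>c\<close> with the primal linearised at \<open>s h\<close>.\<close>

lemma avg_breg_le:
  assumes c: "\<And>h. (\<Sum>j\<in>UNIV. (deriv (l j) (s h j) - deriv (l j) (c j)) * \<delta> h j + breg (l j) (s h j) (c j)) \<le> \<epsilon>"
  shows "nu k * avg k (\<lambda>h. \<Sum>j\<in>UNIV. breg (l j) (s h j) (c j))
    \<le> nu 0 * (\<Sum>j\<in>UNIV. breg (l j) 0 (c j)) + \<gamma> * n * (\<Sum>i<k. F i) + \<epsilon> * (\<Sum>i<k. u i)"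
proof (induction k)
  case (Suc k)
  have "avg k (\<lambda>h. \<Sum>j\<in>UNIV. (deriv (l j) (s h j) - deriv (l j) (c j)) * \<delta> h j + breg (l j) (s h j) (c j)) \<le> \<epsilon>"
    using avg_mono[of k _ "\<lambda>_. \<epsilon>"] c by (metis (no_types, lifting) avg_const)
  then have "u k * avg k (\<lambda>h. \<Sum>j\<in>UNIV. (deriv (l j) (s h j) - deriv (l j) (c j)) * \<delta> h j + breg (l j) (s h j) (c j)) \<le> u k * \<epsilon>"
    using u_ge[of k] by (intro mult_left_mono) auto
  then show ?case using Suc avg_breg_step[of k c] by (simp add: distrib_left mult.commute[of \<epsilon>])
qed simp

lemma avg_regret_quadratic:
  assumes \<tau>: "0 < \<tau>"
    and Q: "\<And>h j. (deriv (l j) (s h j) - deriv (l j) (c j))\<^sup>2 \<le> 2 * \<gamma> * Q h j"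
  shows "avg k regret \<le> \<gamma> * n * (\<Sum>i<k. F i) + \<tau> * (nu k * avg k (\<lambda>h. \<Sum>j\<in>UNIV. Q h j))
    + \<gamma> / 2 * (1 + 1 / \<tau>) * (nu k * z k)"
proof -
  have "avg k (\<lambda>h. \<Sum>j\<in>UNIV. breg (l j) (b h j) (c j) - breg (l j) (s h j) (c j))
      \<le> avg k (\<lambda>h. \<Sum>j\<in>UNIV. \<tau> * Q h j + \<gamma> / 2 * (1 + 1 / \<tau>) * (b h j - s h j)\<^sup>2)"
    by (intro avg_mono sum_mono smooth_loss.breg_diff_le[OF losses \<tau> Q])
  also have "\<dots> = \<tau> * avg k (\<lambda>h. \<Sum>j\<in>UNIV. Q h j) + \<gamma> / 2 * (1 + 1 / \<tau>) * z k"
    by (simp only: sum.distrib sum_distrib_left[symmetric] avg_add avg_cmult z_def)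
  finally have "nu k * avg k (\<lambda>h. \<Sum>j\<in>UNIV. breg (l j) (b h j) (c j) - breg (l j) (s h j) (c j))
      \<le> nu k * (\<tau> * avg k (\<lambda>h. \<Sum>j\<in>UNIV. Q h j) + \<gamma> / 2 * (1 + 1 / \<tau>) * z k)"
    using nu_pos[of k] by simp
  then show ?thesis using avg_regret_le[of k c] by (simp add: distrib_left mult_ac)
qed

text \<open>With a single coordinate the draw is deterministic, and \<open>s\<close> and
  \<open>b\<close> obey the same recursion.\<close>

lemma s_eq_b: "s h j = b h j" if "n = 1"
proof -
  have "CARD('n) = 1" using that n_eq by simp
  then have "i = j" for i :: 'n by (metis UNIV_I card_1_singletonE singletonD)
  moreover have "eta i = 2 / (u i + 1)" for i using step_eq_eta[of i] that by simp
  ultimately show ?thesis by (induction h) simp_all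
qed

theorem avg_regret_bound:
  assumes near_opt: "\<And>\<epsilon>. 0 < \<epsilon> \<Longrightarrow> \<exists>c. (\<forall>j. \<bar>c j\<bar> \<le> M) \<and> (\<forall>h. (\<Sum>j\<in>UNIV.
      (deriv (l j) (s h j) - deriv (l j) (c j)) * \<delta> h j + breg (l j) (s h j) (c j)) \<le> \<epsilon>)"
  shows "avg K regret \<le> 4 * n\<^sup>2 * \<gamma> * M\<^sup>2 * K"
proof -
  have nu0: "0 \<le> nu K" "0 \<le> nu 0" using nu_pos less_imp_le by blast+
  consider "n = 1" | "2 \<le> n" "real K \<le> 7 * n" | "2 \<le> n" "7 * n \<le> real K" "real K \<le> 29 * n"
    | "2 \<le> n" "29 * n \<le> real K"
  proof -
    have "CARD('n) = 1 \<or> 2 \<le> CARD('n)" using zero_less_card_finite[where 'a='n] by arith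
    then have "n = 1 \<or> 2 \<le> n" unfolding n_eq by auto
    then show ?thesis using that by fastforce
  qed
  then show ?thesis
  proof cases
    case 1
    have "avg K regret \<le> \<gamma> * n * (\<Sum>i<K. F i)"
      using avg_regret_le[of K "\<lambda>_. 0"] s_eq_b[OF 1] by simp
    also have "\<dots> \<le> \<gamma> * n * (\<Sum>i<K. 4 * n * M\<^sup>2)"
      using gamma_pos n_ge by (intro mult_left_mono sum_mono F_le) auto
    finally show ?thesis by (simp add: power2_eq_square mult_ac)
  next
    case 2
    have "avg K (\<lambda>h. \<Sum>j\<in>UNIV. breg (l j) (b h j) 0 - breg (l j) (s h j) 0)
        \<le> avg K (\<lambda>h. \<Sum>j\<in>UNIV. \<gamma> / 2 * (b h j)\<^sup>2)"
    proof (intro avg_mono sum_mono)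
      fix h :: "'n list" and j
      show "breg (l j) (b h j) 0 - breg (l j) (s h j) 0 \<le> \<gamma> / 2 * (b h j)\<^sup>2"
        using smooth_loss.breg_le[OF losses[of j], of "b h j" 0]
          smooth_loss.breg_nonneg[OF losses[of j], of "s h j" 0] by simp
    qed
    then have "nu K * avg K (\<lambda>h. \<Sum>j\<in>UNIV. breg (l j) (b h j) 0 - breg (l j) (s h j) 0)
        \<le> nu K * (\<gamma> / 2 * avg K (\<lambda>h. \<Sum>j\<in>UNIV. (b h j)\<^sup>2))"
      using nu0 by (intro mult_left_mono) (simp_all only: sum_distrib_left[symmetric] avg_cmult)
    then have "avg K regret \<le> \<gamma> * (n * (\<Sum>i<K. F i) + nu K / 2 * avg K (\<lambda>h. \<Sum>j\<in>UNIV. (b h j)\<^sup>2))"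
      using avg_regret_le[of K "\<lambda>_. 0"] by (simp add: distrib_left mult_ac)
    also have "\<dots> \<le> \<gamma> * (4 * n\<^sup>2 * M\<^sup>2 * K)"
      using regime_small[OF 2] gamma_pos by (intro mult_left_mono) auto
    finally show ?thesis by (simp add: mult_ac)
  next
    case 3
    obtain \<tau> where \<tau>: "0 < \<tau>" and le:
      "n * (\<Sum>i<K. F i) + \<tau> / 2 * (nu K * q K) + (1 + 1 / \<tau>) / 2 * (nu K * z K) \<le> 4 * n\<^sup>2 * M\<^sup>2 * K"
      by (rule regime_middle[OF 3])
    have "(deriv (l j) x - deriv (l j) 0)\<^sup>2 \<le> 2 * \<gamma> * (\<gamma> / 2 * x\<^sup>2)" for j x
      using power_mono[OF smooth_loss.deriv_lipschitz[OF losses[of j], of x 0], of 2]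
      by (simp add: power2_eq_square mult_ac abs_mult_self_eq)
    from avg_regret_quadratic[OF \<tau> this, of K]
    have "avg K regret \<le> \<gamma> * n * (\<Sum>i<K. F i) + \<tau> * (nu K * (\<gamma> / 2 * q K)) + \<gamma> / 2 * (1 + 1 / \<tau>) * (nu K * z K)"
      by (simp only: sum_distrib_left[symmetric] avg_cmult q_def)
    also have "\<dots> = \<gamma> * (n * (\<Sum>i<K. F i) + \<tau> / 2 * (nu K * q K) + (1 + 1 / \<tau>) / 2 * (nu K * z K))"
      by (simp add: distrib_left mult_ac)
    also have "\<dots> \<le> \<gamma> * (4 * n\<^sup>2 * M\<^sup>2 * K)"
      using le gamma_pos by (intro mult_left_mono) auto
    finally show ?thesis by (simp add: mult_ac)
  next
    case 4
    define U where "U = (\<Sum>i<K. u i)"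
    have U: "0 \<le> U" unfolding U_def using u_ge by (intro sum_nonneg) (auto intro: order_trans[of 0 2])
    show ?thesis
    proof (rule field_le_epsilon)
      fix e :: real assume e: "0 < e"
      \<comment> \<open>In \<open>avg_breg_le\<close> the optimality error of \<open>c\<close>
        accumulates with the total weight \<open>U\<close>; adding 1 keeps the divisor
        positive.\<close>
      define \<epsilon> where "\<epsilon> = e / (U + 1)"
      have eps: "0 < \<epsilon>" "\<epsilon> * U \<le> e" using e U by (auto simp: \<epsilon>_def divide_le_eq)
      obtain c where c: "\<And>j. \<bar>c j\<bar> \<le> M"
        "\<And>h. (\<Sum>j\<in>UNIV. (deriv (l j) (s h j) - deriv (l j) (c j)) * \<delta> h j + breg (l j) (s h j) (c j)) \<le> \<epsilon>"
        using near_opt[OF eps(1)] by blast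
      have "(\<Sum>j\<in>UNIV. breg (l j) 0 (c j)) \<le> (\<Sum>j::'n\<in>UNIV. \<gamma> / 2 * M\<^sup>2)"
      proof (rule sum_mono)
        fix j
        have "breg (l j) 0 (c j) \<le> \<gamma> / 2 * (0 - c j)\<^sup>2" by (rule smooth_loss.breg_le[OF losses])
        also have "\<dots> \<le> \<gamma> / 2 * M\<^sup>2" using power_mono[OF c(1)[of j], of 2] gamma_pos by simp
        finally show "breg (l j) 0 (c j) \<le> \<gamma> / 2 * M\<^sup>2" .
      qed
      then have "nu 0 * (\<Sum>j\<in>UNIV. breg (l j) 0 (c j)) \<le> nu 0 * (n * (\<gamma> / 2 * M\<^sup>2))"
        using nu0 by (intro mult_left_mono) (auto simp: n_eq)
      then have *: "nu K * avg K (\<lambda>h. \<Sum>j\<in>UNIV. breg (l j) (s h j) (c j))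
          \<le> nu 0 * (n * (\<gamma> / 2 * M\<^sup>2)) + \<gamma> * n * (\<Sum>i<K. F i) + e"
        using avg_breg_le[OF c(2), of K] eps(2) unfolding U_def by linarith
      have "avg K regret \<le> \<gamma> * n * (\<Sum>i<K. F i)
          + 2 / 3 * (nu K * avg K (\<lambda>h. \<Sum>j\<in>UNIV. breg (l j) (s h j) (c j))) + \<gamma> / 2 * (1 + 1 / (2 / 3)) * (nu K * z K)"
        by (rule avg_regret_quadratic) (auto intro: smooth_loss.deriv_diff_sq_le[OF losses])
      also have "\<dots> \<le> \<gamma> * (5 / 3 * (n * (\<Sum>i<K. F i)) + 5 / 4 * (nu K * z K) + n * nu 0 * M\<^sup>2 / 3) + e"
        using * e by (simp add: algebra_simps)
      also have "\<dots> \<le> \<gamma> * (4 * n\<^sup>2 * M\<^sup>2 * K) + e"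
        using regime_large[OF 4] gamma_pos by (intro add_right_mono mult_left_mono) auto
      finally show "avg K regret \<le> 4 * n\<^sup>2 * \<gamma> * M\<^sup>2 * K + e" by (simp add: mult_ac)
    qed
  qed
qed

end

section \<open>Conjugates and gradients\<close>

context smooth_loss
begin

lemma fconj_ge: "ereal (w * x - f x) \<le> fconj (\<lambda>x. ereal (f x)) w"
proof -
  have "ereal (w \<bullet> x) - ereal (f x) \<le> fconj (\<lambda>x. ereal (f x)) w"
    unfolding fconj_def by (rule SUP_upper) simp
  then show ?thesis by simp
qed

lemma fconj_deriv: "fconj (\<lambda>x. ereal (f x)) (deriv f x) = ereal (deriv f x * x - f x)"
proof (rule antisym)
  show "fconj (\<lambda>x. ereal (f x)) (deriv f x) \<le> ereal (deriv f x * x - f x)"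
    unfolding fconj_def
  proof (rule SUP_least)
    fix y
    show "ereal (deriv f x \<bullet> y) - ereal (f y) \<le> ereal (deriv f x * x - f x)"
      using above_tangent[of x y] by (simp add: right_diff_distrib)
  qed
qed (rule fconj_ge)

text \<open>Equality in the Fenchel-Young inequality makes \<open>x\<close> a minimiser of
  \<open>f y - w * y\<close>, where the derivative has to vanish.\<close>

lemma fconj_eqD:
  assumes "fconj (\<lambda>x. ereal (f x)) w = ereal (w * x - f x)" shows "w = deriv f x"
proof -
  have "f x - w * x \<le> f y - w * y" for y
  proof -
    have "w * y - f y \<le> w * x - f x" using fconj_ge[of w y] assms by simp
    then show ?thesis by linarith
  qed
  moreover have "((\<lambda>y. f y - w * y) has_real_derivative deriv f x - w) (at x)"
    by (auto intro!: derivative_eq_intros has_deriv)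
  ultimately have "deriv f x - w = 0"
    by (intro DERIV_local_min[of "\<lambda>y. f y - w * y" _ x 1]) auto
  then show ?thesis by simp
qed

text \<open>For \<open>w = deriv f y\<close> the error of the linear approximation of the conjugate
  is exactly \<open>breg f x y\<close>. It lies between 0 and
  \<open>(w - deriv f x) * (y - x)\<close>, the sum of the two Bregman distances, and
  \<open>y\<close> is close to \<open>x\<close> because the derivative is strictly
  increasing.\<close>

lemma fconj_has_deriv:
  "((\<lambda>w. real_of_ereal (fconj (\<lambda>x. ereal (f x)) w)) has_real_derivative x) (at (deriv f x))"
proof -
  define g where "g w = real_of_ereal (fconj (\<lambda>x. ereal (f x)) w)" for w
  have g: "g (deriv f y) = deriv f y * y - f y" for y by (simp add: g_def fconj_deriv)
  have "((\<lambda>w. (g w - g (deriv f x)) / (w - deriv f x)) \<longlongrightarrow> x) (at (deriv f x))"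
  proof (rule tendstoI)
    fix e :: real assume e: "0 < e"
    define A where "A = {deriv f (x - e / 2)<..<deriv f (x + e / 2)}"
    have "deriv f x \<in> A" "open A" using strict_monoD[OF deriv_strict_mono] e by (auto simp: A_def)
    then have "\<forall>\<^sub>F w in at (deriv f x). w \<in> A \<and> w \<noteq> deriv f x"
      by (simp add: eventually_at_topological) blast
    then show "\<forall>\<^sub>F w in at (deriv f x). dist ((g w - g (deriv f x)) / (w - deriv f x)) x < e"
    proof (rule eventually_mono)
      fix w assume w: "w \<in> A \<and> w \<noteq> deriv f x"
      then obtain y where y: "x - e / 2 \<le> y" "y \<le> x + e / 2" "deriv f y = w"
        using deriv_IVT[of "x - e / 2" w "x + e / 2"] by (auto simp: A_def)
      define d where "d = w - deriv f x"
      have d0: "d \<noteq> 0" using w by (simp add: d_def)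
      define c where "c = g w - g (deriv f x) - x * d"
      have c_eq: "c = breg f x y"
        using y(3) by (auto simp: c_def d_def breg_def g algebra_simps simp flip: y(3))
      have "breg f x y + breg f y x = d * (y - x)"
        using y(3) by (simp add: breg_def d_def algebra_simps)
      then have "0 \<le> c" "c \<le> d * (y - x)" using breg_nonneg[of x y] breg_nonneg[of y x] c_eq by auto
      moreover have "\<bar>y - x\<bar> \<le> e / 2" using y by linarith
      then have "\<bar>d * (y - x)\<bar> \<le> \<bar>d\<bar> * (e / 2)" unfolding abs_mult by (intro mult_left_mono) auto
      ultimately have "\<bar>c\<bar> \<le> \<bar>d\<bar> * (e / 2)" by linarith
      then have "\<bar>c / d\<bar> \<le> e / 2" using d0 by (simp add: abs_divide divide_le_eq mult.commute)
      moreover have "(g w - g (deriv f x)) / (w - deriv f x) - x = c / d"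
        using d0 by (simp add: c_def d_def field_simps)
      ultimately have "\<bar>(g w - g (deriv f x)) / (w - deriv f x) - x\<bar> \<le> e / 2" by (simp only:)
      then show "dist ((g w - g (deriv f x)) / (w - deriv f x)) x < e"
        unfolding dist_real_def using e by linarith
    qed
  qed
  then show ?thesis unfolding g_def[symmetric] by (simp add: has_field_derivative_iff)
qed

text \<open>The range of a continuous, strictly increasing derivative is open, so the conjugate is
  finite around each of its points.\<close>

lemma fconj_finite_near:
  "\<exists>A. open A \<and> deriv f x \<in> A \<and> (\<forall>w\<in>A. \<exists>y. w = deriv f y)"
proof (intro exI[of _ "{deriv f (x - 1)<..<deriv f (x + 1)}"] conjI ballI)
  show "open {deriv f (x - 1)<..<deriv f (x + 1)}" by simp
  show "deriv f x \<in> {deriv f (x - 1)<..<deriv f (x + 1)}" using strict_monoD[OF deriv_strict_mono] by auto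
  show "\<exists>y. w = deriv f y" if "w \<in> {deriv f (x - 1)<..<deriv f (x + 1)}" for w
    using deriv_IVT[of "x - 1" w "x + 1"] that by auto
qed

end

lemma grad_eqI: "GDERIV f x :> D \<Longrightarrow> grad f x = D"
  unfolding grad_def
proof (rule the_equality)
  fix D' assume "GDERIV f x :> D'" "GDERIV f x :> D"
  then have "(\<lambda>h. h \<bullet> D') = (\<lambda>h. h \<bullet> D)" unfolding gderiv_def by (rule has_derivative_unique)
  then show "D' = D" by (metis vector_eq_ldot)
qed simp

lemma gderiv_separable:
  fixes g :: "'n::finite \<Rightarrow> real \<Rightarrow> real" and x d :: "real^'n"
  assumes "\<And>j. (g j has_real_derivative d $ j) (at (x $ j))"
  shows "GDERIV (\<lambda>w. \<Sum>j\<in>UNIV. g j (w $ j)) x :> d"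
proof -
  have "((\<lambda>w. g j (w $ j)) has_derivative (\<lambda>h. (h $ j) * (d $ j))) (at x)" for j
  proof -
    have "((\<lambda>w. w $ j) has_derivative (\<lambda>h. h $ j)) (at x)"
      by (rule bounded_linear.has_derivative[OF bounded_linear_vec_nth has_derivative_ident])
    then show ?thesis
      using has_derivative_compose[of "\<lambda>w. w $ j" "\<lambda>h. h $ j" x UNIV "g j" "(*) (d $ j)"] assms[of j]
      by (simp add: has_field_derivative_def mult.commute)
  qed
  then show ?thesis
    unfolding gderiv_def inner_vec_def by (auto intro!: has_derivative_sum)
qed

section \<open>The function \<open>h\<close>, its gradient and its Bregman distance\<close>

locale problem =
  fixes X :: "real^'p^'n" and l :: "'n \<Rightarrow> real \<Rightarrow> real" and R :: "real^'p \<Rightarrow> ereal" and \<gamma> M N :: real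
  assumes losses: "smooth_loss (l j) \<gamma>"
    and N_eq: "N = real CARD('n)"
    and R_convex: "econvex R" and R_bounded: "bounded (edom R)" and R_zero: "0 \<in> edom R"
    and attained: "\<And>c. \<exists>b. is_arg_min (\<lambda>b. ereal (c \<bullet> b) + R b) (\<lambda>_. True) b"
    and M_eq: "M = data_bound X R"
begin

abbreviation dl :: "'n \<Rightarrow> real \<Rightarrow> real" where "dl j \<equiv> deriv (l j)"

text \<open>The gradient of \<open>Lfun l\<close>. All dual points of interest, namely iterates,
  averages and the elements of \<open>Wset X l R\<close>, turn out to be of this form.\<close>

definition dL :: "('n \<Rightarrow> real) \<Rightarrow> real^'n" where "dL x = (\<chi> j. dl j (x j))"

lemma dL_nth [simp]: "dL x $ j = dl j (x j)" by (simp add: dL_def)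

lemma N_pos: "0 < N" by (simp add: N_eq)

lemma hfun_eq: "hfun l w = ereal (1 / N) * (\<Sum>j\<in>UNIV. lstar l j (w $ j))"
  by (simp add: hfun_def N_eq)

lemma hfun_cases:
  obtains r where "\<And>j. lstar l j (w $ j) = ereal (r j)" "hfun l w = ereal (1 / N * (\<Sum>j\<in>UNIV. r j))"
    | "hfun l w = \<infinity>"
proof (cases "\<exists>j. lstar l j (w $ j) = \<infinity>")
  case True
  then have "(\<Sum>j\<in>UNIV. lstar l j (w $ j)) = \<infinity>" by (auto simp: sum_Pinfty)
  then show ?thesis using that(2) N_pos by (simp add: hfun_eq)
next
  case False
  have "lstar l j (w $ j) \<noteq> -\<infinity>" for j
    using smooth_loss.fconj_ge[OF losses[of j], of "w $ j" 0] by (auto simp: lstar_def)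
  with False have r: "lstar l j (w $ j) = ereal (real_of_ereal (lstar l j (w $ j)))" for j
    by (metis ereal_real' ereal_infty_less(1) abs_eq_infinity_cases)
  have "(\<Sum>j\<in>UNIV. lstar l j (w $ j)) = ereal (\<Sum>j\<in>UNIV. real_of_ereal (lstar l j (w $ j)))"
    unfolding sum_ereal[symmetric] by (rule sum.cong) (use r in auto)
  then have "hfun l w = ereal (1 / N * (\<Sum>j\<in>UNIV. real_of_ereal (lstar l j (w $ j))))"
    by (simp add: hfun_eq)
  from that(1)[OF r this] show ?thesis .
qed

lemma hfun_ge: "ereal (1 / N * (\<Sum>j\<in>UNIV. w $ j * x j - l j (x j))) \<le> hfun l w"
proof (cases w rule: hfun_cases)
  case (1 r)
  have "w $ j * x j - l j (x j) \<le> r j" for j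
    using smooth_loss.fconj_ge[OF losses[of j], of "w $ j" "x j"] 1(1)[of j] by (simp add: lstar_def)
  then have "1 / N * (\<Sum>j\<in>UNIV. w $ j * x j - l j (x j)) \<le> 1 / N * (\<Sum>j\<in>UNIV. r j)"
    using N_pos by (intro mult_left_mono sum_mono) auto
  then show ?thesis using 1(2) by simp
qed simp

lemma hfun_dL: "hfun l (dL x) = ereal (1 / N * (\<Sum>j\<in>UNIV. dl j (x j) * x j - l j (x j)))"
proof -
  have "lstar l j (dL x $ j) = ereal (dl j (x j) * x j - l j (x j))" for j
    using smooth_loss.fconj_deriv[OF losses] by (simp add: lstar_def)
  then show ?thesis by (simp add: hfun_eq)
qed

text \<open>A sum of nonnegative Fenchel-Young gaps that is at most 0 forces equality in every
  coordinate. This identifies the initial point, the mirror steps and the maximisers of the saddle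
  function.\<close>

lemma hfun_leD:
  assumes "hfun l w \<le> ereal (1 / N * (\<Sum>j\<in>UNIV. w $ j * x j - l j (x j)))"
  shows "w = dL x"
proof (cases w rule: hfun_cases)
  case (1 r)
  have ge: "w $ j * x j - l j (x j) \<le> r j" for j
    using smooth_loss.fconj_ge[OF losses[of j], of "w $ j" "x j"] 1(1)[of j] by (simp add: lstar_def)
  have "1 / N * (\<Sum>j\<in>UNIV. r j) \<le> 1 / N * (\<Sum>j\<in>UNIV. w $ j * x j - l j (x j))"
    using assms 1(2) by simp
  then have "(\<Sum>j\<in>UNIV. r j) \<le> (\<Sum>j\<in>UNIV. w $ j * x j - l j (x j))"
    using N_pos by (simp add: divide_le_cancel)
  then have "(\<Sum>j\<in>UNIV. r j - (w $ j * x j - l j (x j))) = 0"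
    using sum_mono[of UNIV "\<lambda>j. w $ j * x j - l j (x j)" r] ge by (simp add: sum_subtractf)
  then have "r j = w $ j * x j - l j (x j)" for j
    using ge by (subst (asm) sum_nonneg_eq_0_iff) auto
  then have "w $ j = dl j (x j)" for j
    using smooth_loss.fconj_eqD[OF losses[of j]] 1(1)[of j] by (simp add: lstar_def)
  then show ?thesis by (simp add: vec_eq_iff)
qed (use assms in simp)

lemma grad_Lfun: "grad (Lfun l) s = dL (($) s)"
proof (rule grad_eqI)
  have "GDERIV (\<lambda>w. \<Sum>j\<in>UNIV. l j (w $ j)) s :> dL (($) s)"
    by (rule gderiv_separable) (simp add: smooth_loss.has_deriv[OF losses])
  then show "GDERIV (Lfun l) s :> dL (($) s)" by (simp add: Lfun_def[abs_def])
qed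

lemma dlstar_dl: "dlstar l j (dl j x) = x"
  unfolding dlstar_def lstar_def
  by (rule DERIV_imp_deriv) (rule smooth_loss.fconj_has_deriv[OF losses])

lemma grad_hfun: "grad (\<lambda>w. real_of_ereal (hfun l w)) (dL x) = (\<chi> j. x j / N)"
proof (rule grad_eqI)
  let ?g = "\<lambda>w. \<Sum>j\<in>UNIV. 1 / N * real_of_ereal (lstar l j (w $ j))"
  have "\<forall>j. \<exists>A. open A \<and> dl j (x j) \<in> A \<and> (\<forall>w\<in>A. \<exists>y. w = dl j y)"
    using smooth_loss.fconj_finite_near[OF losses] by blast
  from choice[OF this] obtain A where
    A: "\<And>j. open (A j)" "\<And>j. dl j (x j) \<in> A j" "\<And>j w. w \<in> A j \<Longrightarrow> \<exists>y. w = dl j y"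
    by blast
  \<comment> \<open>On \<open>U\<close> all conjugates are finite, so the real part of
    \<open>hfun l\<close> agrees with the separable sum \<open>?g\<close>; outside it the two may
    differ.\<close>
  define U where "U = (\<Inter>j\<in>UNIV. {w :: real^'n. w $ j \<in> A j})"
  have "open U" unfolding U_def
    by (intro open_INT ballI open_vimage_vec_nth[unfolded vimage_def] A) auto
  moreover have "dL x \<in> U" using A by (simp add: U_def)
  moreover have "?g w = real_of_ereal (hfun l w)" if "w \<in> U" for w
  proof -
    have "\<exists>y. \<forall>j. w $ j = dl j (y j)" using that A(3) by (intro choice) (auto simp: U_def)
    then obtain y where "\<And>j. w $ j = dl j (y j)" by blast
    then have w: "w = dL y" by (simp add: vec_eq_iff)
    show ?thesis unfolding w hfun_dL
      by (simp add: lstar_def smooth_loss.fconj_deriv[OF losses] sum_divide_distrib)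
  qed
  moreover have "GDERIV ?g (dL x) :> (\<chi> j. x j / N)"
  proof (rule gderiv_separable)
    fix j
    have "((\<lambda>w. real_of_ereal (lstar l j w)) has_real_derivative x j) (at (dl j (x j)))"
      unfolding lstar_def by (rule smooth_loss.fconj_has_deriv[OF losses])
    from DERIV_cmult[OF this, of "1 / N"]
    show "((\<lambda>w. 1 / N * real_of_ereal (lstar l j w)) has_real_derivative (\<chi> j. x j / N) $ j) (at (dL x $ j))"
      by simp
  qed
  ultimately show "GDERIV (\<lambda>w. real_of_ereal (hfun l w)) (dL x) :> (\<chi> j. x j / N)"
    unfolding gderiv_def using has_derivative_transform_within_open[of ?g _ "dL x" UNIV U] by simp
qed

text \<open>At \<open>dL x\<close> the gradient of \<open>h\<close> is \<open>x / N\<close>, so the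
  affine part collapses and the Bregman distance is the Fenchel-Young gap between \<open>v\<close>
  and \<open>x\<close>, also when \<open>hfun l v\<close> is infinite.\<close>

lemma bregman_hfun: "bregman (hfun l) v (dL x)
    = hfun l v - ereal (1 / N * (\<Sum>j\<in>UNIV. v $ j * x j - l j (x j)))"
proof -
  have "(1 / N * (\<Sum>j\<in>UNIV. dl j (x j) * x j - l j (x j))) + (\<chi> j. x j / N) \<bullet> (v - dL x)
      = 1 / N * (\<Sum>j\<in>UNIV. v $ j * x j - l j (x j))"
    by (simp add: inner_vec_def sum_distrib_left sum.distrib[symmetric] algebra_simps diff_divide_distrib add_divide_distrib)
  then show ?thesis
    unfolding bregman_def hfun_dL grad_hfun by (cases "hfun l v") (auto simp: algebra_simps)
qed

text \<open>Passing to conjugates swaps the two arguments of a Bregman distance.\<close>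

lemma bregman_hfun_dL: "bregman (hfun l) (dL y) (dL x) = ereal (1 / N * (\<Sum>j\<in>UNIV. breg (l j) (x j) (y j)))"
  unfolding bregman_hfun hfun_dL
  by (simp add: breg_def sum_subtractf[symmetric] diff_divide_distrib[symmetric] algebra_simps)

end

section \<open>Linear subproblems and the common form of both methods\<close>

context problem
begin

abbreviation Rr :: "real^'p \<Rightarrow> real" where "Rr b \<equiv> real_of_ereal (R b)"

lemma R_real: "b \<in> edom R \<Longrightarrow> R b = ereal (Rr b)"
  using R_convex by (cases "R b") (auto simp: edom_def econvex_def)

lemma R_outside: "b \<notin> edom R \<Longrightarrow> R b = \<infinity>"
  by (simp add: edom_def)

lemma R_combination:
  assumes "x \<in> edom R" "y \<in> edom R" "0 \<le> t" "t \<le> 1"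
  shows "(1 - t) *\<^sub>R x + t *\<^sub>R y \<in> edom R"
    and "Rr ((1 - t) *\<^sub>R x + t *\<^sub>R y) \<le> (1 - t) * Rr x + t * Rr y"
proof -
  obtain p q where pq: "R x = ereal p" "R y = ereal q"
    using R_real[OF assms(1)] R_real[OF assms(2)] by blast
  have "R ((1 - t) *\<^sub>R x + t *\<^sub>R y) \<le> ereal (1 - t) * R x + ereal t * R y"
    using R_convex assms by (simp add: econvex_def)
  then have le: "R ((1 - t) *\<^sub>R x + t *\<^sub>R y) \<le> ereal ((1 - t) * Rr x + t * Rr y)"
    by (simp add: pq)
  then show dom: "(1 - t) *\<^sub>R x + t *\<^sub>R y \<in> edom R" by (auto simp: edom_def)
  obtain r where r: "R ((1 - t) *\<^sub>R x + t *\<^sub>R y) = ereal r" using R_real[OF dom] by blast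
  show "Rr ((1 - t) *\<^sub>R x + t *\<^sub>R y) \<le> (1 - t) * Rr x + t * Rr y"
    using le unfolding r by simp
qed

text \<open>The real supremum in \<open>data_bound\<close> is an upper bound only of a bounded set;
  boundedness comes from Cauchy-Schwarz and the bounded domain of \<open>R\<close>.\<close>

lemma X_le: assumes "b \<in> edom R" shows "\<bar>X $ j \<bullet> b\<bar> \<le> M"
proof -
  let ?m = "\<lambda>b. Max (range (\<lambda>j. \<bar>X $ j \<bullet> b\<bar>))"
  obtain B where B: "\<And>b. b \<in> edom R \<Longrightarrow> norm b \<le> B"
    using R_bounded by (auto simp: bounded_iff)
  have "?m b \<le> (\<Sum>j\<in>UNIV. norm (X $ j)) * B" if "b \<in> edom R" for b
  proof (rule Max.boundedI)
    fix y assume "y \<in> range (\<lambda>j. \<bar>X $ j \<bullet> b\<bar>)"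
    then obtain j where "y = \<bar>X $ j \<bullet> b\<bar>" by blast
    then have "y \<le> norm (X $ j) * norm b" by (simp add: Cauchy_Schwarz_ineq2)
    also have "\<dots> \<le> (\<Sum>j\<in>UNIV. norm (X $ j)) * B"
      using B[OF that] by (intro mult_mono member_le_sum) (auto intro: sum_nonneg)
    finally show "y \<le> (\<Sum>j\<in>UNIV. norm (X $ j)) * B" .
  qed auto
  then have "bdd_above (?m ` edom R)" by (rule bdd_aboveI2)
  then have "?m b \<le> M" unfolding M_eq data_bound_def using assms by (rule cSUP_upper[rotated])
  moreover have "\<bar>X $ j \<bullet> b\<bar> \<le> ?m b" by (rule Max_ge) auto
  ultimately show ?thesis by linarith
qed

definition lin :: "('n \<Rightarrow> real) \<Rightarrow> real^'p \<Rightarrow> real" where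
  "lin v b = 1 / N * (\<Sum>j\<in>UNIV. v j * (X $ j \<bullet> b))"

lemma lin_eq: "1 / real CARD('n) * (w \<bullet> (X *v b)) = lin (($) w) b"
  unfolding N_eq[symmetric] by (simp add: lin_def inner_vec_def[of w] matrix_vector_mul_component)

lemma inner_transpose: "((1 / real CARD('n)) *\<^sub>R (transpose X *v w)) \<bullet> b = lin (($) w) b"
  unfolding lin_eq[symmetric] by (simp add: dot_lmul_matrix transpose_matrix_vector)

definition lin_min :: "('n \<Rightarrow> real) \<Rightarrow> real^'p \<Rightarrow> bool" where
  "lin_min v b \<longleftrightarrow> b \<in> edom R \<and> (\<forall>b'\<in>edom R. lin v b + Rr b \<le> lin v b' + Rr b')"

lemma arg_min_edom:
  assumes "is_arg_min (\<lambda>b. ereal (f b) + R b) (\<lambda>_. True) b"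
  shows "b \<in> edom R" and "b' \<in> edom R \<Longrightarrow> f b + Rr b \<le> f b' + Rr b'"
proof -
  have le: "ereal (f b) + R b \<le> ereal (f b') + R b'" for b'
    using assms by (auto simp: is_arg_min_def not_less)
  show dom: "b \<in> edom R"
  proof (rule ccontr)
    assume "b \<notin> edom R"
    moreover obtain p where "R 0 = ereal p" using R_real[OF R_zero] by blast
    ultimately show False using le[of 0] by (simp add: R_outside)
  qed
  show "f b + Rr b \<le> f b' + Rr b'" if b': "b' \<in> edom R"
  proof -
    obtain p q where "R b = ereal p" "R b' = ereal q" using R_real[OF dom] R_real[OF b'] by blast
    then show ?thesis using le[of b'] by simp
  qed
qed

lemma lin_minI:
  "is_arg_min (\<lambda>b. ereal (lin v b) + R b) (\<lambda>_. True) b \<Longrightarrow> lin_min v b"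
  using arg_min_edom by (auto simp: lin_min_def)

text \<open>What both methods have in common. In mirror descent \<open>s\<close> is not part of the
  run but is reconstructed from it.\<close>

definition fw_path :: "(nat \<Rightarrow> real) \<Rightarrow> (nat \<Rightarrow> 'n) \<Rightarrow> (nat \<Rightarrow> real^'p) \<Rightarrow> (nat \<Rightarrow> real^'n)
    \<Rightarrow> (nat \<Rightarrow> 'n \<Rightarrow> real) \<Rightarrow> bool" where
  "fw_path \<eta> J bt w s \<longleftrightarrow> s 0 = (\<lambda>_. 0) \<and> (\<forall>i. w i = dL (s i)) \<and>
     (\<forall>i. lin_min (\<lambda>j. dl j (s i j)) (bt i)) \<and>
     (\<forall>i j. s (Suc i) j = (if J i = j then s i j + \<eta> i * (X $ j \<bullet> bt i - s i j) else s i j))"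

lemma sgfw_path:
  assumes "sgfw_run X l R \<alpha> \<eta> J bt bbar s d w"
  shows "fw_path \<eta> J bt w (\<lambda>i j. s i $ j)"
proof -
  have s: "s 0 = 0" and w: "\<And>i. w i = dL (($) (s i))"
    and d: "\<And>i. d i = (1 / real CARD('n)) *\<^sub>R (transpose X *v w i)"
    and bt: "\<And>i. is_arg_min (\<lambda>b. ereal (d i \<bullet> b) + R b) (\<lambda>_. True) (bt i)"
    and step: "\<And>i j. s (Suc i) $ j =
        (if j = J i then (1 - \<eta> i) * s i $ j + \<eta> i * (X $ j \<bullet> bt i) else s i $ j)"
    using assms by (auto simp: sgfw_run_def grad_Lfun)
  have "lin_min (($) (w i)) (bt i)" for i
    using bt[of i] unfolding d inner_transpose by (rule lin_minI)
  moreover have "($) (w i) = (\<lambda>j. dl j (s i $ j))" for i by (simp add: w fun_eq_iff)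
  ultimately show ?thesis
    by (auto simp: fw_path_def s w step algebra_simps)
qed

text \<open>If \<open>w i = dL (s i)\<close>, then \<open>dlstar\<close> recovers
  \<open>s i\<close>, and up to a constant the mirror step minimises
  \<open>h v - 1 / N * (\<Sum>j\<in>UNIV. v $ j * y j)\<close> with \<open>y = s (Suc i)\<close>. By
  \<open>hfun_leD\<close> the only minimiser is \<open>dL y\<close>. The initial point is the same
  argument for \<open>y = 0\<close>.\<close>

lemma rdcmd_path:
  assumes "rdcmd_run X l R \<alpha> \<eta> J bt bbar w"
  shows "\<exists>s. fw_path \<eta> J bt w s"
proof -
  define s where "s = rec_nat (\<lambda>_. 0) (\<lambda>i v j. if J i = j then v j + \<eta> i * (X $ j \<bullet> bt i - v j) else v j)"
  have s0: "s 0 = (\<lambda>_. 0)" and sS: "s (Suc i) = (\<lambda>j. if J i = j then s i j + \<eta> i * (X $ j \<bullet> bt i - s i j) else s i j)" for i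
    by (simp_all only: s_def nat.rec)
  have w0: "is_arg_min (hfun l) (\<lambda>_. True) (w 0)"
    and bt: "\<And>i. is_arg_min (\<lambda>b. ereal (1 / real CARD('n) * (w i \<bullet> (X *v b))) + R b) (\<lambda>_. True) (bt i)"
    and wS: "\<And>i. is_arg_min (\<lambda>v. ereal ((- (\<eta> i *\<^sub>R stoch_grad X l (J i) (bt i) (w i))) \<bullet> (v - w i))
             + bregman (hfun l) v (w i)) (\<lambda>_. True) (w (Suc i))"
    using assms by (auto simp: rdcmd_run_def)
  have w: "w i = dL (s i)" for i
  proof (induction i)
    case 0
    have "hfun l (w 0) \<le> hfun l (dL (\<lambda>_. 0))" using w0 by (auto simp: is_arg_min_def not_less)
    then show ?case unfolding s0 by (intro hfun_leD) (simp add: hfun_dL)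
  next
    case (Suc i)
    define x where "x = s i"
    define y where "y = s (Suc i)"
    define k where "k = J i"
    \<comment> \<open>The part of the mirror step objective that does not depend on
      \<open>v\<close>.\<close>
    define c where "c = 1 / N * (y k - x k) * dl k (x k) + 1 / N * (\<Sum>j\<in>UNIV. l j (x j))"
    have y: "y j = x j + (if j = k then y k - x k else 0)" for j by (simp add: x_def y_def sS k_def)
    have sg: "\<eta> i *\<^sub>R stoch_grad X l (J i) (bt i) (w i) = (1 / N * (y k - x k)) *\<^sub>R axis k 1"
      by (simp add: stoch_grad_def Suc.IH dlstar_dl k_def x_def y_def sS N_eq[symmetric])
    have obj: "ereal ((- (\<eta> i *\<^sub>R stoch_grad X l (J i) (bt i) (w i))) \<bullet> (v - w i)) + bregman (hfun l) v (w i)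
        = hfun l v + ereal (c - 1 / N * (\<Sum>j\<in>UNIV. v $ j * y j))" for v
    proof -
      have "(\<Sum>j\<in>UNIV. v $ j * y j) = (\<Sum>j\<in>UNIV. v $ j * x j) + (\<Sum>j\<in>UNIV. if j = k then v $ k * (y k - x k) else 0)"
        unfolding sum.distrib[symmetric] by (subst y) (auto intro!: sum.cong simp: distrib_left)
      then have vy: "(\<Sum>j\<in>UNIV. v $ j * y j) = (\<Sum>j\<in>UNIV. v $ j * x j) + v $ k * (y k - x k)" by simp
      have "(- (\<eta> i *\<^sub>R stoch_grad X l (J i) (bt i) (w i))) \<bullet> (v - w i)
          = - (1 / N * (y k - x k)) * (v $ k - dl k (x k))"
        unfolding sg by (simp add: Suc.IH x_def inner_axis' )
      then have "(- (\<eta> i *\<^sub>R stoch_grad X l (J i) (bt i) (w i))) \<bullet> (v - w i)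
          = c - 1 / N * (\<Sum>j\<in>UNIV. v $ j * y j) + 1 / N * (\<Sum>j\<in>UNIV. v $ j * x j - l j (x j))"
        unfolding c_def vy sum_subtractf by (simp add: algebra_simps)
      then show ?thesis unfolding Suc.IH x_def[symmetric] bregman_hfun
        by (cases "hfun l v") auto
    qed
    have "hfun l (w (Suc i)) + ereal (c - 1 / N * (\<Sum>j\<in>UNIV. w (Suc i) $ j * y j))
        \<le> hfun l (dL y) + ereal (c - 1 / N * (\<Sum>j\<in>UNIV. dL y $ j * y j))"
      using wS[of i] unfolding obj by (auto simp: is_arg_min_def not_less simp del: dL_nth)
    also have "\<dots> = ereal (c - 1 / N * (\<Sum>j\<in>UNIV. l j (y j)))"
      by (simp add: hfun_dL sum_subtractf diff_divide_distrib)
    finally have "hfun l (w (Suc i)) \<le> ereal (1 / N * (\<Sum>j\<in>UNIV. w (Suc i) $ j * y j - l j (y j)))"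
      by (cases "hfun l (w (Suc i))") (auto simp: sum_subtractf algebra_simps diff_divide_distrib)
    then show ?case unfolding y_def[symmetric] by (rule hfun_leD)
  qed
  have "lin_min (\<lambda>j. dl j (s i j)) (bt i)" for i
  proof -
    have "lin_min (($) (w i)) (bt i)" using bt[of i] unfolding lin_eq by (rule lin_minI)
    moreover have "($) (w i) = (\<lambda>j. dl j (s i j))" by (simp add: w fun_eq_iff)
    ultimately show ?thesis by simp
  qed
  then show ?thesis using s0 sS w by (auto simp: fw_path_def)
qed

text \<open>For \<open>b\<close> in the domain of \<open>R\<close> the saddle function is a constant
  minus the Fenchel-Young gap between \<open>w\<close> and the vector of the
  \<open>X $ j \<bullet> b\<close>, so its maximiser is unique.\<close>

lemma Wset_eq: "Wset X l R = (\<lambda>b. dL (\<lambda>j. X $ j \<bullet> b)) ` edom R"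
proof -
  have "is_arg_max (saddle X l R b) (\<lambda>_. True) w \<longleftrightarrow> w = dL (\<lambda>j. X $ j \<bullet> b)" if b: "b \<in> edom R" for b w
  proof -
    define x where "x j = X $ j \<bullet> b" for j
    obtain r where r: "R b = ereal r" using R_real[OF b] by blast
    have sad: "saddle X l R b v = ereal (1 / N * (\<Sum>j\<in>UNIV. v $ j * x j) + r) - hfun l v" for v
      unfolding saddle_def lin_eq lin_def x_def[symmetric] r
      by (cases "hfun l v") auto
    have opt: "saddle X l R b (dL x) = ereal (1 / N * (\<Sum>j\<in>UNIV. l j (x j)) + r)"
      unfolding sad hfun_dL by (simp add: sum_subtractf diff_divide_distrib)
    have le: "saddle X l R b v \<le> saddle X l R b (dL x)" for v
      unfolding opt unfolding sad using hfun_ge[of v x]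
      by (cases "hfun l v") (auto simp: sum_subtractf diff_divide_distrib)
    have "v = dL x" if "saddle X l R b (dL x) \<le> saddle X l R b v" for v
    proof (rule hfun_leD)
      show "hfun l v \<le> ereal (1 / N * (\<Sum>j\<in>UNIV. v $ j * x j - l j (x j)))"
        using that unfolding opt unfolding sad using hfun_ge[of v x]
        by (cases "hfun l v") (auto simp: sum_subtractf diff_divide_distrib)
    qed
    then show ?thesis using le unfolding x_def[symmetric] is_arg_max_def by (auto simp: not_less)
  qed
  then show ?thesis by (auto simp: Wset_def image_def)
qed

lemma dist_bound_iff:
  "dist_bound X l R (dL (\<lambda>_. 0)) D \<longleftrightarrow>
    (\<forall>b\<in>edom R. 1 / N * (\<Sum>j\<in>UNIV. breg (l j) 0 (X $ j \<bullet> b)) \<le> D)"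
  unfolding dist_bound_def Wset_eq by (simp add: bregman_hfun_dL)

lemma dist_bound_gamma: "dist_bound X l R (dL (\<lambda>_. 0)) (\<gamma> * M\<^sup>2)"
  unfolding dist_bound_iff
proof
  fix b assume b: "b \<in> edom R"
  have g: "0 < \<gamma>" using smooth_loss.gamma_pos[OF losses] .
  have "breg (l j) 0 (X $ j \<bullet> b) \<le> \<gamma> * M\<^sup>2" for j
  proof -
    have "breg (l j) 0 (X $ j \<bullet> b) \<le> \<gamma> / 2 * (X $ j \<bullet> b)\<^sup>2"
      using smooth_loss.breg_le[OF losses, of j 0 "X $ j \<bullet> b"] by simp
    also have "\<dots> \<le> \<gamma> * M\<^sup>2"
      using power_mono[OF X_le[OF b, of j], of 2] g by (intro mult_mono) auto
    finally show ?thesis .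
  qed
  then have "(\<Sum>j\<in>UNIV. breg (l j) 0 (X $ j \<bullet> b)) \<le> N * (\<gamma> * M\<^sup>2)"
    using sum_bounded_above[of UNIV "\<lambda>j. breg (l j) 0 (X $ j \<bullet> b)"] by (simp add: N_eq)
  then show "1 / N * (\<Sum>j\<in>UNIV. breg (l j) 0 (X $ j \<bullet> b)) \<le> \<gamma> * M\<^sup>2"
    using N_pos by (simp add: divide_le_eq mult.commute)
qed

end

section \<open>Nearly optimal points, averages and the gap along one run\<close>

context problem
begin

definition P :: "real^'p \<Rightarrow> real" where
  "P b = 1 / N * (\<Sum>j\<in>UNIV. l j (X $ j \<bullet> b)) + Rr b"

text \<open>Replacing the losses by their tangents at 0 gives a linear subproblem below
  \<open>P\<close>, and its minimum is attained.\<close>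

lemma P_bounded_below: "\<exists>m. \<forall>b\<in>edom R. m \<le> P b"
proof -
  obtain b0 where "is_arg_min (\<lambda>b. ereal (lin (($) (dL (\<lambda>_. 0))) b) + R b) (\<lambda>_. True) b0"
    using attained[of "(1 / real CARD('n)) *\<^sub>R (transpose X *v dL (\<lambda>_. 0))"]
    unfolding inner_transpose by blast
  moreover have "($) (dL (\<lambda>_. 0)) = (\<lambda>j. dl j 0)" by (simp add: fun_eq_iff)
  ultimately have "is_arg_min (\<lambda>b. ereal (lin (\<lambda>j. dl j 0) b) + R b) (\<lambda>_. True) b0" by (simp only:)
  then have "lin_min (\<lambda>j. dl j 0) b0" by (rule lin_minI)
  then have b0: "lin (\<lambda>j. dl j 0) b0 + Rr b0 \<le> lin (\<lambda>j. dl j 0) b + Rr b" if "b \<in> edom R" for b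
    using that by (auto simp: lin_min_def)
  show ?thesis
  proof (intro exI ballI)
    fix b assume b: "b \<in> edom R"
    have "1 / N * (\<Sum>j\<in>UNIV. l j 0 + dl j 0 * (X $ j \<bullet> b)) \<le> 1 / N * (\<Sum>j\<in>UNIV. l j (X $ j \<bullet> b))"
      using N_pos smooth_loss.above_tangent[OF losses, of _ 0] by (intro mult_left_mono sum_mono) auto
    then show "1 / N * (\<Sum>j\<in>UNIV. l j 0) + (lin (\<lambda>j. dl j 0) b0 + Rr b0) \<le> P b"
      using b0[OF b] by (simp add: P_def lin_def sum.distrib add_divide_distrib)
  qed
qed

text \<open>As \<open>R\<close> need not be lower semicontinuous, \<open>P\<close> need not attain its minimum; a point that is
  nearly optimal satisfies the first-order condition up to a small error.\<close>

lemma near_opt: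
  assumes e: "0 < \<epsilon>"
  shows "\<exists>c. (\<forall>j. \<bar>c j\<bar> \<le> M) \<and> (\<forall>s b. lin_min (\<lambda>j. dl j (s j)) b \<longrightarrow>
    (\<Sum>j\<in>UNIV. (dl j (s j) - dl j (c j)) * (X $ j \<bullet> b - s j) + breg (l j) (s j) (c j)) \<le> \<epsilon>)"
proof -
  have g: "0 < \<gamma>" using smooth_loss.gamma_pos[OF losses] .
  \<comment> \<open>\<open>t\<close> is the step from a nearly optimal point \<open>c0\<close>
    towards \<open>b\<close>. It is so short that the curvature term
    \<open>N * (2 * \<gamma> * M\<^sup>2 * t)\<close> is at most \<open>\<epsilon> / 2\<close>;
    adding 1 covers \<open>M = 0\<close>. The tolerance \<open>e'\<close> below is proportional to
    \<open>t\<close>, so that it too becomes \<open>\<epsilon> / 2\<close> after division by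
    \<open>t\<close> and multiplication by \<open>N\<close>.\<close>
  define t where "t = min 1 (\<epsilon> / (4 * N * (\<gamma> * M\<^sup>2 + 1)))"
  have gM: "0 < \<gamma> * M\<^sup>2 + 1" using g by (simp add: add_nonneg_pos)
  have t: "0 < t" "t \<le> 1" using e N_pos gM by (auto simp: t_def)
  have "t \<le> \<epsilon> / (4 * N * (\<gamma> * M\<^sup>2 + 1))" by (simp add: t_def)
  moreover have "0 < 4 * N * (\<gamma> * M\<^sup>2 + 1)" using N_pos gM by simp
  ultimately have "4 * N * (\<gamma> * M\<^sup>2 + 1) * t \<le> \<epsilon>" 
    using pos_le_divide_eq[of "4 * N * (\<gamma> * M\<^sup>2 + 1)" t \<epsilon>] by (metis mult.commute)
  moreover have "4 * N * (\<gamma> * M\<^sup>2) * t \<le> 4 * N * (\<gamma> * M\<^sup>2 + 1) * t"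
    using N_pos t by (intro mult_right_mono mult_left_mono) auto
  ultimately have t_eps: "N * (2 * \<gamma> * M\<^sup>2 * t) \<le> \<epsilon> / 2" by (simp add: mult_ac)
  define e' where "e' = t * \<epsilon> / (2 * N)"
  have e': "0 < e'" using t e N_pos by (simp add: e'_def)
  define m where "m = Inf (P ` edom R)"
  have bdd: "bdd_below (P ` edom R)" using P_bounded_below by (auto intro: bdd_belowI2)
  have "\<exists>y\<in>P ` edom R. y < m + e'"
    by (rule cInf_lessD) (use R_zero e' in \<open>auto simp: m_def\<close>)
  then obtain c0 where c0: "c0 \<in> edom R" "P c0 < m + e'" by blast
  have c0_le: "P c0 - e' \<le> P b" if "b \<in> edom R" for b
    using c0(2) cInf_lower[OF imageI[OF that] bdd] by (simp add: m_def)
  define c where "c j = X $ j \<bullet> c0" for j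
  show ?thesis
  proof (intro exI conjI allI impI)
    show "\<bar>c j\<bar> \<le> M" for j unfolding c_def by (rule X_le[OF c0(1)])
    fix s b assume "lin_min (\<lambda>j. dl j (s j)) b"
    then have b: "b \<in> edom R" and lin: "lin (\<lambda>j. dl j (s j)) b + Rr b \<le> lin (\<lambda>j. dl j (s j)) c0 + Rr c0"
      using c0(1) by (auto simp: lin_min_def)
    define a where "a j = X $ j \<bullet> b" for j
    let ?D = "\<Sum>j\<in>UNIV. dl j (c j) * (a j - c j)"
    have 1: "(\<Sum>j\<in>UNIV. (dl j (s j) - dl j (c j)) * (a j - s j) + breg (l j) (s j) (c j)) \<le> N * (Rr c0 - Rr b) - ?D"
    proof -
      have "(\<Sum>j\<in>UNIV. (dl j (s j) - dl j (c j)) * (a j - s j) + breg (l j) (s j) (c j))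
          \<le> (\<Sum>j\<in>UNIV. dl j (s j) * a j - dl j (s j) * c j - dl j (c j) * (a j - c j))"
      proof (rule sum_mono)
        fix j
        show "(dl j (s j) - dl j (c j)) * (a j - s j) + breg (l j) (s j) (c j)
            \<le> dl j (s j) * a j - dl j (s j) * c j - dl j (c j) * (a j - c j)"
          using smooth_loss.above_tangent[OF losses, of j "s j" "c j"] by (simp add: breg_def algebra_simps)
      qed
      also have "\<dots> = N * (lin (\<lambda>j. dl j (s j)) b - lin (\<lambda>j. dl j (s j)) c0) - ?D"
        using N_pos by (simp add: lin_def a_def c_def sum_subtractf right_diff_distrib)
      also have "\<dots> \<le> N * (Rr c0 - Rr b) - ?D"
        using lin N_pos by (intro diff_right_mono mult_left_mono) auto
      finally show ?thesis .
    qed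
    define v where "v = (1 - t) *\<^sub>R c0 + t *\<^sub>R b"
    have v: "v \<in> edom R" "Rr v \<le> (1 - t) * Rr c0 + t * Rr b"
      unfolding v_def using R_combination[OF c0(1) b] t by auto
    have "P v \<le> 1 / N * (\<Sum>j\<in>UNIV. l j (c j) + t * (dl j (c j) * (a j - c j)) + \<gamma> / 2 * t\<^sup>2 * (4 * M\<^sup>2))
        + ((1 - t) * Rr c0 + t * Rr b)"
      unfolding P_def
    proof (intro add_mono mult_left_mono sum_mono v(2))
      fix j
      have "X $ j \<bullet> v = c j + t * (a j - c j)"
        by (simp add: v_def c_def a_def inner_add_right algebra_simps)
      moreover have "\<bar>a j - c j\<bar> \<le> 2 * M" using X_le[OF b, of j] X_le[OF c0(1), of j] by (simp add: a_def c_def)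
      then have "(a j - c j)\<^sup>2 \<le> 4 * M\<^sup>2" using power_mono[of "\<bar>a j - c j\<bar>" "2 * M" 2] by (simp add: power_mult_distrib)
      then have "\<gamma> / 2 * t\<^sup>2 * (a j - c j)\<^sup>2 \<le> \<gamma> / 2 * t\<^sup>2 * (4 * M\<^sup>2)" using g by (intro mult_left_mono) auto
      ultimately show "l j (X $ j \<bullet> v) \<le> l j (c j) + t * (dl j (c j) * (a j - c j)) + \<gamma> / 2 * t\<^sup>2 * (4 * M\<^sup>2)"
        using smooth_loss.step_le[OF losses, of j "c j" t "a j - c j"] by simp
    qed (use N_pos in auto)
    also have "\<dots> = P c0 + t * (1 / N * ?D + Rr b - Rr c0 + 2 * \<gamma> * M\<^sup>2 * t)"
    proof -
      have "(\<Sum>j\<in>UNIV. l j (c j) + t * (dl j (c j) * (a j - c j)) + \<gamma> / 2 * t\<^sup>2 * (4 * M\<^sup>2))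
          = (\<Sum>j\<in>UNIV. l j (c j)) + t * ?D + N * (\<gamma> / 2 * t\<^sup>2 * (4 * M\<^sup>2))"
        by (simp only: sum.distrib sum_distrib_left[symmetric] sum_constant N_eq mult_ac)
      moreover have "1 / N * (A + t * B + N * (\<gamma> / 2 * t\<^sup>2 * (4 * M\<^sup>2))) + ((1 - t) * p + t * q)
          = 1 / N * A + p + t * (1 / N * B + q - p + 2 * \<gamma> * M\<^sup>2 * t)" for A B p q
        using N_pos by (simp add: field_simps power2_eq_square)
      ultimately show ?thesis unfolding P_def c_def[symmetric] by simp
    qed
    finally have "- e' \<le> t * (1 / N * ?D + Rr b - Rr c0 + 2 * \<gamma> * M\<^sup>2 * t)"
      using c0_le[OF v(1)] by linarith
    then have "N / t * (- e') \<le> N / t * (t * (1 / N * ?D + Rr b - Rr c0 + 2 * \<gamma> * M\<^sup>2 * t))"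
      using N_pos t by (intro mult_left_mono) auto
    moreover have "N / t * (- e') = - \<epsilon> / 2" using t N_pos by (simp add: e'_def)
    moreover have "N / t * (t * x) = N * x" for x using t by simp
    moreover have "N * (1 / N * ?D + Rr b - Rr c0 + 2 * \<gamma> * M\<^sup>2 * t) = ?D - N * (Rr c0 - Rr b) + N * (2 * \<gamma> * M\<^sup>2 * t)"
      using N_pos by (simp add: algebra_simps)
    ultimately have "- \<epsilon> / 2 \<le> ?D - N * (Rr c0 - Rr b) + N * (2 * \<gamma> * M\<^sup>2 * t)" by (simp only:)
    then have "N * (Rr c0 - Rr b) - ?D \<le> \<epsilon>" using t_eps by linarith
    with 1 show "(\<Sum>j\<in>UNIV. (dl j (s j) - dl j (c j)) * (X $ j \<bullet> b - s j) + breg (l j) (s j) (c j)) \<le> \<epsilon>"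
      by (simp add: a_def)
  qed
qed

abbreviation uu :: "nat \<Rightarrow> real" where "uu i \<equiv> 2 * N + real i"

lemma sum_uu: "(\<Sum>i<K. uu i) = real K * (4 * N + real K - 1) / 2"
  by (rule sum_arith)

text \<open>\<open>\<alpha> K\<close> is \<open>uu K\<close> divided by the sum of
  \<open>uu 0\<close> up to \<open>uu K\<close>. In particular \<open>\<alpha> 0 = 1\<close>, the
  initial value drops out, and \<open>bbar K\<close> is the weighted mean of the \<open>bt i\<close>
  to which convexity of \<open>R\<close> applies.\<close>

lemma averages_le:
  assumes av: "averages \<alpha> bt bbar"
    and alpha: "\<And>i. \<alpha> i = 2 * (2 * N + real i) / ((real i + 1) * (4 * N + real i))"
    and bt: "\<And>i. bt i \<in> edom R"
  shows "bbar K \<in> edom R \<and> (\<Sum>i<K. uu i) *\<^sub>R bbar K = (\<Sum>i<K. uu i *\<^sub>R bt i)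
    \<and> (\<Sum>i<K. uu i) * Rr (bbar K) \<le> (\<Sum>i<K. uu i * Rr (bt i))"
proof (induction K)
  case 0
  then show ?case using av R_zero by (simp add: averages_def)
next
  case (Suc K)
  define S where "S = (\<Sum>i<K. uu i)"
  have pos: "0 < (real K + 1) * (4 * N + real K)" using N_pos by (simp add: add_pos_nonneg)
  have S': "S + uu K = (real K + 1) * (4 * N + real K) / 2"
    unfolding S_def sum_uu by (simp add: field_simps)
  have a1: "(S + uu K) * \<alpha> K = uu K"
  proof -
    have "d / 2 * (2 * x / d) = x" if "0 < d" for d x :: real using that by simp
    from this[OF pos] show ?thesis unfolding S' alpha .
  qed
  have a2: "(S + uu K) * (1 - \<alpha> K) = S" using a1 by (simp add: right_diff_distrib)
  have S0: "0 \<le> S" unfolding S_def using N_pos by (intro sum_nonneg) auto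
  have u0: "0 < uu K" using N_pos by simp
  have "\<alpha> K = uu K / (S + uu K)" using a1 S0 u0 by (simp add: eq_divide_eq mult.commute)
  then have al: "0 \<le> \<alpha> K" "\<alpha> K \<le> 1" using S0 u0 by auto
  have bS: "bbar (Suc K) = (1 - \<alpha> K) *\<^sub>R bbar K + \<alpha> K *\<^sub>R bt K" using av by (simp add: averages_def)
  have IH: "bbar K \<in> edom R" "S *\<^sub>R bbar K = (\<Sum>i<K. uu i *\<^sub>R bt i)" "S * Rr (bbar K) \<le> (\<Sum>i<K. uu i * Rr (bt i))"
    using Suc by (auto simp: S_def)
  note comb = R_combination[OF IH(1) bt al]
  have "(S + uu K) *\<^sub>R bbar (Suc K) = S *\<^sub>R bbar K + uu K *\<^sub>R bt K"
    unfolding bS scaleR_add_right scaleR_scaleR a1 a2 ..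
  moreover have "(S + uu K) * Rr (bbar (Suc K)) \<le> S * Rr (bbar K) + uu K * Rr (bt K)"
  proof -
    have "(S + uu K) * Rr (bbar (Suc K)) \<le> (S + uu K) * ((1 - \<alpha> K) * Rr (bbar K) + \<alpha> K * Rr (bt K))"
      unfolding bS using comb(2) S0 u0 by (intro mult_left_mono) auto
    also have "\<dots> = S * Rr (bbar K) + uu K * Rr (bt K)"
      unfolding distrib_left mult.assoc[symmetric] a1 a2 ..
    finally show ?thesis .
  qed
  ultimately show ?case using comb(1) IH(2,3) by (simp add: bS S_def[symmetric])
qed

text \<open>An average of derivative values lies between two of them. Thus the averaged dual point
  is again of the form \<open>dL y\<close>, and its conjugates are finite and known exactly.\<close>

lemma average_in_range:
  fixes x p :: "nat \<Rightarrow> real"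
  assumes K: "0 < K" and p: "\<And>i. i < K \<Longrightarrow> 0 < p i" and w: "(\<Sum>i<K. p i) * w = (\<Sum>i<K. p i * dl j (x i))"
  shows "\<exists>y. w = dl j y"
proof -
  let ?I = "x ` {..<K}"
  have I: "finite ?I" "?I \<noteq> {}" using K by auto
  have mono: "y \<le> y' \<Longrightarrow> dl j y \<le> dl j y'" for y y'
    using smooth_loss.deriv_strict_mono[OF losses, of j] strict_mono_less_eq by blast
  have S: "0 < (\<Sum>i<K. p i)" using p K by (intro sum_pos) auto
  have "(\<Sum>i<K. p i) * dl j (Min ?I) \<le> (\<Sum>i<K. p i) * w"
    unfolding w unfolding sum_distrib_right using p I by (intro sum_mono mult_left_mono mono) (auto simp: less_imp_le)
  moreover have "(\<Sum>i<K. p i) * w \<le> (\<Sum>i<K. p i) * dl j (Max ?I)"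
    unfolding w unfolding sum_distrib_right using p I by (intro sum_mono mult_left_mono mono) (auto simp: less_imp_le)
  ultimately have "dl j (Min ?I) \<le> w" "w \<le> dl j (Max ?I)" using mult_le_cancel_left_pos[OF S] by blast+
  then show ?thesis using smooth_loss.deriv_IVT[OF losses] by blast
qed

text \<open>\<open>B\<close> differs from the average \<open>A\<close> of the data values by the
  start value 0, which enters \<open>B\<close> with weight \<open>nu0\<close>. The tangent of the
  loss at \<open>A\<close> therefore bounds \<open>S * l j (A j)\<close> by
  \<open>nuK * l j (B j) - nu0 * l j 0\<close> plus \<open>nu0\<close> times the Bregman distance
  from 0 to \<open>A\<close>. Averaged over \<open>j\<close>, this is the distance from the element
  of \<open>Wset X l R\<close> belonging to \<open>bbar K\<close> to the initial dual point.\<close>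

lemma gap_le:
  assumes path: "fw_path \<eta> J bt w s" and av: "averages \<alpha> bt bbar"
    and alpha: "\<And>i. \<alpha> i = 2 * (2 * N + real i) / ((real i + 1) * (4 * N + real i))"
    and K: "0 < K" and wb: "wb = (1 / (\<Sum>i<K. uu i)) *\<^sub>R (\<Sum>i<K. uu i *\<^sub>R w i)"
    and D: "dist_bound X l R (dL (\<lambda>_. 0)) D"
    and nu: "nu0 = 2 * N * (2 * N - 1) / 2" "nuK = nu0 + (\<Sum>i<K. uu i)"
    and B: "\<And>j. nuK * B j = (\<Sum>i<K. uu i * (X $ j \<bullet> bt i))"
  defines "gap \<equiv> primal X l R (bbar K) - dual X l R wb"
  shows "\<bar>gap\<bar> \<noteq> \<infinity>"
    and "(\<Sum>i<K. uu i) * real_of_ereal gap \<le> nu0 * D + 1 / N * ((\<Sum>j\<in>UNIV. nuK * l j (B j) - nu0 * l j 0)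
      - (\<Sum>i<K. uu i * (\<Sum>j\<in>UNIV. l j (s i j) + dl j (s i j) * (X $ j \<bullet> bt i - s i j))))"
proof -
  define S where "S = (\<Sum>i<K. uu i)"
  have uu: "0 < uu i" for i using N_pos by (simp add: add_pos_nonneg)
  have S: "0 < S" unfolding S_def using K uu by (intro sum_pos) auto
  have w: "w i = dL (s i)" and lm: "lin_min (\<lambda>j. dl j (s i j)) (bt i)" for i
    using path by (auto simp: fw_path_def)
  have bt: "bt i \<in> edom R" for i using lm[of i] by (simp add: lin_min_def)
  have bb: "bbar K \<in> edom R" "S *\<^sub>R bbar K = (\<Sum>i<K. uu i *\<^sub>R bt i)" "S * Rr (bbar K) \<le> (\<Sum>i<K. uu i * Rr (bt i))"
    using averages_le[OF av alpha bt, of K] by (auto simp: S_def)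
  define A where "A j = X $ j \<bullet> bbar K" for j
  have SA: "S * A j = (\<Sum>i<K. uu i * (X $ j \<bullet> bt i))" for j
    unfolding A_def inner_scaleR_right[symmetric] bb(2) by (simp add: inner_sum_right)
  have Swb: "S *\<^sub>R wb = (\<Sum>i<K. uu i *\<^sub>R w i)" using S by (simp add: wb S_def)
  have Swb_j: "S * wb $ j = (\<Sum>i<K. uu i * dl j (s i j))" for j
  proof -
    have "S * wb $ j = (S *\<^sub>R wb) $ j" by simp
    also have "\<dots> = (\<Sum>i<K. uu i * dl j (s i j))" unfolding Swb by (simp add: w)
    finally show ?thesis .
  qed
  have "\<forall>j. \<exists>y. wb $ j = dl j y"
  proof
    fix j show "\<exists>y. wb $ j = dl j y"
      by (rule average_in_range[OF K uu Swb_j[unfolded S_def]])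
  qed
  from choice[OF this] obtain y where y: "\<forall>j. wb $ j = dl j (y j)" by (elim exE)
  have wb_dL: "wb = dL y" using y by (simp add: vec_eq_iff)
  define H where "H = 1 / N * (\<Sum>j\<in>UNIV. wb $ j * y j - l j (y j))"
  have H: "hfun l wb = ereal H" unfolding H_def wb_dL hfun_dL by simp
  \<comment> \<open>Convexity of the conjugates: the maximiser \<open>y\<close> for the averaged
    \<open>wb\<close> is admissible, but not better than \<open>s i\<close>, for each single
    \<open>w i\<close>.\<close>
  have SH: "S * H \<le> 1 / N * (\<Sum>i<K. uu i * (\<Sum>j\<in>UNIV. dl j (s i j) * s i j - l j (s i j)))"
  proof -
    have "S * H = 1 / N * (\<Sum>j\<in>UNIV. S * wb $ j * y j - S * l j (y j))"
      by (simp add: H_def sum_distrib_left algebra_simps)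
    also have "\<dots> = 1 / N * (\<Sum>j\<in>UNIV. \<Sum>i<K. uu i * (dl j (s i j) * y j - l j (y j)))"
      unfolding Swb_j by (simp only: S_def sum_distrib_right sum_subtractf[symmetric] right_diff_distrib mult.assoc)
    also have "\<dots> \<le> 1 / N * (\<Sum>j\<in>UNIV. \<Sum>i<K. uu i * (dl j (s i j) * s i j - l j (s i j)))"
    proof (intro mult_left_mono sum_mono)
      fix i j
      show "dl j (s i j) * y j - l j (y j) \<le> dl j (s i j) * s i j - l j (s i j)"
        using smooth_loss.above_tangent[OF losses, of j "s i j" "y j"] by (simp add: algebra_simps)
    qed (use uu N_pos in \<open>auto simp: less_imp_le\<close>)
    also have "(\<Sum>j\<in>UNIV. \<Sum>i<K. uu i * (dl j (s i j) * s i j - l j (s i j)))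
        = (\<Sum>i<K. uu i * (\<Sum>j\<in>UNIV. dl j (s i j) * s i j - l j (s i j)))"
      unfolding sum_distrib_left by (rule sum.swap)
    finally show ?thesis .
  qed
  \<comment> \<open>The conjugate of \<open>R\<close> at an average is at most the average of the
    conjugates, and each of these suprema is attained at the corresponding
    \<open>bt i\<close>.\<close>
  define U where "U = (\<Sum>i<K. uu i * (- lin (\<lambda>j. dl j (s i j)) (bt i) - Rr (bt i))) / S"
  define c where "c = - ((1 / real CARD('n)) *\<^sub>R (transpose X *v wb))"
  have c: "c \<bullet> b = - lin (($) wb) b" for b unfolding c_def inner_minus_left inner_transpose ..
  have "fconj R c \<le> ereal U"
    unfolding fconj_def
  proof (rule SUP_least)
    fix b
    show "ereal (c \<bullet> b) - R b \<le> ereal U"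
    proof (cases "b \<in> edom R")
      case True
      obtain r where r: "R b = ereal r" using R_real[OF True] by blast
      have "S * lin (($) wb) b = (\<Sum>i<K. uu i * lin (\<lambda>j. dl j (s i j)) b)"
      proof -
        have "S * lin (($) wb) b = 1 / N * (\<Sum>j\<in>UNIV. (S * wb $ j) * (X $ j \<bullet> b))"
          by (simp add: lin_def sum_distrib_left mult_ac)
        also have "\<dots> = 1 / N * (\<Sum>j\<in>UNIV. \<Sum>i<K. uu i * (dl j (s i j) * (X $ j \<bullet> b)))"
          unfolding Swb_j by (simp add: sum_distrib_right mult.assoc)
        also have "(\<Sum>j\<in>UNIV. \<Sum>i<K. uu i * (dl j (s i j) * (X $ j \<bullet> b)))
            = (\<Sum>i<K. uu i * (\<Sum>j\<in>UNIV. dl j (s i j) * (X $ j \<bullet> b)))"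
          unfolding sum_distrib_left by (rule sum.swap)
        finally show ?thesis by (simp add: lin_def sum_distrib_left mult_ac)
      qed
      then have "S * (- lin (($) wb) b - r) = (\<Sum>i<K. uu i * (- lin (\<lambda>j. dl j (s i j)) b - r))"
        by (simp add: S_def sum_distrib_right right_diff_distrib sum_subtractf sum_negf)
      also have "\<dots> \<le> (\<Sum>i<K. uu i * (- lin (\<lambda>j. dl j (s i j)) (bt i) - Rr (bt i)))"
      proof (intro sum_mono mult_left_mono)
        fix i
        have "lin (\<lambda>j. dl j (s i j)) (bt i) + Rr (bt i) \<le> lin (\<lambda>j. dl j (s i j)) b + Rr b"
          using lm[of i] True by (simp add: lin_min_def)
        then show "- lin (\<lambda>j. dl j (s i j)) b - r \<le> - lin (\<lambda>j. dl j (s i j)) (bt i) - Rr (bt i)"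
          by (simp add: r)
      qed (use uu in \<open>auto simp: less_imp_le\<close>)
      finally show ?thesis using S by (simp add: c r U_def pos_le_divide_eq mult.commute)
    qed (simp add: R_outside)
  qed
  moreover have "ereal (c \<bullet> 0) - R 0 \<le> fconj R c" unfolding fconj_def by (rule SUP_upper) simp
  then have "fconj R c \<noteq> -\<infinity>" using R_real[OF R_zero] by (cases "R 0") auto
  ultimately obtain V where V: "fconj R c = ereal V" "V \<le> U"
    by (cases "fconj R c") auto
  obtain r where r: "R (bbar K) = ereal r" using R_real[OF bb(1)] by blast
  have gap: "gap = ereal (1 / N * (\<Sum>j\<in>UNIV. l j (A j)) + r + V + H)"
    unfolding gap_def primal_def dual_def c_def[symmetric] V H r A_def by (simp add: N_eq)
  then show "\<bar>gap\<bar> \<noteq> \<infinity>" by simp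
  have "S * real_of_ereal gap = S * (1 / N * (\<Sum>j\<in>UNIV. l j (A j))) + S * r + S * V + S * H"
    unfolding gap by (simp add: distrib_left)
  also have "\<dots> \<le> S * (1 / N * (\<Sum>j\<in>UNIV. l j (A j))) + (\<Sum>i<K. uu i * Rr (bt i))
      + (\<Sum>i<K. uu i * (- lin (\<lambda>j. dl j (s i j)) (bt i) - Rr (bt i)))
      + 1 / N * (\<Sum>i<K. uu i * (\<Sum>j\<in>UNIV. dl j (s i j) * s i j - l j (s i j)))"
  proof (intro add_mono order_refl SH)
    show "S * r \<le> (\<Sum>i<K. uu i * Rr (bt i))" using bb(3) by (simp add: r)
    have "S * V \<le> S * U" using V S by simp
    then show "S * V \<le> (\<Sum>i<K. uu i * (- lin (\<lambda>j. dl j (s i j)) (bt i) - Rr (bt i)))"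
      using S by (simp add: U_def)
  qed
  also have "\<dots> = 1 / N * ((\<Sum>j\<in>UNIV. S * l j (A j))
      - (\<Sum>i<K. uu i * (\<Sum>j\<in>UNIV. l j (s i j) + dl j (s i j) * (X $ j \<bullet> bt i - s i j))))"
  proof -
    have "uu i * Rr (bt i) + uu i * (- lin (\<lambda>j. dl j (s i j)) (bt i) - Rr (bt i))
        + 1 / N * (uu i * (\<Sum>j\<in>UNIV. dl j (s i j) * s i j - l j (s i j)))
      = - (1 / N * (uu i * (\<Sum>j\<in>UNIV. l j (s i j) + dl j (s i j) * (X $ j \<bullet> bt i - s i j))))" for i
    proof -
      have "v * r + v * (- (1 / N * x) - r) + 1 / N * (v * (y - z)) = - (1 / N * (v * (z + (x - y))))" for v r x y z :: real
        by (simp add: algebra_simps add_divide_distrib diff_divide_distrib)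
      moreover have "(\<Sum>j\<in>UNIV. l j (s i j) + dl j (s i j) * (X $ j \<bullet> bt i - s i j))
          = (\<Sum>j\<in>UNIV. l j (s i j)) + ((\<Sum>j\<in>UNIV. dl j (s i j) * (X $ j \<bullet> bt i)) - (\<Sum>j\<in>UNIV. dl j (s i j) * s i j))"
        by (simp only: sum.distrib right_diff_distrib sum_subtractf)
      ultimately show ?thesis unfolding lin_def sum_subtractf by (simp only:)
    qed
    then have "(\<Sum>i<K. uu i * Rr (bt i)) + (\<Sum>i<K. uu i * (- lin (\<lambda>j. dl j (s i j)) (bt i) - Rr (bt i)))
        + 1 / N * (\<Sum>i<K. uu i * (\<Sum>j\<in>UNIV. dl j (s i j) * s i j - l j (s i j)))
      = - (1 / N * (\<Sum>i<K. uu i * (\<Sum>j\<in>UNIV. l j (s i j) + dl j (s i j) * (X $ j \<bullet> bt i - s i j))))"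
      by (simp only: sum_distrib_left[where r = "1 / N"] sum.distrib[symmetric] sum_negf[symmetric])
    moreover have "S * (1 / N * (\<Sum>j\<in>UNIV. l j (A j))) = 1 / N * (\<Sum>j\<in>UNIV. S * l j (A j))"
      by (simp add: sum_distrib_left)
    ultimately show ?thesis unfolding right_diff_distrib by linarith
  qed
  also have "\<dots> \<le> 1 / N * ((\<Sum>j\<in>UNIV. nuK * l j (B j) - nu0 * l j 0 + nu0 * breg (l j) 0 (A j))
      - (\<Sum>i<K. uu i * (\<Sum>j\<in>UNIV. l j (s i j) + dl j (s i j) * (X $ j \<bullet> bt i - s i j))))"
  proof (intro mult_left_mono diff_right_mono sum_mono)
    fix j
    have N1: "1 \<le> N" unfolding N_eq using zero_less_card_finite[where 'a='n] by linarith
    have nu0: "0 \<le> nu0" using N1 by (simp add: nu)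
    have nuK: "nuK = nu0 + S" by (simp add: nu S_def)
    have "nuK * (l j (A j) + dl j (A j) * (B j - A j)) \<le> nuK * l j (B j)"
      using smooth_loss.above_tangent[OF losses, of j "A j" "B j"] nu0 S nuK by (intro mult_left_mono) auto
    moreover have "nuK * (B j - A j) = - (nu0 * A j)"
      using B[of j] SA[of j] unfolding nuK by (simp add: algebra_simps)
    then have "nuK * (l j (A j) + dl j (A j) * (B j - A j)) = nuK * l j (A j) - nu0 * (dl j (A j) * A j)"
      by (simp add: distrib_left mult.left_commute[of nuK])
    ultimately show "S * l j (A j) \<le> nuK * l j (B j) - nu0 * l j 0 + nu0 * breg (l j) 0 (A j)"
      unfolding nuK breg_def by (simp add: algebra_simps)
  qed (use N_pos in auto)
  also have "\<dots> = nu0 * (1 / N * (\<Sum>j\<in>UNIV. breg (l j) 0 (A j))) + 1 / N * ((\<Sum>j\<in>UNIV. nuK * l j (B j) - nu0 * l j 0)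
      - (\<Sum>i<K. uu i * (\<Sum>j\<in>UNIV. l j (s i j) + dl j (s i j) * (X $ j \<bullet> bt i - s i j))))"
    by (simp add: sum.distrib sum_distrib_left[symmetric] add_divide_distrib diff_divide_distrib)
  also have "\<dots> \<le> nu0 * D + 1 / N * ((\<Sum>j\<in>UNIV. nuK * l j (B j) - nu0 * l j 0)
      - (\<Sum>i<K. uu i * (\<Sum>j\<in>UNIV. l j (s i j) + dl j (s i j) * (X $ j \<bullet> bt i - s i j))))"
  proof (intro add_right_mono mult_left_mono)
    show "1 / N * (\<Sum>j\<in>UNIV. breg (l j) 0 (A j)) \<le> D"
      using D bb(1) unfolding dist_bound_iff A_def by blast
    have "1 \<le> N" unfolding N_eq using zero_less_card_finite[where 'a='n] by linarith
    then show "0 \<le> nu0" by (simp add: nu)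
  qed
  finally show "(\<Sum>i<K. uu i) * real_of_ereal gap \<le> nu0 * D + 1 / N * ((\<Sum>j\<in>UNIV. nuK * l j (B j) - nu0 * l j 0)
      - (\<Sum>i<K. uu i * (\<Sum>j\<in>UNIV. l j (s i j) + dl j (s i j) * (X $ j \<bullet> bt i - s i j))))"
    by (simp only: S_def)
qed

end

section \<open>Random runs\<close>

locale random_indices = prob_space \<Omega> for \<Omega> :: "'o measure" +
  fixes J :: "nat \<Rightarrow> 'o \<Rightarrow> 'n::finite"
  assumes iid: "iid_uniform \<Omega> J"
begin

primrec hist :: "nat \<Rightarrow> 'o \<Rightarrow> 'n list" where
  "hist 0 \<omega> = []"
| "hist (Suc i) \<omega> = J i \<omega> # hist i \<omega>"

lemma length_hist [simp]: "length (hist i \<omega>) = i" by (induction i) auto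

lemma hist_eq_iff: "hist i \<omega> = hist i \<omega>' \<longleftrightarrow> (\<forall>m<i. J m \<omega> = J m \<omega>')"
  by (induction i) (auto simp: less_Suc_eq)

lemma hist_eq_nth: "length h = k \<Longrightarrow> hist k \<omega> = h \<longleftrightarrow> (\<forall>i<k. J i \<omega> = rev h ! i)"
proof (induction k arbitrary: h)
  case (Suc k)
  then obtain i h' where h: "h = i # h'" "length h' = k" by (auto simp: length_Suc_conv)
  show ?case using Suc.IH[OF h(2)] h(2) by (auto simp: h(1) less_Suc_eq nth_append)
qed simp

lemma hist_event: "{\<omega> \<in> space \<Omega>. hist k \<omega> = h} \<in> events"
  and prob_hist: "length h = k \<Longrightarrow> prob {\<omega> \<in> space \<Omega>. hist k \<omega> = h} = 1 / real CARD('n) ^ k"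
proof -
  have indep: "indep_vars (\<lambda>_. count_space UNIV) J UNIV"
    and unif: "\<And>i j. prob {\<omega> \<in> space \<Omega>. J i \<omega> = j} = 1 / real CARD('n)"
    using iid by (auto simp: iid_uniform_def)
  have J: "J i \<in> measurable \<Omega> (count_space UNIV)" for i
    using indep by (simp add: indep_vars_def2)
  have vimage: "J i -` {j} \<inter> space \<Omega> = {\<omega> \<in> space \<Omega>. J i \<omega> = j}" for i j by auto
  \<comment> \<open>For \<open>k = 0\<close> the intersection over no index would be the whole type
    instead of \<open>space \<Omega>\<close>.\<close>
  have eq: "{\<omega> \<in> space \<Omega>. hist k \<omega> = h} = (\<Inter>i\<in>{..<k}. J i -` {rev h ! i} \<inter> space \<Omega>)"
    if "length h = k" "0 < k" using that by (auto simp: hist_eq_nth)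
  have sets: "J i -` {j} \<inter> space \<Omega> \<in> events" for i j
    using J by (rule measurable_sets) simp
  show "{\<omega> \<in> space \<Omega>. hist k \<omega> = h} \<in> events"
  proof (cases "length h = k \<and> 0 < k")
    case True
    have "(\<Inter>i\<in>{..<k}. J i -` {rev h ! i} \<inter> space \<Omega>) \<in> events"
      by (rule sets.finite_INT) (use True sets in auto)
    then show ?thesis using eq True by simp
  next
    case False
    then have "{\<omega> \<in> space \<Omega>. hist k \<omega> = h} = {} \<or> {\<omega> \<in> space \<Omega>. hist k \<omega> = h} = space \<Omega>" by auto
    then show ?thesis by (metis sets.empty_sets sets.top)
  qed
  show "prob {\<omega> \<in> space \<Omega>. hist k \<omega> = h} = 1 / real CARD('n) ^ k" if len: "length h = k"
  proof (cases "k = 0")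
    case True
    then show ?thesis using len by (simp add: prob_space)
  next
    case False
    then have "0 < k" by simp
    have "prob {\<omega> \<in> space \<Omega>. hist k \<omega> = h} = (\<Prod>i\<in>{..<k}. prob (J i -` {rev h ! i} \<inter> space \<Omega>))"
      unfolding eq[OF len \<open>0 < k\<close>] by (intro indep_varsD[OF indep]) (use \<open>0 < k\<close> in auto)
    also have "\<dots> = 1 / real CARD('n) ^ k" by (simp add: vimage unif power_one_over)
    finally show ?thesis .
  qed
qed

text \<open>Every history has positive probability and hence is realised. This transfers facts about
  runs to all lists, which the averages over lists range over.\<close>

lemma hist_surj: "\<exists>\<omega>\<in>space \<Omega>. hist (length h) \<omega> = h"
proof (rule ccontr)
  assume "\<not> ?thesis"
  then have "{\<omega> \<in> space \<Omega>. hist (length h) \<omega> = h} = {}" by auto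
  then have "prob {\<omega> \<in> space \<Omega>. hist (length h) \<omega> = h} = 0" by (simp only: measure_empty)
  then show False unfolding prob_hist[OF refl] by simp
qed

lemma has_integral_hist:
  fixes g :: "'n list \<Rightarrow> real"
  assumes f: "\<And>\<omega>. \<omega> \<in> space \<Omega> \<Longrightarrow> f \<omega> = g (hist k \<omega>)"
  shows "has_bochner_integral \<Omega> f (avg k g)"
proof -
  let ?H = "{h :: 'n list. length h = k}"
  let ?E = "\<lambda>h. {\<omega> \<in> space \<Omega>. hist k \<omega> = h}"
  have fin: "finite ?H" using finite_lists_length_eq[of "UNIV :: 'n set" k] by simp
  have sum: "has_bochner_integral \<Omega> (\<lambda>\<omega>. \<Sum>h\<in>?H. g h * indicator (?E h) \<omega>) (\<Sum>h\<in>?H. g h * prob (?E h))"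
    by (intro has_bochner_integral_sum has_bochner_integral_mult_right has_bochner_integral_real_indicator hist_event)
      (simp_all add: emeasure_eq_measure)
  have f_eq: "(\<Sum>h\<in>?H. g h * indicator (?E h) \<omega>) = f \<omega>" if "\<omega> \<in> space \<Omega>" for \<omega>
  proof -
    have "(\<Sum>h\<in>?H. g h * indicator (?E h) \<omega>) = (\<Sum>h\<in>?H. if h = hist k \<omega> then g h else 0)"
      using that by (intro sum.cong) (auto simp: indicator_def)
    also have "\<dots> = g (hist k \<omega>)" using fin by simp
    finally show ?thesis by (simp add: f[OF that])
  qed
  have avg: "(\<Sum>h\<in>?H. g h * prob (?E h)) = avg k g"
    by (simp add: avg_eq_sum prob_hist sum_divide_distrib)
  show ?thesis by (rule has_bochner_integral_cong[OF refl f_eq avg, THEN iffD1, OF _ sum])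
qed

lemma factor_through_hist:
  assumes "\<And>\<omega> \<omega>'. \<omega> \<in> space \<Omega> \<Longrightarrow> \<omega>' \<in> space \<Omega> \<Longrightarrow> hist k \<omega> = hist k \<omega>' \<Longrightarrow> f \<omega> = f \<omega>'"
  shows "\<exists>g. \<forall>\<omega>\<in>space \<Omega>. f \<omega> = g (hist k \<omega>)"
proof (intro exI ballI)
  fix \<omega> assume \<omega>: "\<omega> \<in> space \<Omega>"
  have "\<exists>\<omega>'. \<omega>' \<in> space \<Omega> \<and> hist k \<omega>' = hist k \<omega>" using \<omega> by blast
  note w = someI_ex[OF this]
  show "f \<omega> = (\<lambda>h. f (SOME \<omega>'. \<omega>' \<in> space \<Omega> \<and> hist k \<omega>' = h)) (hist k \<omega>)"
    by (rule assms[OF \<omega> conjunct1[OF w] conjunct2[OF w, symmetric]])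
qed

end

section \<open>A random run as a function on histories\<close>

locale random_run = problem X l R \<gamma> M N + random_indices \<Omega> J
  for X :: "real^'p^'n" and l R \<gamma> M N and \<Omega> :: "'o measure" and J :: "nat \<Rightarrow> 'o \<Rightarrow> 'n" +
  fixes \<eta> :: "nat \<Rightarrow> real" and bt :: "nat \<Rightarrow> 'o \<Rightarrow> real^'p" and w :: "nat \<Rightarrow> 'o \<Rightarrow> real^'n"
    and \<sigma> :: "'o \<Rightarrow> nat \<Rightarrow> 'n \<Rightarrow> real"
  assumes path: "\<omega> \<in> space \<Omega> \<Longrightarrow> fw_path \<eta> (\<lambda>i. J i \<omega>) (\<lambda>i. bt i \<omega>) (\<lambda>i. w i \<omega>) (\<sigma> \<omega>)"
    and past: "depends_on_past \<Omega> J bt"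
    and eta: "\<eta> i = 2 * N / (2 * N + real i + 1)"
begin

text \<open>The choice of the sample point is immaterial because \<open>bt\<close> depends only on
  the past.\<close>

definition \<beta> :: "'n list \<Rightarrow> real^'p" where
  "\<beta> h = bt (length h) (SOME \<omega>. \<omega> \<in> space \<Omega> \<and> hist (length h) \<omega> = h)"

lemma bt_eq: assumes \<omega>: "\<omega> \<in> space \<Omega>" shows "bt i \<omega> = \<beta> (hist i \<omega>)"
proof -
  define \<omega>' where "\<omega>' = (SOME \<omega>'. \<omega>' \<in> space \<Omega> \<and> hist i \<omega>' = hist i \<omega>)"
  have "\<omega>' \<in> space \<Omega> \<and> hist i \<omega>' = hist i \<omega>" unfolding \<omega>'_def by (rule someI_ex) (use \<omega> in blast)
  then have \<omega>': "\<omega>' \<in> space \<Omega>" "\<forall>m<i. J m \<omega> = J m \<omega>'" unfolding hist_eq_iff by auto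
  have "bt i \<omega> = bt i \<omega>'" using past \<omega> \<omega>' unfolding depends_on_past_def by blast
  then show ?thesis by (simp add: \<beta>_def \<omega>'_def)
qed

definition a :: "'n list \<Rightarrow> 'n \<Rightarrow> real" where "a h j = X $ j \<bullet> \<beta> h"

lemma a_le: "\<bar>a h j\<bar> \<le> M"
proof -
  obtain \<omega> where \<omega>: "\<omega> \<in> space \<Omega>" "hist (length h) \<omega> = h" using hist_surj by blast
  have "bt (length h) \<omega> \<in> edom R" using path[OF \<omega>(1)] by (simp add: fw_path_def lin_min_def)
  then have "\<beta> h \<in> edom R" unfolding bt_eq[OF \<omega>(1)] \<omega>(2) .
  then show ?thesis unfolding a_def by (rule X_le)
qed

sublocale tree: loss_tree a N M l \<gamma>
  by (intro loss_tree.intro coord_tree.intro loss_tree_axioms.intro N_eq a_le losses)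

lemma a_hist: "\<omega> \<in> space \<Omega> \<Longrightarrow> a (hist i \<omega>) j = X $ j \<bullet> bt i \<omega>"
  by (simp add: a_def bt_eq)

lemma \<sigma>_eq: assumes \<omega>: "\<omega> \<in> space \<Omega>" shows "\<sigma> \<omega> i = tree.s (hist i \<omega>)"
proof (induction i)
  case 0
  then show ?case using path[OF \<omega>] by (simp add: fw_path_def fun_eq_iff)
next
  case (Suc i)
  have "\<sigma> \<omega> (Suc i) j = tree.s (hist (Suc i) \<omega>) j" for j
    using path[OF \<omega>] unfolding fw_path_def
    by (simp add: Suc.IH eta tree.eta_def tree.u_def a_hist[OF \<omega>])
  then show ?case by (simp add: fun_eq_iff)
qed

lemma average_eq:
  assumes \<omega>: "\<omega> \<in> space \<Omega>"
  shows "tree.nu K * tree.b (hist K \<omega>) j = (\<Sum>i<K. uu i * (X $ j \<bullet> bt i \<omega>))"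
proof (induction K)
  case (Suc K)
  have u: "2 \<le> tree.u K" by (rule tree.u_ge)
  have nu: "tree.nu (Suc K) = (tree.u K + 1) * tree.u K / 2" by (simp add: tree.nu_def tree.u_Suc)
  have step: "tree.nu (Suc K) * (2 / (tree.u K + 1) * x) = tree.u K * x" for x
    using u unfolding nu by simp
  have "tree.nu (Suc K) * tree.b (hist (Suc K) \<omega>) j
      = tree.nu (Suc K) * tree.b (hist K \<omega>) j + tree.u K * (a (hist K \<omega>) j - tree.b (hist K \<omega>) j)"
    unfolding hist.simps tree.b.simps length_hist distrib_left step ..
  also have "\<dots> = tree.nu K * tree.b (hist K \<omega>) j + tree.u K * a (hist K \<omega>) j"
    unfolding tree.nu_Suc by (simp add: algebra_simps)
  finally show ?case unfolding Suc.IH a_hist[OF \<omega>] by (simp add: tree.u_def)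
qed simp

lemma tangent_eq:
  assumes \<omega>: "\<omega> \<in> space \<Omega>"
  shows "tree.tangent_sum (hist K \<omega>) = (\<Sum>i<K. uu i *
    (\<Sum>j\<in>UNIV. l j (\<sigma> \<omega> i j) + dl j (\<sigma> \<omega> i j) * (X $ j \<bullet> bt i \<omega> - \<sigma> \<omega> i j)))"
  by (induction K) (simp_all add: \<sigma>_eq[OF \<omega>] a_hist[OF \<omega>] tree.u_def)

lemma w_eq: "\<omega> \<in> space \<Omega> \<Longrightarrow> w i \<omega> = dL (tree.s (hist i \<omega>))"
  using path[of \<omega>] \<sigma>_eq[of \<omega>] by (simp add: fw_path_def)

lemma avg_regret_le: "avg K tree.regret \<le> 4 * N\<^sup>2 * \<gamma> * M\<^sup>2 * real K"
proof (rule tree.avg_regret_bound)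
  fix \<epsilon> :: real assume "0 < \<epsilon>"
  from near_opt[OF this] obtain c where c: "\<And>j. \<bar>c j\<bar> \<le> M"
    "\<And>s b. lin_min (\<lambda>j. dl j (s j)) b \<Longrightarrow>
      (\<Sum>j\<in>UNIV. (dl j (s j) - dl j (c j)) * (X $ j \<bullet> b - s j) + breg (l j) (s j) (c j)) \<le> \<epsilon>"
    by (elim exE conjE) blast
  have "(\<Sum>j\<in>UNIV. (dl j (tree.s h j) - dl j (c j)) * (a h j - tree.s h j)
      + breg (l j) (tree.s h j) (c j)) \<le> \<epsilon>" for h
  proof -
    obtain \<omega> where \<omega>: "\<omega> \<in> space \<Omega>" "hist (length h) \<omega> = h" using hist_surj by blast
    have "lin_min (\<lambda>j. dl j (\<sigma> \<omega> (length h) j)) (bt (length h) \<omega>)"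
      using path[OF \<omega>(1)] by (simp add: fw_path_def)
    then have "lin_min (\<lambda>j. dl j (tree.s h j)) (\<beta> h)"
      by (simp add: \<sigma>_eq[OF \<omega>(1)] bt_eq[OF \<omega>(1)] \<omega>(2))
    from c(2)[OF this] show ?thesis by (simp add: a_def)
  qed
  with c(1) show "\<exists>c. (\<forall>j. \<bar>c j\<bar> \<le> M) \<and> (\<forall>h. (\<Sum>j\<in>UNIV.
      (dl j (tree.s h j) - dl j (c j)) * (a h j - tree.s h j) + breg (l j) (tree.s h j) (c j)) \<le> \<epsilon>)"
    by blast
qed

lemma nu_sum: "tree.nu K = tree.nu 0 + (\<Sum>i<K. uu i)"
  by (induction K) (simp_all add: tree.nu_Suc tree.u_def)

context
  fixes \<alpha> :: "nat \<Rightarrow> real" and bbar :: "nat \<Rightarrow> 'o \<Rightarrow> real^'p" and wbar :: "'o \<Rightarrow> real^'n"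
    and gap :: "'o \<Rightarrow> ereal" and k :: nat
  assumes av: "\<omega> \<in> space \<Omega> \<Longrightarrow> averages \<alpha> (\<lambda>i. bt i \<omega>) (\<lambda>i. bbar i \<omega>)"
    and alpha: "\<alpha> i = 2 * (2 * N + real i) / ((real i + 1) * (4 * N + real i))"
    and wbar: "wbar \<omega> = (2 / ((4 * N + real k) * (real k + 1))) *\<^sub>R (\<Sum>i=0..k. (2 * N + real i) *\<^sub>R w i \<omega>)"
    and gap: "gap \<omega> = primal X l R (bbar (Suc k) \<omega>) - dual X l R (wbar \<omega>)"
begin

lemma wbar_sum: "wbar \<omega> = (1 / (\<Sum>i<Suc k. uu i)) *\<^sub>R (\<Sum>i<Suc k. uu i *\<^sub>R w i \<omega>)"
proof -
  have "1 / (\<Sum>i<Suc k. uu i) = 2 / ((4 * N + real k) * (real k + 1))"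
    unfolding sum_uu by (simp add: algebra_simps)
  then show ?thesis unfolding wbar by (simp only: atLeast0AtMost lessThan_Suc_atMost)
qed

lemma gap_bound:
  assumes \<omega>: "\<omega> \<in> space \<Omega>" and D: "dist_bound X l R (dL (\<lambda>_. 0)) D"
  shows "\<bar>gap \<omega>\<bar> \<noteq> \<infinity>"
    and "(\<Sum>i<Suc k. uu i) * real_of_ereal (gap \<omega>) \<le> tree.nu 0 * D + 1 / N * tree.regret (hist (Suc k) \<omega>)"
proof -
  have nu0: "tree.nu 0 = 2 * N * (2 * N - 1) / 2" by (simp add: tree.nu_def tree.u_def)
  note g = gap_le[OF path[OF \<omega>] av[OF \<omega>] alpha zero_less_Suc wbar_sum D nu0 nu_sum average_eq[OF \<omega>],
      folded tangent_eq[OF \<omega>], folded gap]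
  show "\<bar>gap \<omega>\<bar> \<noteq> \<infinity>" by (rule g(1))
  show "(\<Sum>i<Suc k. uu i) * real_of_ereal (gap \<omega>) \<le> tree.nu 0 * D + 1 / N * tree.regret (hist (Suc k) \<omega>)"
    using g(2) by (simp only: tree.regret_def length_hist)
qed

text \<open>Measurability and integrability of the gap rest on this: a function of the history is
  constant on each of finitely many events.\<close>

lemma gap_determined:
  assumes \<omega>: "\<omega> \<in> space \<Omega>" "\<omega>' \<in> space \<Omega>" "hist (Suc k) \<omega> = hist (Suc k) \<omega>'"
  shows "gap \<omega> = gap \<omega>'"
proof -
  have hist: "hist i \<omega> = hist i \<omega>'" if "i \<le> Suc k" for i
    using \<omega>(3) that unfolding hist_eq_iff by auto
  have "bbar i \<omega> = bbar i \<omega>'" if "i \<le> Suc k" for i using that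
  proof (induction i)
    case (Suc i)
    then show ?case using av[OF \<omega>(1)] av[OF \<omega>(2)]
      by (simp add: averages_def bt_eq[OF \<omega>(1)] bt_eq[OF \<omega>(2)] hist[of i])
  qed (use av[OF \<omega>(1)] av[OF \<omega>(2)] in \<open>simp add: averages_def\<close>)
  moreover have "wbar \<omega> = wbar \<omega>'"
    unfolding wbar by (simp add: w_eq[OF \<omega>(1)] w_eq[OF \<omega>(2)] hist)
  ultimately show ?thesis by (simp add: gap)
qed

lemma integrable_gap: "integrable \<Omega> (\<lambda>\<omega>. real_of_ereal (gap \<omega>))"
  and integral_gap_le: "dist_bound X l R (dL (\<lambda>_. 0)) D \<Longrightarrow> (\<integral>\<omega>. real_of_ereal (gap \<omega>) \<partial>\<Omega>)
    \<le> 8 * N * \<gamma> * M\<^sup>2 / (4 * N + real k) + 2 * N * (2 * N - 1) * D / ((4 * N + real k) * (real k + 1))"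
proof -
  obtain g where g: "\<And>\<omega>. \<omega> \<in> space \<Omega> \<Longrightarrow> real_of_ereal (gap \<omega>) = g (hist (Suc k) \<omega>)"
    using factor_through_hist[of "Suc k" "\<lambda>\<omega>. real_of_ereal (gap \<omega>)"] gap_determined by metis
  have int: "has_bochner_integral \<Omega> (\<lambda>\<omega>. real_of_ereal (gap \<omega>)) (avg (Suc k) g)"
    by (rule has_integral_hist) (rule g)
  show "integrable \<Omega> (\<lambda>\<omega>. real_of_ereal (gap \<omega>))" using int by (rule integrable.intros)
  assume D: "dist_bound X l R (dL (\<lambda>_. 0)) D"
  define S where "S = (\<Sum>i<Suc k. uu i)"
  have S: "S = (4 * N + real k) * (real k + 1) / 2" unfolding S_def sum_uu by (simp add: mult.commute)
  have pos: "0 < 4 * N + real k" "0 < real k + 1" using N_pos by auto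
  then have S0: "0 < S" by (simp add: S)
  have "S * avg (Suc k) g = avg (Suc k) (\<lambda>h. S * g h)" by (rule avg_cmult[symmetric])
  also have "\<dots> \<le> avg (Suc k) (\<lambda>h. tree.nu 0 * D + 1 / N * tree.regret h)"
  proof (rule avg_mono)
    fix h :: "'n list" assume "length h = Suc k"
    then obtain \<omega> where \<omega>: "\<omega> \<in> space \<Omega>" "hist (Suc k) \<omega> = h" using hist_surj[of h] by auto
    show "S * g h \<le> tree.nu 0 * D + 1 / N * tree.regret h"
      using gap_bound(2)[OF \<omega>(1) D] unfolding g[OF \<omega>(1)] \<omega>(2) S_def .
  qed
  also have "\<dots> = tree.nu 0 * D + 1 / N * avg (Suc k) tree.regret"
    unfolding avg_add avg_cmult avg_const ..
  also have "\<dots> \<le> tree.nu 0 * D + 1 / N * (4 * N\<^sup>2 * \<gamma> * M\<^sup>2 * real (Suc k))"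
    by (intro add_left_mono mult_left_mono avg_regret_le) (use N_pos in simp)
  also have "\<dots> = N * (2 * N - 1) * D + 4 * N * \<gamma> * M\<^sup>2 * (real k + 1)"
    using N_pos by (simp add: tree.nu_def tree.u_def power2_eq_square add.commute)
  also have "\<dots> = S * (8 * N * \<gamma> * M\<^sup>2 / (4 * N + real k) + 2 * N * (2 * N - 1) * D / ((4 * N + real k) * (real k + 1)))"
  proof -
    have "x + y * q = p * q / 2 * (2 * y / p + 2 * x / (p * q))" if "0 < p" "0 < q" for x y p q :: real
      using that by (simp add: field_simps)
    from this[OF pos, of "N * (2 * N - 1) * D" "4 * N * \<gamma> * M\<^sup>2"] show ?thesis
      unfolding S by (simp add: mult.assoc)
  qed
  finally have "avg (Suc k) g \<le> 8 * N * \<gamma> * M\<^sup>2 / (4 * N + real k) + 2 * N * (2 * N - 1) * D / ((4 * N + real k) * (real k + 1))"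
    using S0 by (simp only: mult_le_cancel_left_pos)
  then show "(\<integral>\<omega>. real_of_ereal (gap \<omega>) \<partial>\<Omega>)
      \<le> 8 * N * \<gamma> * M\<^sup>2 / (4 * N + real k) + 2 * N * (2 * N - 1) * D / ((4 * N + real k) * (real k + 1))"
    using has_bochner_integral_integral_eq[OF int] by (simp only:)
qed

end

end

theorem theorem3p1:
  fixes X :: "real^'p^'n"
    and l :: "'n \<Rightarrow> real \<Rightarrow> real"
    and R :: "real^'p \<Rightarrow> ereal"
    and \<gamma> M :: real
    and n :: nat
    and \<alpha> \<eta> :: "nat \<Rightarrow> real"
    and \<Omega> :: "'o measure"
    and J :: "nat \<Rightarrow> 'o \<Rightarrow> 'n"
    and bt bbar :: "nat \<Rightarrow> 'o \<Rightarrow> real^'p"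
    and w wbar :: "nat \<Rightarrow> 'o \<Rightarrow> real^'n"
    and gap :: "nat \<Rightarrow> 'o \<Rightarrow> ereal"
  assumes n_eq: "n = CARD('n)"
    and losses: "\<And>j. strictly_convex (l j)" "\<And>j. smooth_with \<gamma> (l j)"
    and R: "econvex R" "bounded (edom R)" "0 \<in> edom R"
    and attained: "\<And>c. \<exists>b. is_arg_min (\<lambda>b. ereal (c \<bullet> b) + R b) (\<lambda>_. True) b"
    and M_eq: "M = data_bound X R"
    and alpha: "\<And>i. \<alpha> i = 2 * (2 * real n + real i) / ((real i + 1) * (4 * real n + real i))"
    and eta: "\<And>i. \<eta> i = 2 * real n / (2 * real n + real i + 1)"
    and prob: "prob_space \<Omega>"
    and indices: "iid_uniform \<Omega> J"
    and past: "depends_on_past \<Omega> J bt"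
    and run: "(\<exists>s d. \<forall>\<omega>\<in>space \<Omega>. sgfw_run X l R \<alpha> \<eta> (\<lambda>i. J i \<omega>) (\<lambda>i. bt i \<omega>) (\<lambda>i. bbar i \<omega>)
                 (\<lambda>i. s i \<omega>) (\<lambda>i. d i \<omega>) (\<lambda>i. w i \<omega>))
            \<or> (\<forall>\<omega>\<in>space \<Omega>. rdcmd_run X l R \<alpha> \<eta> (\<lambda>i. J i \<omega>) (\<lambda>i. bt i \<omega>) (\<lambda>i. bbar i \<omega>)
                 (\<lambda>i. w i \<omega>))"
    and wbar_eq: "\<And>k \<omega>. wbar k \<omega> = (2 / ((4 * real n + real k) * (real k + 1))) *\<^sub>R
                    (\<Sum>i=0..k. (2 * real n + real i) *\<^sub>R w i \<omega>)"
    and gap_eq: "\<And>k \<omega>. gap k \<omega> = primal X l R (bbar (Suc k) \<omega>) - dual X l R (wbar k \<omega>)"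
  shows "(\<forall>k. (\<forall>\<omega>\<in>space \<Omega>. \<bar>gap k \<omega>\<bar> \<noteq> \<infinity>) \<and> integrable \<Omega> (\<lambda>\<omega>. real_of_ereal (gap k \<omega>)))
    \<and> (\<forall>Dmax. (\<forall>\<omega>\<in>space \<Omega>. dist_bound X l R (w 0 \<omega>) Dmax) \<longrightarrow>
         (\<forall>k. (\<integral>\<omega>. real_of_ereal (gap k \<omega>) \<partial>\<Omega>)
            \<le> 8 * real n * \<gamma> * M\<^sup>2 / (4 * real n + real k)
              + 2 * real n * (2 * real n - 1) * Dmax / ((4 * real n + real k) * (real k + 1))))
    \<and> (\<exists>Dmax\<le>\<gamma> * M\<^sup>2. \<forall>\<omega>\<in>space \<Omega>. dist_bound X l R (w 0 \<omega>) Dmax)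
    \<and> (\<forall>Dmax\<le>\<gamma> * M\<^sup>2. \<forall>k::nat.
         8 * real n * \<gamma> * M\<^sup>2 / (4 * real n + real k)
           + 2 * real n * (2 * real n - 1) * Dmax / ((4 * real n + real k) * (real k + 1))
         \<le> 8 * real n * \<gamma> * M\<^sup>2 / (4 * real n + real k)
           + 2 * real n * (2 * real n - 1) * (\<gamma> * M\<^sup>2) / ((4 * real n + real k) * (real k + 1)))
    \<and> (\<forall>k. (\<integral>\<omega>. real_of_ereal (gap k \<omega>) \<partial>\<Omega>)
         \<le> 8 * real n * \<gamma> * M\<^sup>2 / (4 * real n + real k)
           + 2 * real n * (2 * real n - 1) * (\<gamma> * M\<^sup>2) / ((4 * real n + real k) * (real k + 1)))"
proof -
  interpret problem X l R \<gamma> M "real n"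
    by (intro problem.intro smooth_loss.intro losses R attained M_eq) (simp add: n_eq)
  interpret random_indices \<Omega> J
    by (intro random_indices.intro random_indices_axioms.intro prob indices)
  have av: "averages \<alpha> (\<lambda>i. bt i \<omega>) (\<lambda>i. bbar i \<omega>)" if "\<omega> \<in> space \<Omega>" for \<omega>
    using run that by (auto simp: sgfw_run_def rdcmd_run_def)
  have "\<exists>\<sigma>. \<forall>\<omega>\<in>space \<Omega>. fw_path \<eta> (\<lambda>i. J i \<omega>) (\<lambda>i. bt i \<omega>) (\<lambda>i. w i \<omega>) (\<sigma> \<omega>)"
    using run
  proof (elim disjE exE)
    fix s d assume s: "\<forall>\<omega>\<in>space \<Omega>. sgfw_run X l R \<alpha> \<eta> (\<lambda>i. J i \<omega>) (\<lambda>i. bt i \<omega>)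
      (\<lambda>i. bbar i \<omega>) (\<lambda>i. s i \<omega>) (\<lambda>i. d i \<omega>) (\<lambda>i. w i \<omega>)"
    show ?thesis
      by (intro exI[of _ "\<lambda>\<omega> i j. s i \<omega> $ j"] ballI) (rule sgfw_path[OF bspec[OF s]])
  next
    assume r: "\<forall>\<omega>\<in>space \<Omega>. rdcmd_run X l R \<alpha> \<eta> (\<lambda>i. J i \<omega>) (\<lambda>i. bt i \<omega>)
      (\<lambda>i. bbar i \<omega>) (\<lambda>i. w i \<omega>)"
    show ?thesis
      by (intro bchoice ballI) (rule rdcmd_path[OF bspec[OF r]])
  qed
  then obtain \<sigma> where "\<forall>\<omega>\<in>space \<Omega>. fw_path \<eta> (\<lambda>i. J i \<omega>) (\<lambda>i. bt i \<omega>) (\<lambda>i. w i \<omega>) (\<sigma> \<omega>)"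
    by (elim exE)
  note \<sigma> = bspec[OF this]
  interpret random_run X l R \<gamma> M "real n" \<Omega> J \<eta> bt w \<sigma>
    by unfold_locales (rule \<sigma> past eta | assumption)+
  have w0: "w 0 \<omega> = dL (\<lambda>_. 0)" if "\<omega> \<in> space \<Omega>" for \<omega>
    using \<sigma>[OF that] by (simp add: fw_path_def)
  have finite: "\<bar>gap k \<omega>\<bar> \<noteq> \<infinity>" if "\<omega> \<in> space \<Omega>" for k \<omega>
    by (rule gap_bound(1)[where \<alpha> = \<alpha> and bbar = bbar and wbar = "wbar k" and gap = "gap k" and k = k,
          OF _ alpha wbar_eq gap_eq that dist_bound_gamma, OF av])
  have integrable: "integrable \<Omega> (\<lambda>\<omega>. real_of_ereal (gap k \<omega>))" for k
    by (rule integrable_gap[where \<alpha> = \<alpha> and bbar = bbar and wbar = "wbar k" and gap = "gap k" and k = k,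
          OF _ alpha wbar_eq gap_eq, OF av])
  have le: "(\<integral>\<omega>. real_of_ereal (gap k \<omega>) \<partial>\<Omega>)
      \<le> 8 * real n * \<gamma> * M\<^sup>2 / (4 * real n + real k)
        + 2 * real n * (2 * real n - 1) * D / ((4 * real n + real k) * (real k + 1))"
    if "dist_bound X l R (dL (\<lambda>_. 0)) D" for k D
    by (rule integral_gap_le[where \<alpha> = \<alpha> and bbar = bbar and wbar = "wbar k" and gap = "gap k" and k = k,
          OF _ alpha wbar_eq gap_eq that, OF av])
  obtain \<omega>\<^sub>0 where \<omega>\<^sub>0: "\<omega>\<^sub>0 \<in> space \<Omega>" using not_empty by blast
  have "1 \<le> real n" unfolding n_eq using zero_less_card_finite[where 'a='n] by linarith
  then have mono: "2 * real n * (2 * real n - 1) * D / ((4 * real n + real k) * (real k + 1))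
      \<le> 2 * real n * (2 * real n - 1) * (\<gamma> * M\<^sup>2) / ((4 * real n + real k) * (real k + 1))"
    if "D \<le> \<gamma> * M\<^sup>2" for D k
    using that by (intro divide_right_mono mult_left_mono) auto
  show ?thesis
  proof (intro conjI allI impI)
    fix k D assume D: "\<forall>\<omega>\<in>space \<Omega>. dist_bound X l R (w 0 \<omega>) D"
    \<comment> \<open>All runs start at the same dual point, so one sample point suffices to read
      off the hypothesis on \<open>D\<close>.\<close>
    have "dist_bound X l R (dL (\<lambda>_. 0)) D" using bspec[OF D \<omega>\<^sub>0] unfolding w0[OF \<omega>\<^sub>0] .
    then show "(\<integral>\<omega>. real_of_ereal (gap k \<omega>) \<partial>\<Omega>)
      \<le> 8 * real n * \<gamma> * M\<^sup>2 / (4 * real n + real k)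
        + 2 * real n * (2 * real n - 1) * D / ((4 * real n + real k) * (real k + 1))" by (rule le)
  next
    show "\<exists>Dmax\<le>\<gamma> * M\<^sup>2. \<forall>\<omega>\<in>space \<Omega>. dist_bound X l R (w 0 \<omega>) Dmax"
      using dist_bound_gamma w0 by (intro exI[of _ "\<gamma> * M\<^sup>2"]) simp
  qed (use finite integrable le[OF dist_bound_gamma] mono in auto)
qed

end
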